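(* Let $h\in C^2(\mathbb{R}^n)$ and $\mu>0$. Let $f:\mathbb{R}^n\to\mathbb{R}$, $f(x)=h(x)+\mu\|x\|_1$, and $F:\mathbb{R}^n\times\mathbb{R}^n\to\mathbb{R}$, $F(a,b)=h(a^2-b^2)+\mu\sum_{i=1}^n(a_i^2+b_i^2)$. Let $\theta_0\in(0,\infty)$, $\kappa\in(0,1)$, $\Gamma=\{\kappa^k\theta_0: k\in\mathbb{N}\}$, and $\mathcal{G}_\theta(a,b):=(a,b)-\theta\nabla F(a,b)$. Assume that: (A1) for each $\theta\in\Gamma$, there exists an open set $U_\theta\subseteq\mathbb{R}^{2n}$, whose complement has zero Lebesgue measure, such that $\det(D\mathcal{G}_\theta)$ is nonzero on $U_\theta$, where $D\mathcal{G}_\theta$ is the Jacobian of $\mathcal{G}_\theta$; (A2) the function $F$ is level bounded; (A3) the function $F$ satisfies the KL property at each of its stationary points. Then there exists a subset $V\subseteq\mathbb{R}^{2n}$, whose complement has zero Lebesgue measure, such that if $(a^0,b^0)\in V$, then the sequence $\{(a^k,b^k)\}$ generated by gradient descent with backtracking linesearch (defined in the context) with initial point $(a^0,b^0)$, initial stepsize $\theta_0$ and parameter $\kappa$ converges to a second-order stationary point $(a^*,b^* )$ of $F$. Moreover, in this case, denote $s^*=(a^* )^2-(b^* )^2$ and assume in addition that $f$ satisfies the KL property at $s^*$ with exponent $\alpha\in(0,1)$. Then the following statements hold. (i) If $-\nabla h(s^* )\in\mathrm{ri}(\mu\,\partial\|s^*\|_1)$, then $\|(a^k,b^k)-(a^*,b^*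 )\|=O\big(k^{-\frac{1-\alpha}{2\alpha-1}}\big)$ if $\alpha\in(\frac12,1)$, and $\|(a^k,b^k)-(a^*,b^* )\|=O(c^k)$ for some $c\in(0,1)$ if $\alpha\in(0,\frac12]$. (ii) Suppose $h$ is convex and there exist a neighborhood $W$ of $s^*$ and constants $c>0$, $\gamma\in(0,1]$ such that for all $\rho\in\mathbb{R}^{J_3}_+$, $$\mathrm{dist}(x,\Omega\cap S_\rho)\le c\,\max\{\mathrm{dist}(x,\Omega),\mathrm{dist}(x,S_\rho)\}^\gamma\qquad\forall x\in W\cap(s^*+K),$$ where $\Omega=\{x\in\mathbb{R}^n: f(x)=f(s^* )\}$, $J_3=\{i: s^*_i=0,\ \nabla h(s^* )_i\in\{-\mu,\mu\}\}$, $S_\rho=\{x\in\mathbb{R}^n:|x_i-s^*_i|\le\rho_i\ \ \forall i\in J_3\}$ and $K=N_{\mu\partial\|s^*\|_1}(-\nabla h(s^* ))$. Then $\|(a^k,b^k)-(a^*,b^* )\|=O\big(k^{-\frac{1-\beta}{2\beta}}\big)$, where $\beta=1-\gamma(1-\alpha)$.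
   Context: For $a\in\mathbb{R}^n$, $a^2$ denotes the componentwise square; $\mathbb{N}$ includes $0$; $\mathrm{ri}$ denotes relative interior; $\partial\|s\|_1$ is the convex subdifferential of the $\ell_1$-norm at $s$; $N_C(x)=\{\xi:\langle\xi,y-x\rangle\le0\ \forall y\in C\}$ is the normal cone of a closed convex set $C$ at $x\in C$ (at a second-order stationary point $(a^*,b^* )$ of $F$ one has $-\nabla h(s^* )\in\mu\,\partial\|s^*\|_1$, so $K$ is well defined). $F$ is level bounded if all its sublevel sets $\{F\le t\}$, $t\in\mathbb{R}$, are bounded. A stationary point of $F$ is a point where $\nabla F=0$; a second-order stationary point of $F$ is a point where $\nabla F=0$ and $\nabla^2F\succeq0$. Gradient descent with backtracking linesearch: given initial $(a^0,b^0)\in\mathbb{R}^n\times\mathbb{R}^n$, initial stepsize $\theta_0\in(0,\infty)$, and $\kappa\in(0,1)$, set $\theta=\theta_0$. For $k=0,1,2,\dots$: set $(a^{k+1},b^{k+1})=(a^k,b^k)-\theta\nabla F(a^k,b^k)$; while $F(a^{k+1},b^{k+1})>F(a^k,b^k)-\frac{\theta^2}{2}\|\nabla F(a^k,b^k)\|^2$, replace $\theta$ by $\kappa\theta$ and recompute $(a^{k+1},b^{k+1})=(a^k,b^k)-\theta\nabla F(a^k,b^k)$. (The value of $\theta$ is carried over from one iteration to the next and is not reset.) KL property: for a proper closed function $g:\mathbb{R}^m\to\mathbb{R}\cup\{\infty\}$, $\partial g$ denotes the limiting subdifferential (equal to $\{\nabla g(x)\}$ if $g$ is $C^1$, and to $\nabla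 g_1+\partial g_2$ if $g=g_1+g_2$ with $g_1\in C^1$ and $g_2$ proper closed convex). The function $g$ satisfies the Kurdyka-Łojasiewicz (KL) property at $\bar x$ (with $\partial g(\bar x)\neq\emptyset$) if there are $r\in(0,\infty]$, a neighborhood $V$ of $\bar x$ and a continuous concave function $\varphi:[0,r)\to[0,\infty)$ with $\varphi(0)=0$, continuously differentiable on $(0,r)$ with $\varphi'>0$ there, such that for every $x\in V$ with $0<g(x)-g(\bar x)<r$ one has $\varphi'(g(x)-g(\bar x))\,\mathrm{dist}(0,\partial g(x))\ge1$ (with $\mathrm{dist}(0,\emptyset)=\infty$). If $\varphi$ can be chosen as $\varphi(t)=\bar c\,t^{1-\alpha}$ for some $\bar c>0$ and $\alpha\in[0,1)$, then $g$ satisfies the KL property at $\bar x$ with exponent $\alpha$. *)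

theory Defs
  imports
    "HOL-Analysis.Analysis"
    "HOL-Library.Landau_Symbols"
    "HOL-Library.While_Combinator"
begin

section \<open>Smooth functions\<close>

definition grad :: "('a::euclidean_space \<Rightarrow> real) \<Rightarrow> 'a \<Rightarrow> 'a" where
  "grad f x = (THE D. GDERIV f x :> D)"

definition C2_fun :: "('a::euclidean_space \<Rightarrow> real) \<Rightarrow> bool" where
  "C2_fun f \<longleftrightarrow> (\<exists>(g :: 'a \<Rightarrow> 'a) (H :: 'a \<Rightarrow> 'a \<Rightarrow>\<^sub>L 'a).
     (\<forall>x. GDERIV f x :> g x) \<and>
     (\<forall>x. (g has_derivative blinfun_apply (H x)) (at x)) \<and>
     continuous_on UNIV H)"

definition hess :: "('a::euclidean_space \<Rightarrow> real) \<Rightarrow> 'a \<Rightarrow> 'a \<Rightarrow> 'a" where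
  "hess f x = frechet_derivative (grad f) (at x)"

definition stationary :: "('a::euclidean_space \<Rightarrow> real) \<Rightarrow> 'a \<Rightarrow> bool" where
  "stationary f x \<longleftrightarrow> grad f x = 0"

definition second_order_stationary :: "('a::euclidean_space \<Rightarrow> real) \<Rightarrow> 'a \<Rightarrow> bool" where
  "second_order_stationary f x \<longleftrightarrow> grad f x = 0 \<and> (\<forall>v. v \<bullet> hess f x v \<ge> 0)"

definition level_bounded :: "('a::euclidean_space \<Rightarrow> real) \<Rightarrow> bool" where
  "level_bounded f \<longleftrightarrow> (\<forall>t. bounded {x. f x \<le> t})"


section \<open>Jacobian determinant on a product space\<close>

text \<open>The library's \<^const>\<open>det\<close> and \<^const>\<open>jacobian\<close> are for maps between spaces \<open>real ^ 'm\<close>;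
  the space \<open>real ^ 'n \<times> real ^ 'n\<close> is given the coordinates indexed by \<open>'n + 'n\<close>.\<close>

definition join_vec :: "(real ^ 'n) \<times> (real ^ 'n) \<Rightarrow> real ^ ('n + 'n)" where
  "join_vec z = (\<chi> i. case i of Inl j \<Rightarrow> fst z $ j | Inr j \<Rightarrow> snd z $ j)"

definition split_vec :: "real ^ ('n + 'n) \<Rightarrow> (real ^ 'n) \<times> (real ^ 'n)" where
  "split_vec v = ((\<chi> j. v $ Inl j), (\<chi> j. v $ Inr j))"

definition jacobian_det ::
    "((real ^ 'n) \<times> (real ^ 'n) \<Rightarrow> (real ^ 'n) \<times> (real ^ 'n)) \<Rightarrow> (real ^ 'n) \<times> (real ^ 'n) \<Rightarrow> real" where
  "jacobian_det G z = det (jacobian (\<lambda>v. join_vec (G (split_vec v))) (at (join_vec z)))"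


section \<open>Gradient descent with backtracking linesearch\<close>

definition gd_map :: "('a::euclidean_space \<Rightarrow> real) \<Rightarrow> real \<Rightarrow> 'a \<Rightarrow> 'a" where
  "gd_map F \<theta> z = z - \<theta> *\<^sub>R grad F z"

definition backtrack :: "('a::euclidean_space \<Rightarrow> real) \<Rightarrow> real \<Rightarrow> 'a \<Rightarrow> real \<Rightarrow> real" where
  "backtrack F \<kappa> z = while
     (\<lambda>\<theta>. F (gd_map F \<theta> z) > F z - \<theta>\<^sup>2 / 2 * (norm (grad F z))\<^sup>2)
     (\<lambda>\<theta>. \<kappa> * \<theta>)"

text \<open>The state is the current iterate together with the stepsize carried over.\<close>

fun gd_state :: "('a::euclidean_space \<Rightarrow> real) \<Rightarrow> real \<Rightarrow> real \<Rightarrow> 'a \<Rightarrow> nat \<Rightarrow> 'a \<times> real" where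
  "gd_state F \<theta>\<^sub>0 \<kappa> z\<^sub>0 0 = (z\<^sub>0, \<theta>\<^sub>0)"
| "gd_state F \<theta>\<^sub>0 \<kappa> z\<^sub>0 (Suc k) =
     (let (z, \<theta>) = gd_state F \<theta>\<^sub>0 \<kappa> z\<^sub>0 k; \<theta>' = backtrack F \<kappa> z \<theta>
      in (gd_map F \<theta>' z, \<theta>'))"

definition gd_iterate :: "('a::euclidean_space \<Rightarrow> real) \<Rightarrow> real \<Rightarrow> real \<Rightarrow> 'a \<Rightarrow> nat \<Rightarrow> 'a" where
  "gd_iterate F \<theta>\<^sub>0 \<kappa> z\<^sub>0 k = fst (gd_state F \<theta>\<^sub>0 \<kappa> z\<^sub>0 k)"


section \<open>Subdifferentials and normal cones\<close>

definition convex_subdiff :: "('a::euclidean_space \<Rightarrow> real) \<Rightarrow> 'a \<Rightarrow> 'a set" where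
  "convex_subdiff g x = {v. \<forall>y. g y \<ge> g x + v \<bullet> (y - x)}"

definition normal_cone :: "'a::euclidean_space set \<Rightarrow> 'a \<Rightarrow> 'a set" where
  "normal_cone C x = {\<xi>. \<forall>y\<in>C. \<xi> \<bullet> (y - x) \<le> 0}"

text \<open>Regular (Frechet) and limiting (Mordukhovich) subdifferential, for finite-valued functions.\<close>

definition regular_subdiff :: "('a::euclidean_space \<Rightarrow> real) \<Rightarrow> 'a \<Rightarrow> 'a set" where
  "regular_subdiff g x =
     {v. Liminf (at x) (\<lambda>y. ereal ((g y - g x - v \<bullet> (y - x)) / norm (y - x))) \<ge> 0}"

definition limiting_subdiff :: "('a::euclidean_space \<Rightarrow> real) \<Rightarrow> 'a \<Rightarrow> 'a set" where
  "limiting_subdiff g x =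
     {v. \<exists>X Y. X \<longlonglongrightarrow> x \<and> (\<lambda>k. g (X k)) \<longlonglongrightarrow> g x \<and>
          (\<forall>k::nat. Y k \<in> regular_subdiff g (X k)) \<and> Y \<longlonglongrightarrow> v}"


section \<open>The Kurdyka-Lojasiewicz property\<close>

text \<open>Unlike \<^const>\<open>infdist\<close>, this distance to the empty set is \<open>\<infinity>\<close>.\<close>

definition einfdist :: "'a::metric_space \<Rightarrow> 'a set \<Rightarrow> ereal" where
  "einfdist x A = (INF a\<in>A. ereal (dist x a))"

definition desingularizing :: "ereal \<Rightarrow> (real \<Rightarrow> real) \<Rightarrow> bool" where
  "desingularizing r \<phi> \<longleftrightarrow>
     (let I = {t. 0 \<le> t \<and> ereal t < r}; I\<^sub>0 = {t. 0 < t \<and> ereal t < r} in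
      continuous_on I \<phi> \<and> concave_on I \<phi> \<and> (\<forall>t\<in>I. 0 \<le> \<phi> t) \<and> \<phi> 0 = 0 \<and>
      (\<forall>t\<in>I\<^sub>0. \<phi> differentiable (at t)) \<and> continuous_on I\<^sub>0 (deriv \<phi>) \<and>
      (\<forall>t\<in>I\<^sub>0. deriv \<phi> t > 0))"

definition KL_with :: "(real \<Rightarrow> real) \<Rightarrow> ('a::euclidean_space \<Rightarrow> real) \<Rightarrow> 'a \<Rightarrow> bool" where
  "KL_with \<phi> g x \<longleftrightarrow> limiting_subdiff g x \<noteq> {} \<and>
     (\<exists>r>0. \<exists>V. open V \<and> x \<in> V \<and> desingularizing r \<phi> \<and>
       (\<forall>y\<in>V. 0 < g y - g x \<and> ereal (g y - g x) < r \<longrightarrow>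
          ereal (deriv \<phi> (g y - g x)) * einfdist 0 (limiting_subdiff g y) \<ge> 1))"

definition KL_property :: "('a::euclidean_space \<Rightarrow> real) \<Rightarrow> 'a \<Rightarrow> bool" where
  "KL_property g x \<longleftrightarrow> (\<exists>\<phi>. KL_with \<phi> g x)"

definition KL_exponent :: "('a::euclidean_space \<Rightarrow> real) \<Rightarrow> 'a \<Rightarrow> real \<Rightarrow> bool" where
  "KL_exponent g x \<alpha> \<longleftrightarrow> 0 \<le> \<alpha> \<and> \<alpha> < 1 \<and>
     (\<exists>c>0. KL_with (\<lambda>t. c * t powr (1 - \<alpha>)) g x)"


section \<open>Componentwise square and l1-norm\<close>

definition vsq :: "real ^ 'n \<Rightarrow> real ^ 'n" where
  "vsq a = (\<chi> i. (a $ i)\<^sup>2)"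

definition l1_norm :: "real ^ 'n \<Rightarrow> real" where
  "l1_norm x = (\<Sum>i\<in>UNIV. \<bar>x $ i\<bar>)"

end

theory Submission
  imports Defs
begin

text \<open>Level boundedness makes the gradient Lipschitz where the iterates live, so the linesearch stepsize is
  eventually a constant \<open>\<theta>\<close>, and the KL property gives convergence to a stationary point. Near a
  stationary point with a negative curvature direction the gradient step is a perturbation of the symmetric
  map \<open>I - \<theta> \<nabla>\<^sup>2F\<close>, which has an eigenvalue above \<open>1\<close>; an indefinite quadratic form that grows along the
  difference of two orbits shows that the orbits staying nearby start in a null set, and null sets
  pull back to null sets under the gradient steps because their Jacobian determinants vanish only on a null set.

  For the rates, let \<open>z\<^sup>*\<close> be the limit and \<open>s\<^sup>*\<close> the corresponding point for \<open>f\<close>. In each coordinate one of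
  \<open>a\<^sub>i, b\<^sub>i\<close> (or both) is of the size of \<open>\<nabla>F\<close>, and deleting it changes \<open>F\<close> only by \<open>O(\<bar>\<nabla>F\<bar>\<^sup>2)\<close>. At the resulting
  point of the domain of \<open>f\<close> there is an explicit subgradient of \<open>f\<close>, whose coordinates are
  \<open>O(\<bar>\<nabla>F\<bar>)\<close> after multiplication by \<open>\<bar>a\<^sub>i\<bar>\<close> or \<open>\<bar>b\<^sub>i\<bar>\<close>. Under strict complementarity these factors are bounded below, and
  the exponent of \<open>f\<close> carries over to \<open>F\<close>. In the convex case the KL exponent yields an error bound for
  \<open>dist(x, \<Omega>)\<close>, and the subgradient inequality at a nearby point of \<open>\<Omega> \<inter> S\<^sub>\<rho>\<close> gives the exponent \<open>(1 + \<beta>) / 2\<close>.\<close>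

section \<open>Null sets and twice continuously differentiable functions\<close>

text \<open>Saddles need not be isolated, and the final stepsize depends on the starting point. Both
  obstacles are met by countability: Lindelof selects countably many neighbourhoods of saddles, and
  every iterate is the image of the start under one of countably many finite words of gradient
  steps. The second-order condition matters for the rates too: it gives |\<nabla>h(s)_i| \<le> \<mu>
  at the limit even where a_i = b_i = 0, and this is what yields subgradients of f near s. Deleting
  the small halves costs a multiple of |\<nabla>F|^2, a loss compatible only with exponents \<ge>
  1/2; hence max(\<alpha>, 1/2) in the strict case. In the convex case, at the degenerate indices
  only the product of the subgradient coordinate with the square root of the point's coordinate is
  O(|\<nabla>F|). A displacement d therefore enters as sqrt d, and the error bound d =
  O(\<Delta>^(1-\<beta>)), with \<Delta> the excess of f, is worth only half: \<Delta> =
  O(|\<nabla>F| \<Delta>^((1-\<beta>)/2)), which is exponent (1+\<beta>)/2.\<close>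

lemma negligible_inverse_Lipschitz:
  fixes p :: "'a::euclidean_space \<Rightarrow> 'a"
  assumes neg: "negligible (p ` A)" and "\<eta> > 0"
    and low: "\<And>x y. x \<in> A \<Longrightarrow> y \<in> A \<Longrightarrow> \<eta> * norm (x - y) \<le> norm (p x - p y)"
  shows "negligible A"
proof -
  have inj: "inj_on p A"
  proof (rule inj_onI)
    fix x y assume "x \<in> A" "y \<in> A" "p x = p y"
    with low[of x y] \<open>\<eta> > 0\<close> show "x = y"
      by (simp add: mult_le_0_iff)
  qed
  \<comment> \<open>The set is recovered from its image by the inverse map, which is Lipschitz with
    constant \<open>1 / \<eta>\<close> and so preserves null sets.\<close>
  have "negligible (inv_into A p ` (p ` A))"
  proof (rule negligible_locally_Lipschitz_image[OF order_refl neg])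
    fix u assume u: "u \<in> p ` A"
    show "\<exists>T B. open T \<and> u \<in> T \<and>
        (\<forall>y \<in> p ` A \<inter> T. norm (inv_into A p y - inv_into A p u) \<le> B * norm (y - u))"
    proof (intro exI[of _ UNIV] exI[of _ "1 / \<eta>"] conjI ballI)
      fix v assume "v \<in> p ` A \<inter> UNIV"
      then obtain x y where "x \<in> A" "y \<in> A" "u = p x" "v = p y" using u by auto
      then show "norm (inv_into A p v - inv_into A p u) \<le> 1 / \<eta> * norm (v - u)"
        using low[of y x] \<open>\<eta> > 0\<close> inj by (simp add: field_simps)
    qed auto
  qed
  moreover have "inv_into A p ` (p ` A) = A"
    using inj by (simp add: image_image)
  ultimately show ?thesis by simp
qed

locale C2_pair =
  fixes F :: "'a::euclidean_space \<Rightarrow> real" and g :: "'a \<Rightarrow> 'a" and H :: "'a \<Rightarrow> 'a \<Rightarrow>\<^sub>L 'a"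
  assumes der: "\<And>x. GDERIV F x :> g x"
    and der2: "\<And>x. (g has_derivative blinfun_apply (H x)) (at x)"
    and cont2: "continuous_on UNIV H"
begin

lemma grad_eq: "grad F = g"
proof
  fix x
  show "grad F x = g x"
    unfolding grad_def
  proof (rule the_equality)
    show "GDERIV F x :> g x" by (rule der)
    fix D assume "GDERIV F x :> D"
    then have "(\<lambda>h. h \<bullet> D) = (\<lambda>h. h \<bullet> g x)"
      using der[of x] unfolding gderiv_def by (rule has_derivative_unique)
    then show "D = g x" by (metis inner_commute vector_eq_rdot)
  qed
qed

lemma hess_eq: "hess F x = blinfun_apply (H x)"
  unfolding hess_def grad_eq using frechet_derivative_at[OF der2] by metis

lemma cont_g: "continuous_on S g"
  by (meson continuous_at_imp_continuous_on der2 has_derivative_continuous)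

lemma cont_F: "continuous_on S F"
  by (meson continuous_at_imp_continuous_on der gderiv_def has_derivative_continuous)

lemma MVT_grad: "\<exists>t\<in>{0..1}. F (x + v) - F x = g (x + t *\<^sub>R v) \<bullet> v"
proof -
  have "((\<lambda>t. F (x + t *\<^sub>R v)) has_derivative (\<lambda>s. (s *\<^sub>R v) \<bullet> g (x + t *\<^sub>R v))) (at t within {0..1})" for t
  proof -
    have "((\<lambda>t. x + t *\<^sub>R v) has_derivative (\<lambda>s. s *\<^sub>R v)) (at t within {0..1})"
      by (auto intro!: derivative_eq_intros)
    from has_derivative_compose[OF this] der[unfolded gderiv_def]
    show ?thesis by blast
  qed
  from mvt_very_simple[OF _ this] show ?thesis
    by (auto simp: inner_commute)
qed

text \<open>Near \<open>x\<close> the map \<open>g - H x\<close> has small derivative, by continuity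
  of \<open>H\<close>, and the mean value inequality on the convex ball does the rest. Both
  arguments vary, which differentiability at a point would not allow; this is what controls the
  difference of two orbits later.\<close>

lemma strict_diff:
  assumes "\<epsilon> > 0"
  shows "\<exists>d>0. \<forall>y\<in>ball x d. \<forall>z\<in>ball x d. norm (g y - g z - H x (y - z)) \<le> \<epsilon> * norm (y - z)"
proof -
  have "isCont H x" using cont2 by (simp add: continuous_on_eq_continuous_at)
  then obtain d where d: "d > 0" "\<And>y. dist y x < d \<Longrightarrow> dist (H y) (H x) < \<epsilon>"
    using assms unfolding continuous_at_eps_delta by blast
  have "norm (g y - g z - H x (y - z)) \<le> \<epsilon> * norm (y - z)"
    if "y \<in> ball x d" "z \<in> ball x d" for y z
  proof -
    have "norm ((\<lambda>w. g w - H x w) y - (\<lambda>w. g w - H x w) z) \<le> \<epsilon> * norm (y - z)"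
    proof (rule differentiable_bound[where S = "ball x d"])
      fix w assume w: "w \<in> ball x d"
      show "((\<lambda>w. g w - H x w) has_derivative blinfun_apply (H w - H x)) (at w within ball x d)"
        by (auto intro!: derivative_eq_intros has_derivative_at_withinI[OF der2]
            bounded_linear.has_derivative[OF blinfun.bounded_linear_right] simp: blinfun.diff_left)
      show "onorm (blinfun_apply (H w - H x)) \<le> \<epsilon>"
        using d(2)[of w] w by (simp add: dist_norm norm_blinfun.rep_eq[symmetric] norm_minus_commute)
    qed (use that in auto)
    then show ?thesis by (simp add: blinfun.diff_right algebra_simps)
  qed
  then show ?thesis using d(1) by blast
qed

lemma Lipschitz_cball: "\<exists>L>0. \<forall>x\<in>cball 0 R. \<forall>y\<in>cball 0 R. norm (g x - g y) \<le> L * norm (x - y)"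
proof -
  have "compact (H ` cball 0 R)"
    by (intro compact_continuous_image continuous_on_subset[OF cont2]) auto
  then obtain L where L: "L > 0" "\<And>x. x \<in> cball 0 R \<Longrightarrow> norm (H x) \<le> L"
    using compact_imp_bounded bounded_pos by (metis imageI)
  have "norm (g x - g y) \<le> L * norm (x - y)" if "x \<in> cball 0 R" "y \<in> cball 0 R" for x y
    by (rule differentiable_bound[where S = "cball 0 R" and f' = "\<lambda>x. blinfun_apply (H x)"])
      (use that L(2) in \<open>auto intro: has_derivative_at_withinI[OF der2] simp: norm_blinfun.rep_eq[symmetric]\<close>)
  then show ?thesis using L(1) by blast
qed

text \<open>Symmetry of the Hessian: both \<open>H x v \<bullet> u\<close> and \<open>H x u \<bullet> v\<close> are the limit of the second difference quotient of \<open>F\<close>.\<close>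

lemma H_second_difference:
  "((\<lambda>t. (F (x + t *\<^sub>R u + t *\<^sub>R v) - F (x + t *\<^sub>R u) - F (x + t *\<^sub>R v) + F x) / t\<^sup>2)
      \<longlongrightarrow> H x v \<bullet> u) (at_right 0)"
proof (rule tendstoI)
  fix e :: real assume "e > 0"
  define N where "N = norm u * (norm v + 1) + 1"
  have N: "N > 0" by (simp add: N_def add_nonneg_pos)
  define \<epsilon> where "\<epsilon> = e / (2 * N)"
  have "\<epsilon> > 0" using \<open>e > 0\<close> N by (simp add: \<epsilon>_def)
  then obtain d where d: "d > 0"
    "\<And>y z. y \<in> ball x d \<Longrightarrow> z \<in> ball x d \<Longrightarrow> norm (g y - g z - H x (y - z)) \<le> \<epsilon> * norm (y - z)"
    using strict_diff[of \<epsilon> x] by blast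
  define t0 where "t0 = d / (norm u + norm v + 1)"
  have t0: "t0 > 0" unfolding t0_def using d(1) by (intro divide_pos_pos add_nonneg_pos) auto
  have "dist ((F (x + t *\<^sub>R u + t *\<^sub>R v) - F (x + t *\<^sub>R u) - F (x + t *\<^sub>R v) + F x) / t\<^sup>2) (H x v \<bullet> u) < e"
    if t: "0 < t" "t < t0" for t
  proof -
    \<comment> \<open>The second difference is the increment of \<open>\<psi>\<close> over [0, t].
      One mean value step in direction \<open>u\<close> leaves a difference of gradients, which
      \<open>strict_diff\<close> replaces by the Hessian applied to
      \<open>t *\<^sub>R v\<close>.\<close>
    define \<psi> where "\<psi> = (\<lambda>s. F (x + s *\<^sub>R u + t *\<^sub>R v) - F (x + s *\<^sub>R u))"
    have der\<psi>: "(\<psi> has_derivative (\<lambda>r. (r *\<^sub>R u) \<bullet> (g (x + s *\<^sub>R u + t *\<^sub>R v) - g (x + s *\<^sub>R u)))) (at s within {0..t})" for s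
    proof -
      have 1: "((\<lambda>s. x + s *\<^sub>R u + t *\<^sub>R v) has_derivative (\<lambda>r. r *\<^sub>R u)) (at s within {0..t})"
       and 2: "((\<lambda>s. x + s *\<^sub>R u) has_derivative (\<lambda>r. r *\<^sub>R u)) (at s within {0..t})"
        by (auto intro!: derivative_eq_intros)
      show ?thesis
        unfolding \<psi>_def inner_diff_right
        by (intro has_derivative_diff has_derivative_compose[OF 1] has_derivative_compose[OF 2])
           (use der[unfolded gderiv_def] in blast)+
    qed
    obtain s where s: "s \<in> {0..t}" "\<psi> t - \<psi> 0 = (t *\<^sub>R u) \<bullet> (g (x + s *\<^sub>R u + t *\<^sub>R v) - g (x + s *\<^sub>R u))"
      using mvt_very_simple[OF _ der\<psi>] t by auto
    have td: "t * (norm u + norm v + 1) < d"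
      using t t0_def by (simp add: pos_less_divide_eq add_nonneg_pos)
    then have td: "t * norm u + t * norm v + t < d" by (simp add: distrib_left)
    have su: "norm (s *\<^sub>R u) \<le> t * norm u" using s(1) by (auto intro: mult_right_mono)
    have n1: "norm (s *\<^sub>R u + t *\<^sub>R v) < d"
      using norm_triangle_ineq[of "s *\<^sub>R u" "t *\<^sub>R v"] su td t by simp
    have "0 \<le> t * norm v" using t by simp
    then have n2: "norm (s *\<^sub>R u) < d"
      using su td t by linarith
    have b: "x + s *\<^sub>R u + t *\<^sub>R v \<in> ball x d" "x + s *\<^sub>R u \<in> ball x d"
      unfolding mem_ball dist_commute[of x] unfolding dist_norm using n1 n2 by (simp_all add: add.assoc)
    define w where "w = g (x + s *\<^sub>R u + t *\<^sub>R v) - g (x + s *\<^sub>R u) - H x (t *\<^sub>R v)"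
    have "norm w \<le> \<epsilon> * norm (t *\<^sub>R v)"
      using d(2)[OF b] by (simp add: w_def)
    then have w: "norm w \<le> \<epsilon> * (t * norm v)" using t by simp
    have "\<psi> t - \<psi> 0 = t\<^sup>2 * (H x v \<bullet> u) + t * (u \<bullet> w)"
      unfolding s(2) w_def by (simp add: inner_diff_right inner_commute blinfun.scaleR_right power2_eq_square algebra_simps)
    moreover have "F (x + t *\<^sub>R u + t *\<^sub>R v) - F (x + t *\<^sub>R u) - F (x + t *\<^sub>R v) + F x = \<psi> t - \<psi> 0"
      by (simp add: \<psi>_def)
    ultimately have "(F (x + t *\<^sub>R u + t *\<^sub>R v) - F (x + t *\<^sub>R u) - F (x + t *\<^sub>R v) + F x) / t\<^sup>2 - H x v \<bullet> u
        = (u \<bullet> w) / t"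
      using t by (simp add: field_simps power2_eq_square)
    moreover have "\<bar>u \<bullet> w\<bar> \<le> norm u * (\<epsilon> * (t * norm v))"
      using Cauchy_Schwarz_ineq2[of u w] w by (meson mult_left_mono norm_ge_zero order_trans)
    then have "\<bar>(u \<bullet> w) / t\<bar> \<le> norm u * norm v * \<epsilon>"
      using t by (simp add: field_simps)
    also have "\<dots> \<le> N * \<epsilon>"
      using \<open>\<epsilon> > 0\<close> by (intro mult_right_mono) (auto simp: N_def algebra_simps)
    also have "\<dots> < e" using N \<open>e > 0\<close> by (simp add: \<epsilon>_def)
    ultimately show ?thesis by (simp add: dist_real_def)
  qed
  then show "\<forall>\<^sub>F t in at_right 0. dist ((F (x + t *\<^sub>R u + t *\<^sub>R v) - F (x + t *\<^sub>R u) - F (x + t *\<^sub>R v) + F x) / t\<^sup>2) (H x v \<bullet> u) < e"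
    using eventually_at_right_less t0 by (auto simp: eventually_at_right intro!: exI[of _ t0])
qed

lemma H_sym: "H x v \<bullet> u = H x u \<bullet> v"
proof -
  have "((\<lambda>t. (F (x + t *\<^sub>R u + t *\<^sub>R v) - F (x + t *\<^sub>R u) - F (x + t *\<^sub>R v) + F x) / t\<^sup>2)
      \<longlongrightarrow> H x u \<bullet> v) (at_right 0)"
    using H_second_difference[of x v u] by (simp add: algebra_simps)
  with H_second_difference[of x u v] show ?thesis
    using tendsto_unique trivial_limit_at_right_real by blast
qed

end

section \<open>Avoidance of expanding fixed points\<close>

text \<open>Eigenvectors for distinct eigenvalues are orthogonal, so there are at most as many as
  the dimension. It serves to choose a level \<open>l\<close> off the spectrum of a squared
  map.\<close>

lemma symmetric_eigenvalues_finite: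
  fixes A :: "'a::euclidean_space \<Rightarrow> 'a"
  assumes sym: "\<And>x y. A x \<bullet> y = x \<bullet> A y"
  shows "finite {l. \<exists>v. v \<noteq> 0 \<and> A v = l *\<^sub>R v}"
proof -
  define E where "E = {l. \<exists>v. v \<noteq> 0 \<and> A v = l *\<^sub>R v}"
  have "\<forall>l\<in>E. \<exists>v. v \<noteq> 0 \<and> A v = l *\<^sub>R v" by (simp add: E_def)
  then obtain V where V0: "\<And>l. l \<in> E \<Longrightarrow> V l \<noteq> 0" and V: "\<And>l. l \<in> E \<Longrightarrow> A (V l) = l *\<^sub>R V l"
    by metis
  have orth: "V l \<bullet> V m = 0" if "l \<in> E" "m \<in> E" "l \<noteq> m" for l m
  proof -
    have "(l *\<^sub>R V l) \<bullet> V m = V l \<bullet> (m *\<^sub>R V m)"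
      using sym[of "V l" "V m"] by (simp only: V that)
    then show ?thesis using that(3) by (simp only: inner_scaleR_left inner_scaleR_right mult_cancel_right) simp
  qed
  have inj: "inj_on V E"
  proof (rule inj_onI, rule ccontr)
    fix l m assume "l \<in> E" "m \<in> E" "V l = V m" "l \<noteq> m"
    with orth[of l m] V0[of m] show False by simp
  qed
  have "independent (V ` E)"
  proof (rule pairwise_orthogonal_independent)
    show "pairwise orthogonal (V ` E)" unfolding pairwise_def orthogonal_def using orth by blast
    show "0 \<notin> V ` E" using V0 by fastforce
  qed
  then have "finite (V ` E)" using independent_bound by blast
  from finite_imageD[OF this inj] show ?thesis by (simp add: E_def)
qed

text \<open>For the indefinite form \<open>Q w = \<bar>T w\<bar>\<^sup>2 - l \<bar>w\<bar>\<^sup>2\<close> one has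
  \<open>Q (T w) = \<bar>(T\<^sup>2 - l) w\<bar>\<^sup>2 + l Q w\<close>. Hence for \<open>l > 1\<close> with \<open>T\<^sup>2 - l\<close> injective, two orbits whose
  difference has \<open>Q \<ge> 0\<close> drift apart exponentially, and the set of starting points of orbits that stay
  near \<open>x\<close> is a Lipschitz graph over a hyperplane. No spectral decomposition of \<open>T\<close> is needed.\<close>

lemma negligible_staying_near_saddle:
  fixes G :: "'a::euclidean_space \<Rightarrow> 'a" and T :: "'a \<Rightarrow> 'a"
  assumes lin: "linear T" and sym: "\<And>x y. T x \<bullet> y = x \<bullet> T y"
    and e: "norm e = 1" "e \<bullet> T e > 1"
    and sd: "\<And>\<epsilon>. \<epsilon> > 0 \<Longrightarrow> \<exists>d>0. \<forall>y\<in>ball x d. \<forall>z\<in>ball x d. norm (G y - G z - T (y - z)) \<le> \<epsilon> * norm (y - z)"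
  shows "\<exists>B. open B \<and> x \<in> B \<and> negligible {y. \<forall>k. (G ^^ k) y \<in> B}"
proof -
  interpret T: linear T by (rule lin)
  have Te: "norm (T e) > 1"
    using Cauchy_Schwarz_ineq2[of e "T e"] e by simp
  \<comment> \<open>The level \<open>l\<close> is to lie strictly between 1 and the squared norm of
    \<open>T e\<close>: above 1 for expansion, below so that the form is positive at
    \<open>e\<close>. Avoiding the finite set \<open>E\<close> makes \<open>A\<close>
    injective.\<close>
  define E where "E = {l. \<exists>v. v \<noteq> 0 \<and> T (T v) = l *\<^sub>R v}"
  have "finite E" unfolding E_def by (intro symmetric_eigenvalues_finite) (simp add: sym)
  moreover have "infinite {1<..<(norm (T e))\<^sup>2}"
    using Te by (simp add: infinite_Ioo one_less_power)
  ultimately obtain l where l: "l \<in> {1<..<(norm (T e))\<^sup>2}" "l \<notin> E"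
    by (meson finite_subset subsetI)
  define A where "A = (\<lambda>w. T (T w) - l *\<^sub>R w)"
  have linA: "linear A"
    unfolding A_def by (intro linearI) (simp_all add: T.add T.scale algebra_simps)
  interpret A: linear A by (rule linA)
  have symA: "A u \<bullet> v = u \<bullet> A v" for u v
    by (simp add: A_def inner_diff_left inner_diff_right sym)
  have "inj A"
    unfolding linear_injective_0[OF linA] using l(2) by (auto simp: A_def E_def)
  then obtain \<delta> where \<delta>: "\<delta> > 0" "\<And>w. \<delta> * norm w \<le> norm (A w)"
    using linear_inj_bounded_below_pos[OF linA] by blast
  obtain M where M: "M > 0" "\<And>w. norm (A w) \<le> M * norm w"
    using linear_bounded_pos[OF linA] by blast
  obtain N where N: "N > 0" "\<And>w. norm (T w) \<le> N * norm w"
    using linear_bounded_pos[OF lin] by blast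
  define Q where "Q = (\<lambda>w. w \<bullet> A w)"
  have QM: "\<bar>Q w\<bar> \<le> M * (norm w)\<^sup>2" for w
    using Cauchy_Schwarz_ineq2[of w "A w"] mult_left_mono[OF M(2)[of w] norm_ge_zero[of w]]
    by (simp add: Q_def power2_eq_square mult_ac)
  have AT: "A (T w) = T (A w)" for w by (simp add: A_def T.diff T.scale)
  have QT: "Q (T w) = (norm (A w))\<^sup>2 + l * Q w" for w
  proof -
    have "Q (T w) = w \<bullet> T (T (A w))" by (simp add: Q_def AT sym)
    also have "T (T (A w)) = A (A w) + l *\<^sub>R A w" by (simp add: A_def)
    finally show ?thesis by (simp add: inner_add_right Q_def power2_norm_eq_inner symA)
  qed
  have Qadd: "Q (u + v) = Q u + 2 * (v \<bullet> A u) + Q v" for u v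
    using symA[of u v] by (simp add: Q_def A.add inner_add_left inner_add_right inner_commute)
  \<comment> \<open>With \<open>w\<close> the difference of two points and \<open>r\<close> the
    nonlinear remainder, \<open>2 * M * N\<close> comes from the cross term of \<open>T w\<close>
    and \<open>r\<close>, and \<open>M\<close> from \<open>Q r\<close>, where
    \<open>\<epsilon> \<le> 1\<close> absorbs a square. Half of the gain
    \<open>\<delta>\<^sup>2\<close> survives.\<close>
  define \<epsilon> where "\<epsilon> = min 1 (\<delta>\<^sup>2 / (2 * (2 * M * N + M)))"
  have MN: "2 * M * N + M > 0" using M N by (simp add: add_pos_pos)
  have \<epsilon>: "\<epsilon> > 0" "\<epsilon> \<le> 1" "\<epsilon> * (2 * M * N + M) \<le> \<delta>\<^sup>2 / 2"
  proof -
    show "\<epsilon> > 0" "\<epsilon> \<le> 1" using \<delta>(1) MN by (auto simp: \<epsilon>_def)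
    have "\<epsilon> \<le> \<delta>\<^sup>2 / (2 * (2 * M * N + M))" by (simp add: \<epsilon>_def)
    then show "\<epsilon> * (2 * M * N + M) \<le> \<delta>\<^sup>2 / 2" using MN by (simp add: field_simps)
  qed
  obtain d where d: "d > 0"
    "\<And>y z. y \<in> ball x d \<Longrightarrow> z \<in> ball x d \<Longrightarrow> norm (G y - G z - T (y - z)) \<le> \<epsilon> * norm (y - z)"
    using sd[OF \<epsilon>(1)] by blast
  have step: "Q (G y - G z) \<ge> l * Q (y - z) + \<delta>\<^sup>2 / 2 * (norm (y - z))\<^sup>2"
    if "y \<in> ball x d" "z \<in> ball x d" for y z
  proof -
    define w r where "w = y - z" and "r = G y - G z - T w"
    have r: "norm r \<le> \<epsilon> * norm w" using d(2)[OF that] by (simp add: w_def r_def)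
    have "\<bar>r \<bullet> A (T w)\<bar> \<le> norm r * norm (A (T w))" by (rule Cauchy_Schwarz_ineq2)
    also have "\<dots> \<le> (\<epsilon> * norm w) * (M * (N * norm w))"
    proof (rule mult_mono[OF r])
      show "norm (A (T w)) \<le> M * (N * norm w)"
        using M(2)[of "T w"] mult_left_mono[OF N(2)[of w], of M] M(1) by linarith
    qed (use \<epsilon>(1) in auto)
    finally have 1: "\<bar>r \<bullet> A (T w)\<bar> \<le> \<epsilon> * (M * N) * (norm w)\<^sup>2" by (simp add: power2_eq_square mult_ac)
    have "(norm r)\<^sup>2 \<le> (\<epsilon> * norm w)\<^sup>2" using r by (intro power_mono) auto
    also have "\<dots> \<le> \<epsilon> * (norm w)\<^sup>2"
      using \<epsilon>(1,2) mult_right_mono[of "\<epsilon> * \<epsilon>" \<epsilon> "(norm w)\<^sup>2"] by (simp add: power2_eq_square mult_ac mult_left_le)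
    finally have "\<bar>Q r\<bar> \<le> M * (\<epsilon> * (norm w)\<^sup>2)"
      using QM[of r] M(1) by (meson mult_left_mono less_imp_le order_trans)
    then have 2: "\<bar>Q r\<bar> \<le> \<epsilon> * M * (norm w)\<^sup>2" by (simp add: mult_ac)
    have "(\<epsilon> * (2 * M * N + M)) * (norm w)\<^sup>2 \<le> \<delta>\<^sup>2 / 2 * (norm w)\<^sup>2"
      by (intro mult_right_mono \<epsilon>(3)) simp
    then have 3: "2 * (\<epsilon> * (M * N) * (norm w)\<^sup>2) + \<epsilon> * M * (norm w)\<^sup>2 \<le> \<delta>\<^sup>2 / 2 * (norm w)\<^sup>2"
      by (simp add: algebra_simps)
    have 4: "(norm (A w))\<^sup>2 \<ge> \<delta>\<^sup>2 * (norm w)\<^sup>2"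
      using power_mono[OF \<delta>(2)[of w], of 2] \<delta>(1) by (simp add: power_mult_distrib)
    have "G y - G z = T w + r" by (simp add: r_def)
    then have "Q (G y - G z) = (norm (A w))\<^sup>2 + l * Q w + 2 * (r \<bullet> A (T w)) + Q r"
      by (simp add: Qadd QT)
    with 1 2 3 4 show ?thesis unfolding w_def[symmetric] by (simp add: algebra_simps abs_le_iff)
  qed
  define W where "W = {y. \<forall>k. (G ^^ k) y \<in> ball x d}"
  have Wneg: "Q (y - z) < 0" if "y \<in> W" "z \<in> W" "y \<noteq> z" for y z
  proof (rule ccontr)
    assume "\<not> Q (y - z) < 0"
    then have Q0: "Q (y - z) \<ge> 0" by simp
    define q where "q = (\<lambda>k. Q ((G ^^ k) y - (G ^^ k) z))"
    have Yk: "(G ^^ k) y \<in> ball x d" "(G ^^ k) z \<in> ball x d" for k using that by (auto simp: W_def)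
    have qs: "q (Suc k) \<ge> l * q k + \<delta>\<^sup>2 / 2 * (norm ((G ^^ k) y - (G ^^ k) z))\<^sup>2" for k
      using step[OF Yk] by (simp add: q_def)
    have l1: "l > 1" using l by simp
    \<comment> \<open>The form may vanish on the initial difference. The strictly positive term in
      \<open>step\<close> makes it positive after one iteration, and geometric growth is started
      from there.\<close>
    have q1: "q 1 > 0"
    proof -
      have "0 < \<delta>\<^sup>2 / 2 * (norm (y - z))\<^sup>2" using \<delta>(1) that(3) by simp
      moreover have "0 \<le> l * Q (y - z)" using l1 Q0 by simp
      ultimately show ?thesis using qs[of 0] by (simp add: q_def)
    qed
    have qk: "q (Suc k) \<ge> l ^ k * q 1" for k
    proof (induction k)
      case (Suc k)
      have "l ^ Suc k * q 1 \<le> l * q (Suc k)" using Suc l1 by (simp add: mult_ac)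
      also have "\<dots> \<le> q (Suc (Suc k))" using qs[of "Suc k"] by (smt (verit) zero_le_power2 mult_nonneg_nonneg divide_nonneg_nonneg)
      finally show ?case .
    qed simp
    have qb: "q k \<le> M * (2 * d)\<^sup>2" for k
    proof -
      have "norm ((G ^^ k) y - (G ^^ k) z) \<le> 2 * d"
        using Yk[of k] dist_triangle2[of "(G ^^ k) y" "(G ^^ k) z" x] by (simp add: dist_norm norm_minus_commute)
      then have "(norm ((G ^^ k) y - (G ^^ k) z))\<^sup>2 \<le> (2 * d)\<^sup>2" by (intro power_mono) auto
      then show ?thesis using QM[of "(G ^^ k) y - (G ^^ k) z"] M(1)
        by (smt (verit) q_def mult_left_mono)
    qed
    obtain k where "M * (2 * d)\<^sup>2 / q 1 < l ^ k"
      using real_arch_pow[OF l1] by blast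
    then have "M * (2 * d)\<^sup>2 < l ^ k * q 1" using q1 by (simp add: field_simps)
    with qk[of k] qb[of "Suc k"] show False by simp
  qed
  define q where "q = Q e"
  have q: "q > 0"
  proof -
    have "q = (norm (T e))\<^sup>2 - l"
      using e(1) by (simp add: q_def Q_def A_def inner_diff_right power2_norm_eq_inner sym norm_eq_1)
    then show ?thesis using l(1) by simp
  qed
  \<comment> \<open>If \<open>p w\<close> were small against \<open>w\<close>, then \<open>w\<close>
    would be almost a multiple of \<open>e\<close>, where the form is positive. The choice keeps the
    cross term and \<open>Q (p w)\<close> below 5/16 of \<open>q * (norm w)\<^sup>2\<close>, against
    a main term of at least 3/4 of it.\<close>
  define \<eta> where "\<eta> = min (1/2) (q / (8 * M))"
  have \<eta>: "\<eta> > 0" "\<eta> \<le> 1/2" "\<eta> * M \<le> q / 8" using q M(1) by (auto simp: \<eta>_def min_def field_simps)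
  define p where "p = (\<lambda>w. w - (w \<bullet> e) *\<^sub>R e)"
  have plow: "\<eta> * norm w \<le> norm (p w)" if "Q w < 0" for w
  proof (rule ccontr)
    assume "\<not> \<eta> * norm w \<le> norm (p w)"
    then have pw: "norm (p w) \<le> \<eta> * norm w" by simp
    define t where "t = w \<bullet> e"
    have "p w \<bullet> e = 0" using e(1) by (simp add: p_def inner_diff_left norm_eq_1)
    moreover have wt: "w = t *\<^sub>R e + p w" by (simp add: p_def t_def)
    ultimately have nw: "(norm w)\<^sup>2 = t\<^sup>2 + (norm (p w))\<^sup>2"
      using norm_add_Pythagorean[of "t *\<^sub>R e" "p w"] e(1)
      by (simp add: orthogonal_def inner_commute)
    have p2: "(norm (p w))\<^sup>2 \<le> \<eta>\<^sup>2 * (norm w)\<^sup>2"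
      using power_mono[OF pw, of 2] by (simp add: power_mult_distrib)
    have \<eta>2: "\<eta>\<^sup>2 \<le> \<eta> / 2" "\<eta> / 2 \<le> 1 / 4" using \<eta> mult_left_mono[of \<eta> "1/2" \<eta>] by (auto simp: power2_eq_square)
    have p3: "(norm (p w))\<^sup>2 \<le> \<eta> / 2 * (norm w)\<^sup>2" using p2 mult_right_mono[OF \<eta>2(1), of "(norm w)\<^sup>2"] by simp
    have p4: "(norm (p w))\<^sup>2 \<le> 1 / 4 * (norm w)\<^sup>2" using p3 mult_right_mono[OF \<eta>2(2), of "(norm w)\<^sup>2"] by simp
    have tw: "\<bar>t\<bar> \<le> norm w" using Cauchy_Schwarz_ineq2[of w e] e(1) by (simp add: t_def)
    have "\<bar>p w \<bullet> A (t *\<^sub>R e)\<bar> \<le> norm (p w) * norm (A (t *\<^sub>R e))" by (rule Cauchy_Schwarz_ineq2)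
    also have "\<dots> \<le> (\<eta> * norm w) * (M * norm w)"
    proof (rule mult_mono[OF pw])
      have "norm (A (t *\<^sub>R e)) \<le> M * \<bar>t\<bar>" using M(2)[of "t *\<^sub>R e"] e(1) by simp
      also have "\<dots> \<le> M * norm w" using tw M(1) by simp
      finally show "norm (A (t *\<^sub>R e)) \<le> M * norm w" .
    qed (use \<eta> in auto)
    also have "\<dots> = \<eta> * M * (norm w)\<^sup>2" by (simp add: power2_eq_square)
    also have "\<dots> \<le> q / 8 * (norm w)\<^sup>2" by (intro mult_right_mono \<eta>(3)) simp
    finally have b1: "\<bar>p w \<bullet> A (t *\<^sub>R e)\<bar> \<le> q / 8 * (norm w)\<^sup>2" .
    have "\<bar>Q (p w)\<bar> \<le> M * (\<eta> / 2 * (norm w)\<^sup>2)"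
      using QM[of "p w"] mult_left_mono[OF p3, of M] M(1) by linarith
    also have "\<dots> = (\<eta> * M) / 2 * (norm w)\<^sup>2" by simp
    also have "\<dots> \<le> q / 16 * (norm w)\<^sup>2"
      by (intro mult_right_mono) (use \<eta>(3) in linarith, simp)
    finally have b2: "\<bar>Q (p w)\<bar> \<le> q / 16 * (norm w)\<^sup>2" .
    have "Q w = t\<^sup>2 * q + 2 * (p w \<bullet> A (t *\<^sub>R e)) + Q (p w)"
      by (subst wt, subst Qadd) (simp add: Q_def q_def A.scale power2_eq_square)
    moreover have "t\<^sup>2 * q \<ge> 3 / 4 * (norm w)\<^sup>2 * q"
      using nw p4 q by (intro mult_right_mono) auto
    moreover have "0 \<le> q * (norm w)\<^sup>2" using q by simp
    ultimately have "Q w \<ge> 0" using b1 b2 by (simp add: abs_le_iff algebra_simps)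
    with that show False by simp
  qed
  have "negligible W"
  proof (rule negligible_inverse_Lipschitz[where p = p and \<eta> = \<eta>])
    have "p ` W \<subseteq> {w. e \<bullet> w = 0}"
      using e(1) by (auto simp: p_def inner_diff_right inner_commute norm_eq_1)
    moreover have "e \<noteq> 0" using e(1) by auto
    ultimately show "negligible (p ` W)"
      using negligible_hyperplane[of e 0] negligible_subset by blast
    fix y z assume "y \<in> W" "z \<in> W"
    moreover have "p y - p z = p (y - z)" by (simp add: p_def inner_diff_left algebra_simps)
    ultimately show "\<eta> * norm (y - z) \<le> norm (p y - p z)"
      using plow[of "y - z"] Wneg[of y z] by (cases "y = z") auto
  qed (use \<eta> in auto)
  then show ?thesis
    unfolding W_def using d(1) by (intro exI[of _ "ball x d"]) auto
qed

text \<open>Where the derivative is injective, strict differentiability makes \<open>G\<close>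
  locally expanding by half the lower bound of the derivative. So a preimage of a null set is
  locally null there, without inverting \<open>G\<close>, and the remaining points form a null set
  anyway.\<close>

lemma negligible_preimage:
  fixes G :: "'a::euclidean_space \<Rightarrow> 'a" and D :: "'a \<Rightarrow> 'a \<Rightarrow> 'a"
  assumes U: "open U" "negligible (- U)"
    and lin: "\<And>x. linear (D x)" and inj: "\<And>x. x \<in> U \<Longrightarrow> inj (D x)"
    and sd: "\<And>x \<epsilon>. \<epsilon> > 0 \<Longrightarrow> \<exists>d>0. \<forall>y\<in>ball x d. \<forall>z\<in>ball x d. norm (G y - G z - D x (y - z)) \<le> \<epsilon> * norm (y - z)"
    and N: "negligible N"
  shows "negligible {z. G z \<in> N}"
proof -
  have "negligible (U \<inter> {z. G z \<in> N})" (is "negligible ?P")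
  proof (subst locally_negligible_alt, rule ballI)
    fix x assume x: "x \<in> ?P"
    have "inj (D x)" by (rule inj) (use x in blast)
    then obtain m where m: "m > 0" "\<And>w. m * norm w \<le> norm (D x w)"
      using linear_inj_bounded_below_pos[OF lin] by metis
    obtain d where d: "d > 0"
      "\<And>y z. y \<in> ball x d \<Longrightarrow> z \<in> ball x d \<Longrightarrow> norm (G y - G z - D x (y - z)) \<le> m / 2 * norm (y - z)"
      using sd[of "m / 2" x] m(1) by auto
    have "negligible (?P \<inter> ball x d)"
    proof (rule negligible_inverse_Lipschitz[where p = G and \<eta> = "m / 2"])
      show "negligible (G ` (?P \<inter> ball x d))" by (rule negligible_subset[OF N]) auto
      fix y z assume "y \<in> ?P \<inter> ball x d" "z \<in> ?P \<inter> ball x d"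
      then have "norm (G y - G z - D x (y - z)) \<le> m / 2 * norm (y - z)" using d(2) by blast
      moreover have "norm (D x (y - z)) \<le> norm (G y - G z) + norm (G y - G z - D x (y - z))"
        using norm_triangle_ineq4[of "G y - G z" "G y - G z - D x (y - z)"] by simp
      ultimately show "m / 2 * norm (y - z) \<le> norm (G y - G z)"
        using m(2)[of "y - z"] by simp
    qed (use m in auto)
    then show "\<exists>V. openin (top_of_set ?P) V \<and> x \<in> V \<and> negligible V"
      using x d(1) by (intro exI[of _ "?P \<inter> ball x d"]) (auto intro: openin_open_Int)
  qed
  then have "negligible (?P \<union> - U)" using U(2) by (simp add: negligible_Un)
  then show ?thesis by (rule negligible_subset) auto
qed

section \<open>Stepsizes of the linesearch\<close>

text \<open>The loop is unfolded along any witness \<open>j\<close> of termination; the resulting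
  \<open>i\<close> is the first index at which the test fails, possibly smaller than
  \<open>j\<close>.\<close>

lemma while_eq_funpow:
  assumes "\<not> b ((c ^^ j) s)"
  shows "\<exists>i. while b c s = (c ^^ i) s \<and> \<not> b ((c ^^ i) s) \<and> (\<forall>l<i. b ((c ^^ l) s))"
  using assms
proof (induction j arbitrary: s)
  case 0
  then show ?case by (intro exI[of _ 0]) (subst while_unfold, simp)
next
  case (Suc j)
  show ?case
  proof (cases "b s")
    case True
    from Suc.prems have "\<not> b ((c ^^ j) (c s))" by (simp add: funpow_swap1)
    from Suc.IH[OF this] obtain i where i: "while b c (c s) = (c ^^ i) (c s)" "\<not> b ((c ^^ i) (c s))"
      "\<forall>l<i. b ((c ^^ l) (c s))" by blast
    have "while b c s = (c ^^ Suc i) s" using True i(1) by (subst while_unfold) (simp add: funpow_swap1)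
    moreover have "b ((c ^^ l) s)" if "l < Suc i" for l
      using i(3) True that by (cases l) (auto simp: funpow_swap1)
    ultimately show ?thesis using i(2) by (intro exI[of _ "Suc i"]) (auto simp: funpow_swap1)
  next
    case False
    then show ?thesis by (intro exI[of _ 0]) (subst while_unfold, simp)
  qed
qed

lemma funpow_mult_left: "((\<lambda>t. \<kappa> * t) ^^ i) (\<theta>::real) = \<kappa> ^ i * \<theta>"
  by (induction i) (simp_all add: mult.assoc)

definition accepted :: "('a::euclidean_space \<Rightarrow> real) \<Rightarrow> 'a \<Rightarrow> real \<Rightarrow> bool" where
  "accepted F z \<theta> \<longleftrightarrow> F (gd_map F \<theta> z) \<le> F z - \<theta>\<^sup>2 / 2 * (norm (grad F z))\<^sup>2"

lemma backtrack_accepted: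
  assumes "accepted F z (\<kappa> ^ j * \<theta>)"
  shows "\<exists>i. backtrack F \<kappa> z \<theta> = \<kappa> ^ i * \<theta> \<and> accepted F z (\<kappa> ^ i * \<theta>) \<and>
    (\<forall>l<i. \<not> accepted F z (\<kappa> ^ l * \<theta>))"
  using while_eq_funpow[where b = "\<lambda>\<theta>. F (gd_map F \<theta> z) > F z - \<theta>\<^sup>2 / 2 * (norm (grad F z))\<^sup>2"
      and c = "\<lambda>\<theta>. \<kappa> * \<theta>" and j = j and s = \<theta>]
    assms unfolding backtrack_def accepted_def by (auto simp: funpow_mult_left not_less not_le)

text \<open>With \<open>L\<close> a Lipschitz constant of the gradient, the mean value theorem
  bounds the change of \<open>F\<close> by -\<theta> (1 - L \<theta>) |g|^2. This is at most
  -(\<theta>^2 / 2) |g|^2 as soon as \<theta> (L + 1/2) \<le> 1.\<close>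

lemma (in C2_pair) accepted_small_step:
  assumes "bounded S"
  shows "\<exists>\<delta>>0. \<forall>z\<in>S. \<forall>\<theta>. 0 < \<theta> \<and> \<theta> \<le> \<delta> \<longrightarrow> accepted F z \<theta>"
proof -
  obtain R where "\<forall>x\<in>S. norm x \<le> R" using assms unfolding bounded_iff by metis
  then have R: "S \<subseteq> cball 0 R" by (simp add: subset_iff)
  have "compact (g ` cball 0 R)" by (intro compact_continuous_image cont_g) auto
  then obtain B where B: "B > 0" "\<And>x. x \<in> cball 0 R \<Longrightarrow> norm (g x) \<le> B"
    using compact_imp_bounded bounded_pos by (metis imageI)
  obtain L where L: "L > 0" "\<And>x y. x \<in> cball 0 (R + B) \<Longrightarrow> y \<in> cball 0 (R + B) \<Longrightarrow> norm (g x - g y) \<le> L * norm (x - y)"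
    using Lipschitz_cball by blast
  \<comment> \<open>The cap at 1 bounds the step by \<open>B\<close>, so the whole segment stays in
    the larger ball on which \<open>L\<close> is valid.\<close>
  define \<delta> where "\<delta> = min 1 (1 / (L + 1/2))"
  have "accepted F z \<theta>" if z: "z \<in> S" and \<theta>: "0 < \<theta>" "\<theta> \<le> \<delta>" for z \<theta>
  proof -
    have \<theta>1: "\<theta> \<le> 1" and \<theta>L: "\<theta> * (L + 1/2) \<le> 1"
      using \<theta> L(1) by (auto simp: \<delta>_def field_simps)
    obtain t where t: "t \<in> {0..1}" "F (z + (- \<theta>) *\<^sub>R g z) - F z = g (z + t *\<^sub>R (- \<theta>) *\<^sub>R g z) \<bullet> ((- \<theta>) *\<^sub>R g z)"
      using MVT_grad by blast
    define w where "w = z + t *\<^sub>R (- \<theta>) *\<^sub>R g z"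
    have t\<theta>: "t * \<theta> \<le> \<theta>" using t(1) \<theta> by (simp add: mult_left_le_one_le)
    have "norm (w - z) \<le> t * \<theta> * norm (g z)" using t(1) \<theta> by (simp add: w_def)
    then have wz: "norm (w - z) \<le> \<theta> * norm (g z)"
      using t\<theta> mult_right_mono[OF t\<theta>, of "norm (g z)"] by simp
    have zR: "z \<in> cball 0 R" using z R by blast
    have "norm (w - z) \<le> 1 * B"
      using wz mult_mono[OF \<theta>1 B(2)[OF zR]] by simp
    then have "w \<in> cball 0 (R + B)" "z \<in> cball 0 (R + B)"
      using zR B(1) norm_triangle_sub[of w z] by auto
    from L(2)[OF this] have "norm (g w - g z) \<le> L * (\<theta> * norm (g z))"
      using mult_left_mono[OF wz, of L] L(1) by linarith
    then have "\<bar>(g w - g z) \<bullet> g z\<bar> \<le> L * (\<theta> * norm (g z)) * norm (g z)"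
      using Cauchy_Schwarz_ineq2[of "g w - g z" "g z"] by (meson mult_right_mono norm_ge_zero order_trans)
    then have 1: "- ((g w - g z) \<bullet> g z) \<le> L * \<theta> * (norm (g z))\<^sup>2"
      by (simp add: power2_eq_square mult_ac)
    have "F (z - \<theta> *\<^sub>R g z) - F z = \<theta> * (- ((g w - g z) \<bullet> g z) - (norm (g z))\<^sup>2)"
      using t(2) unfolding w_def[symmetric] by (simp add: inner_diff_left power2_norm_eq_inner algebra_simps)
    also have "\<dots> \<le> \<theta> * (L * \<theta> * (norm (g z))\<^sup>2 - (norm (g z))\<^sup>2)"
      using 1 \<theta> by (intro mult_left_mono) auto
    also have "\<dots> = \<theta> * (norm (g z))\<^sup>2 * (\<theta> * (L + 1/2) - 1) - \<theta>\<^sup>2 / 2 * (norm (g z))\<^sup>2"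
      by (simp add: field_simps power2_eq_square)
    also have "\<dots> \<le> - \<theta>\<^sup>2 / 2 * (norm (g z))\<^sup>2"
      using \<theta>L \<theta> by (simp add: mult_nonneg_nonpos)
    finally show ?thesis by (simp add: accepted_def gd_map_def grad_eq)
  qed
  moreover have "\<delta> > 0" using L(1) by (simp add: \<delta>_def)
  ultimately show ?thesis by blast
qed

text \<open>Descent keeps all iterates in the initial sublevel set, which is bounded, so one
  threshold for acceptance serves all of them. The stepsizes are then bounded below; being
  \<open>\<theta>\<^sub>0\<close> times powers of \<open>\<kappa>\<close> with nondecreasing
  exponents, they can change only finitely often.\<close>

lemma (in C2_pair) gd_iterate_eventually_constant_step:
  fixes z\<^sub>0 :: 'a and \<theta>\<^sub>0 \<kappa> :: real
  assumes lb: "level_bounded F" and \<theta>0: "\<theta>\<^sub>0 > 0" and \<kappa>: "0 < \<kappa>" "\<kappa> < 1"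
  defines "z \<equiv> gd_iterate F \<theta>\<^sub>0 \<kappa> z\<^sub>0"
  shows "bounded (range z)"
    and "\<And>k. \<exists>m. z (Suc k) = gd_map F (\<kappa> ^ m * \<theta>\<^sub>0) (z k)"
    and "\<exists>m K. \<forall>k\<ge>K. z (Suc k) = gd_map F (\<kappa> ^ m * \<theta>\<^sub>0) (z k) \<and> accepted F (z k) (\<kappa> ^ m * \<theta>\<^sub>0)"
proof -
  \<comment> \<open>The state holds the stepsize after backtracking, so the step leaving
    \<open>z k\<close> has size \<open>t (Suc k)\<close>, while \<open>t 0\<close> is the untested
    initial value.\<close>
  define t where "t k = snd (gd_state F \<theta>\<^sub>0 \<kappa> z\<^sub>0 k)" for k
  have z0: "z 0 = z\<^sub>0" and t0: "t 0 = \<theta>\<^sub>0" by (simp_all add: z_def t_def gd_iterate_def)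
  have tS: "t (Suc k) = backtrack F \<kappa> (z k) (t k)" for k
    by (simp add: z_def t_def gd_iterate_def Let_def split_beta)
  have zS: "z (Suc k) = gd_map F (t (Suc k)) (z k)" for k
    unfolding tS by (simp add: z_def t_def gd_iterate_def Let_def split_beta)
  define S where "S = {x. F x \<le> F z\<^sub>0}"
  have bS: "bounded S" using lb by (simp add: S_def level_bounded_def)
  obtain \<delta> where \<delta>: "\<delta> > 0" "\<And>x \<theta>. x \<in> S \<Longrightarrow> 0 < \<theta> \<Longrightarrow> \<theta> \<le> \<delta> \<Longrightarrow> accepted F x \<theta>"
    using accepted_small_step[OF bS] by blast
  \<comment> \<open>A rejected stepsize exceeds \<open>\<delta>\<close>, hence a shrunken one
    exceeds \<open>\<kappa> * \<delta>\<close>; the minimum with \<open>\<theta>\<^sub>0\<close>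
    covers the case that nothing has been shrunk yet.\<close>
  define c where "c = min \<theta>\<^sub>0 (\<kappa> * \<delta>)"
  have c: "c > 0" using \<theta>0 \<kappa> \<delta>(1) by (simp add: c_def)
  have step: "\<exists>i. t (Suc k) = \<kappa> ^ i * t k \<and> accepted F (z k) (t (Suc k)) \<and> (t k \<ge> c \<longrightarrow> t (Suc k) \<ge> c)"
    if "z k \<in> S" "t k > 0" for k
  proof -
    obtain j where "\<kappa> ^ j < \<delta> / t k" using real_arch_pow_inv \<kappa> \<delta>(1) \<open>t k > 0\<close> by (metis divide_pos_pos)
    then have "\<kappa> ^ j * t k \<le> \<delta>" using that(2) by (simp add: field_simps)
    moreover have "0 < \<kappa> ^ j * t k" using \<kappa> that(2) by simp
    ultimately have "accepted F (z k) (\<kappa> ^ j * t k)" using \<delta>(2) that(1) by blast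
    from backtrack_accepted[OF this] obtain i where i: "t (Suc k) = \<kappa> ^ i * t k"
      "accepted F (z k) (\<kappa> ^ i * t k)" "\<And>l. l < i \<Longrightarrow> \<not> accepted F (z k) (\<kappa> ^ l * t k)"
      unfolding tS by blast
    have "t (Suc k) \<ge> c" if "t k \<ge> c"
    proof (cases i)
      case 0
      then show ?thesis using i(1) that by simp
    next
      case (Suc l)
      have "0 < \<kappa> ^ l * t k" using \<kappa> \<open>t k > 0\<close> by simp
      then have "\<delta> < \<kappa> ^ l * t k" using i(3)[of l] Suc \<delta>(2)[OF \<open>z k \<in> S\<close>] by force
      then have "\<kappa> * \<delta> \<le> t (Suc k)" using i(1) Suc \<kappa> by simp
      then show ?thesis by (simp add: c_def)
    qed
    then show ?thesis using i(1,2) by auto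
  qed
  have inv: "z k \<in> S \<and> (\<exists>m. t k = \<kappa> ^ m * \<theta>\<^sub>0) \<and> t k \<ge> c" for k
  proof (induction k)
    case 0
    show ?case using z0 t0 by (auto simp: S_def c_def intro: exI[of _ 0])
  next
    case (Suc k)
    then obtain m where m: "z k \<in> S" "t k = \<kappa> ^ m * \<theta>\<^sub>0" "t k \<ge> c" by blast
    with c have "t k > 0" by linarith
    from step[OF m(1) this] m(3) obtain i where
      i: "t (Suc k) = \<kappa> ^ i * t k" "accepted F (z k) (t (Suc k))" "t (Suc k) \<ge> c"
      by blast
    have "F (z (Suc k)) \<le> F (z k) - (t (Suc k))\<^sup>2 / 2 * (norm (grad F (z k)))\<^sup>2"
      using i(2) by (simp add: accepted_def zS)
    also have "\<dots> \<le> F (z k)" by simp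
    finally have "z (Suc k) \<in> S" using m(1) by (simp add: S_def)
    moreover have "t (Suc k) = \<kappa> ^ (i + m) * \<theta>\<^sub>0" using i(1) m(2) by (simp add: power_add)
    ultimately show ?case using i(3) by blast
  qed
  show "bounded (range z)" using inv bS by (meson bounded_subset image_subsetI)
  show "\<exists>m. z (Suc k) = gd_map F (\<kappa> ^ m * \<theta>\<^sub>0) (z k)" for k using zS inv by metis
  obtain m where m: "\<And>k. t k = \<kappa> ^ m k * \<theta>\<^sub>0" using inv by metis
  obtain M where M: "\<kappa> ^ M < c / \<theta>\<^sub>0" using real_arch_pow_inv \<kappa> c \<theta>0 by (metis divide_pos_pos)
  have mM: "m k < M" for k
  proof (rule ccontr)
    assume "\<not> m k < M"
    then have "\<kappa> ^ m k \<le> \<kappa> ^ M" using \<kappa> by (intro power_decreasing) auto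
    then have "\<kappa> ^ m k < c / \<theta>\<^sub>0" using M by simp
    then have "\<kappa> ^ m k * \<theta>\<^sub>0 < c" using \<theta>0 by (simp add: pos_less_divide_eq)
    then show False using inv[of k] m[of k] by simp
  qed
  have mmono: "m k \<le> m (Suc k)" for k
  proof -
    have tk: "t k > 0" using inv[of k] c by simp
    obtain i where "t (Suc k) = \<kappa> ^ i * t k" using step[of k] inv[of k] tk by blast
    also have "\<dots> \<le> t k" using \<kappa> tk by (simp add: mult_left_le_one_le power_le_one)
    finally have "\<kappa> ^ m (Suc k) \<le> \<kappa> ^ m k" using \<theta>0 by (simp add: m)
    then show ?thesis using \<kappa> by (simp add: power_decreasing_iff)
  qed
  have fin: "finite (range m)" by (rule finite_subset[of _ "{..<M}"]) (use mM in blast, simp)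
  have "Max (range m) \<in> range m" using fin by (intro Max_in) auto
  then obtain K where K: "m K = Max (range m)" by (metis imageE)
  have mk: "m k = m K" if "k \<ge> K" for k
    using lift_Suc_mono_le[of m, OF mmono that] Max_ge[OF fin, of "m k"] K by simp
  show "\<exists>m K. \<forall>k\<ge>K. z (Suc k) = gd_map F (\<kappa> ^ m * \<theta>\<^sub>0) (z k) \<and> accepted F (z k) (\<kappa> ^ m * \<theta>\<^sub>0)"
  proof (rule exI[of _ "m K"], rule exI[of _ K], intro allI impI)
    fix k assume "K \<le> k"
    then have tk: "t (Suc k) = \<kappa> ^ m K * \<theta>\<^sub>0" using mk[of "Suc k"] m[of "Suc k"] by simp
    have "accepted F (z k) (t (Suc k))" using step[of k] inv[of k] c by fastforce
    then show "z (Suc k) = gd_map F (\<kappa> ^ m K * \<theta>\<^sub>0) (z k) \<and> accepted F (z k) (\<kappa> ^ m K * \<theta>\<^sub>0)"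
      using tk zS[of k] by simp
  qed
qed

section \<open>Convergence under the KL property\<close>

lemma regular_subdiff_grad:
  assumes "GDERIV f x :> D"
  shows "D \<in> regular_subdiff f x"
proof -
  have "((\<lambda>y. norm ((f y - f x) - (y - x) \<bullet> D) / norm (y - x)) \<longlongrightarrow> 0) (at x)"
    using assms unfolding gderiv_def has_derivative_iff_norm by simp
  then have "((\<lambda>y. (f y - f x - D \<bullet> (y - x)) / norm (y - x)) \<longlongrightarrow> 0) (at x)"
    by (subst tendsto_rabs_zero_iff[symmetric]) (simp add: inner_commute)
  then have "((\<lambda>y. ereal ((f y - f x - D \<bullet> (y - x)) / norm (y - x))) \<longlongrightarrow> 0) (at x)"
    by (simp add: zero_ereal_def)
  then show ?thesis
    unfolding regular_subdiff_def by (simp add: lim_imp_Liminf)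
qed

text \<open>The convex subgradient inequality only raises the difference quotient. This inclusion
  suffices because the KL inequality is applied only to explicitly exhibited subgradients.\<close>

lemma regular_subdiff_add_convex:
  assumes D: "D \<in> regular_subdiff f x" and w: "w \<in> convex_subdiff k x"
  shows "D + w \<in> regular_subdiff (\<lambda>x. f x + k x) x"
proof -
  have "Liminf (at x) (\<lambda>y. ereal ((f y - f x - D \<bullet> (y - x)) / norm (y - x)))
      \<le> Liminf (at x) (\<lambda>y. ereal ((f y + k y - (f x + k x) - (D + w) \<bullet> (y - x)) / norm (y - x)))"
  proof (rule Liminf_mono, rule always_eventually, rule allI)
    fix y
    have "k y \<ge> k x + w \<bullet> (y - x)" using w by (simp add: convex_subdiff_def)
    then show "ereal ((f y - f x - D \<bullet> (y - x)) / norm (y - x))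
      \<le> ereal ((f y + k y - (f x + k x) - (D + w) \<bullet> (y - x)) / norm (y - x))"
      by (auto intro!: divide_right_mono simp: inner_add_left)
  qed
  then show ?thesis using D unfolding regular_subdiff_def by auto
qed

lemma einfdist_limiting_subdiff_le:
  assumes "v \<in> regular_subdiff f x"
  shows "einfdist 0 (limiting_subdiff f x) \<le> ereal (norm v)"
proof -
  have "v \<in> limiting_subdiff f x"
    unfolding limiting_subdiff_def using assms
    by (intro CollectI exI[of _ "\<lambda>_. x"] exI[of _ "\<lambda>_. v"]) auto
  then show ?thesis
    unfolding einfdist_def by (intro INF_lower2[of v]) (auto simp: dist_norm)
qed

lemma desingularizing_deriv_pos:
  "desingularizing r \<phi> \<Longrightarrow> 0 < t \<Longrightarrow> ereal t < r \<Longrightarrow> deriv \<phi> t > 0"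
  by (simp add: desingularizing_def Let_def)

lemma desingularizing_nonneg:
  "desingularizing r \<phi> \<Longrightarrow> 0 \<le> t \<Longrightarrow> ereal t < r \<Longrightarrow> \<phi> t \<ge> 0"
  by (simp add: desingularizing_def Let_def)

text \<open>The tangent is taken at an interior point \<open>t\<close>, but \<open>s\<close> may be
  the endpoint 0, where no derivative is assumed.\<close>

lemma desingularizing_concave:
  assumes d: "desingularizing r \<phi>" and t: "0 < t" "ereal t < r" and s: "0 \<le> s" "ereal s < r"
  shows "\<phi> s \<le> \<phi> t + deriv \<phi> t * (s - t)"
proof -
  define I where "I = {t. 0 \<le> t \<and> ereal t < r}"
  have conc: "convex_on I (\<lambda>t. - \<phi> t)" and diff: "\<phi> differentiable (at t)"
    using d t by (auto simp: desingularizing_def Let_def I_def concave_on_def)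
  have "is_interval I"
    unfolding is_interval_1 I_def by (auto intro: le_less_trans simp del: ereal_less_eq simp: ereal_less_eq(3)[symmetric])
  then have conn: "connected I" by (simp add: is_interval_connected)
  have "open {t. 0 < t \<and> ereal t < r}"
    by (intro open_Collect_conj open_Collect_less continuous_intros)
  then have int: "t \<in> interior I"
    using t by (intro interiorI[of "{t. 0 < t \<and> ereal t < r}"]) (auto simp: I_def)
  have "((\<lambda>t. - \<phi> t) has_field_derivative - deriv \<phi> t) (at t within I)"
    using diff by (intro DERIV_minus) (auto intro: has_field_derivative_at_within simp: DERIV_deriv_iff_real_differentiable)
  from convex_on_imp_above_tangent[OF conc conn int _ this, of s] s
  show ?thesis by (simp add: I_def)
qed

lemma desingularizing_small:
  assumes d: "desingularizing r \<phi>" and "r > 0" "e > 0"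
  shows "\<exists>\<eta>>0. \<forall>t. 0 \<le> t \<and> ereal t < r \<and> t < \<eta> \<longrightarrow> \<phi> t < e"
proof -
  define I where "I = {t. 0 \<le> t \<and> ereal t < r}"
  have "continuous_on I \<phi>" "\<phi> 0 = 0" using d by (auto simp: desingularizing_def Let_def I_def)
  moreover have "0 \<in> I" using \<open>r > 0\<close> by (simp add: I_def zero_ereal_def[symmetric])
  ultimately obtain \<eta> where "\<eta> > 0" "\<And>t. t \<in> I \<Longrightarrow> dist t 0 < \<eta> \<Longrightarrow> dist (\<phi> t) 0 < e"
    using \<open>e > 0\<close> unfolding continuous_on_iff by metis
  then show ?thesis by (intro exI[of _ \<eta>]) (force simp: I_def dist_real_def)
qed

text \<open>A regular subgradient is limiting, by constant sequences, so its norm bounds the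
  distance from 0 to the limiting subdifferential. From here on the KL inequality is used in this
  form.\<close>

lemma KL_withD:
  assumes "KL_with \<phi> f x"
  obtains r V where "r > 0" "open V" "x \<in> V" "desingularizing r \<phi>"
    "\<And>y v. y \<in> V \<Longrightarrow> 0 < f y - f x \<Longrightarrow> ereal (f y - f x) < r \<Longrightarrow> v \<in> regular_subdiff f y \<Longrightarrow>
       deriv \<phi> (f y - f x) * norm v \<ge> 1"
proof -
  obtain r V where rV: "r > 0" "open V" "x \<in> V" "desingularizing r \<phi>"
    "\<And>y. y \<in> V \<Longrightarrow> 0 < f y - f x \<Longrightarrow> ereal (f y - f x) < r \<Longrightarrow>
        ereal (deriv \<phi> (f y - f x)) * einfdist 0 (limiting_subdiff f y) \<ge> 1"
    using assms unfolding KL_with_def by blast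
  have "deriv \<phi> (f y - f x) * norm v \<ge> 1"
    if y: "y \<in> V" "0 < f y - f x" "ereal (f y - f x) < r" and v: "v \<in> regular_subdiff f y" for y v
  proof -
    have "1 \<le> ereal (deriv \<phi> (f y - f x)) * einfdist 0 (limiting_subdiff f y)"
      by (rule rV(5)[OF y])
    also have "\<dots> \<le> ereal (deriv \<phi> (f y - f x)) * ereal (norm v)"
      using desingularizing_deriv_pos[OF rV(4) y(2,3)] einfdist_limiting_subdiff_le[OF v]
      by (intro ereal_mult_left_mono) auto
    finally show ?thesis by (simp add: one_ereal_def)
  qed
  with rV(1-4) that show ?thesis by blast
qed

text \<open>The sufficient decrease makes \<open>\<phi> (F (z k) - F x)\<close> drop by at least a multiple of the step length,
  so the orbit has finite length once it is trapped near a cluster point.\<close>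

lemma (in C2_pair) KL_descent_converges:
  assumes step: "\<And>k. z (Suc k) = z k - \<theta> *\<^sub>R g (z k)" and \<theta>: "\<theta> > 0"
    and dec: "\<And>k. F (z (Suc k)) \<le> F (z k) - c * (norm (g (z k)))\<^sup>2" and c: "c > 0"
    and bd: "bounded (range z)"
    and KL: "\<And>x. g x = 0 \<Longrightarrow> KL_property F x"
  shows "\<exists>x. z \<longlonglongrightarrow> x \<and> g x = 0"
proof -
  have Fdec: "decseq (\<lambda>k. F (z k))"
  proof (rule decseq_SucI)
    fix k
    have "0 \<le> c * (norm (g (z k)))\<^sup>2" using c by simp
    then show "F (z (Suc k)) \<le> F (z k)" using dec[of k] by linarith
  qed
  have "compact (F ` closure (range z))"
    using bd by (intro compact_continuous_image cont_F) (simp add: compact_closure)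
  then have "bounded (F ` closure (range z))" by (rule compact_imp_bounded)
  then obtain B where B: "\<And>x. x \<in> closure (range z) \<Longrightarrow> \<bar>F x\<bar> \<le> B"
    by (auto simp: bounded_iff)
  have "\<bar>F (z k)\<bar> \<le> B" for k by (intro B) (meson closure_subset rangeI subsetD)
  then have "- B \<le> F (z k)" for k by (metis abs_le_D2 minus_le_iff)
  then obtain Fs where Fs: "(\<lambda>k. F (z k)) \<longlonglongrightarrow> Fs" "\<And>k. Fs \<le> F (z k)"
    using decseq_convergent[OF Fdec] by metis
  have e0: "(\<lambda>k. norm (g (z k))) \<longlonglongrightarrow> 0"
  proof -
    have lim: "(\<lambda>k. (F (z k) - F (z (Suc k))) / c) \<longlonglongrightarrow> (Fs - Fs) / c"
      by (intro tendsto_divide tendsto_diff tendsto_const Fs(1) LIMSEQ_Suc[OF Fs(1)]) (use c in simp)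
    have up: "(norm (g (z k)))\<^sup>2 \<le> (F (z k) - F (z (Suc k))) / c" for k
      using dec[of k] c by (simp add: field_simps)
    have "(\<lambda>k. (norm (g (z k)))\<^sup>2) \<longlonglongrightarrow> 0"
    proof (rule tendsto_sandwich[OF _ _ tendsto_const])
      show "(\<lambda>k. (F (z k) - F (z (Suc k))) / c) \<longlonglongrightarrow> 0" using lim by simp
    qed (use up in simp_all)
    then have "(\<lambda>k. sqrt ((norm (g (z k)))\<^sup>2)) \<longlonglongrightarrow> sqrt 0" by (rule tendsto_real_sqrt)
    then show ?thesis by simp
  qed
  obtain x \<sigma> where \<sigma>: "strict_mono (\<sigma> :: nat \<Rightarrow> nat)" "(z \<circ> \<sigma>) \<longlonglongrightarrow> x"
    using bounded_closure bd compact_closure[of "range z"] unfolding compact_def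
    by (metis closure_subset rangeI subsetD)
  have gx: "g x = 0"
  proof -
    have "isCont g x" using cont_g[of UNIV] by (simp add: continuous_on_eq_continuous_at)
    then have "(\<lambda>k. g ((z \<circ> \<sigma>) k)) \<longlonglongrightarrow> g x" using \<sigma>(2) by (rule isCont_tendsto_compose)
    then have "(\<lambda>k. norm (g ((z \<circ> \<sigma>) k))) \<longlonglongrightarrow> norm (g x)" by (rule tendsto_norm)
    moreover have "(\<lambda>k. norm (g ((z \<circ> \<sigma>) k))) \<longlonglongrightarrow> 0"
      using LIMSEQ_subseq_LIMSEQ[OF e0 \<sigma>(1)] by (simp add: o_def)
    ultimately show ?thesis using LIMSEQ_unique by fastforce
  qed
  have Fx: "F x = Fs"
  proof -
    have "isCont F x" using cont_F[of UNIV] by (simp add: continuous_on_eq_continuous_at)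
    then have "(\<lambda>k. F ((z \<circ> \<sigma>) k)) \<longlonglongrightarrow> F x" using \<sigma>(2) by (rule isCont_tendsto_compose)
    moreover have "(\<lambda>k. F ((z \<circ> \<sigma>) k)) \<longlonglongrightarrow> Fs"
      using LIMSEQ_subseq_LIMSEQ[OF Fs(1) \<sigma>(1)] by (simp add: o_def)
    ultimately show ?thesis using LIMSEQ_unique by blast
  qed
  \<comment> \<open>Once the limit value is attained, sufficient decrease forces the gradient to
    vanish and the sequence stops. Otherwise the gap \<open>r k\<close> is positive for all
    \<open>k\<close>, as the KL inequality requires.\<close>
  have "convergent z"
  proof (cases "\<exists>k. F (z k) = Fs")
    case True
    then obtain k where k: "F (z k) = Fs" by blast
    have stop: "g (z m) = 0" if "m \<ge> k" for m
    proof -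
      have "F (z m) = Fs" using decseqD[OF Fdec that] k Fs(2)[of m] by simp
      then have "c * (norm (g (z m)))\<^sup>2 \<le> 0" using dec[of m] Fs(2)[of "Suc m"] by linarith
      then show ?thesis using c by (simp add: mult_le_0_iff)
    qed
    have "z m = z k" if "m \<ge> k" for m
      using that by (induction m rule: dec_induct) (simp_all add: step stop)
    then have "\<forall>\<^sub>F m in sequentially. z m = z k" by (rule eventually_sequentiallyI[of k])
    then show ?thesis using tendsto_eventually[of z "z k"] convergentI by blast
  next
    case False
    define r where "r k = F (z k) - F x" for k
    have r: "r k > 0" for k using False Fs(2)[of k] Fx by (auto simp: r_def less_le)
    have r0: "r \<longlonglongrightarrow> 0" using tendsto_diff[OF Fs(1) tendsto_const[of "F x"]] Fx by (simp add: r_def[abs_def])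
    obtain \<phi> where "KL_with \<phi> F x" using KL[OF gx] unfolding KL_property_def by blast
    then obtain \<rho> V where V: "\<rho> > 0" "open V" "x \<in> V" "desingularizing \<rho> \<phi>"
      "\<And>y v. y \<in> V \<Longrightarrow> 0 < F y - F x \<Longrightarrow> ereal (F y - F x) < \<rho> \<Longrightarrow> v \<in> regular_subdiff F y \<Longrightarrow>
       deriv \<phi> (F y - F x) * norm v \<ge> 1"
      by (rule KL_withD) blast
    obtain \<delta> where \<delta>: "\<delta> > 0" "ball x \<delta> \<subseteq> V" using V(2,3) open_contains_ball by blast
    \<comment> \<open>A step has length \<theta> times the gradient norm \<open>n\<close>, while the
      estimate below bounds \<open>c * n\<close>; \<open>A\<close> converts one into the
      other.\<close>
    define A where "A = \<theta> / c"
    have A: "A > 0" using \<theta> c by (simp add: A_def)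
    obtain \<eta> where \<eta>: "\<eta> > 0" "\<And>t. 0 \<le> t \<Longrightarrow> ereal t < \<rho> \<Longrightarrow> t < \<eta> \<Longrightarrow> \<phi> t < \<delta> / (2 * A)"
      using desingularizing_small[OF V(4,1), of "\<delta> / (2 * A)"] \<delta>(1) A by auto
    \<comment> \<open>A real bound is extracted because \<open>\<rho>\<close> may be
      infinite.\<close>
    obtain \<eta>' where \<eta>': "\<eta>' > 0" "ereal \<eta>' \<le> \<rho>"
      using V(1) by (cases \<rho>) (auto intro: that[of 1])
    have "(r \<circ> \<sigma>) \<longlonglongrightarrow> 0" by (rule LIMSEQ_subseq_LIMSEQ[OF r0 \<sigma>(1)])
    moreover have "0 < min \<eta> \<eta>'" using \<eta>(1) \<eta>'(1) by simp
    ultimately have ev1: "\<forall>\<^sub>F k in sequentially. (r \<circ> \<sigma>) k < min \<eta> \<eta>'"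
      by (rule order_tendstoD(2))
    have ev2: "\<forall>\<^sub>F k in sequentially. dist ((z \<circ> \<sigma>) k) x < \<delta> / 2"
      using tendstoD[OF \<sigma>(2), of "\<delta> / 2"] \<delta>(1) by simp
    obtain i where i: "(r \<circ> \<sigma>) i < min \<eta> \<eta>'" "dist ((z \<circ> \<sigma>) i) x < \<delta> / 2"
      using eventually_happens[OF eventually_conj[OF ev1 ev2]] by auto
    define K where "K = \<sigma> i"
    have K: "r K < \<eta>" "r K < \<eta>'" "dist (z K) x < \<delta> / 2" using i by (auto simp: K_def)
    have rK: "r m \<le> r K" if "m \<ge> K" for m using decseqD[OF Fdec that] by (simp add: r_def)
    have r\<rho>: "ereal (r m) < \<rho>" if "m \<ge> K" for m
    proof -
      have "ereal (r m) < ereal \<eta>'" using rK[OF that] K(2) by simp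
      then show ?thesis using \<eta>'(2) by (rule less_le_trans)
    qed
    have \<phi>K: "A * \<phi> (r K) < \<delta> / 2"
      using \<eta>(2)[of "r K"] r[of K] r\<rho>[of K] K(1) A by (simp add: field_simps)
    have len: "norm (z (Suc m) - z m) \<le> A * (\<phi> (r m) - \<phi> (r (Suc m)))" if m: "m \<ge> K" "z m \<in> ball x \<delta>" for m
    proof -
      define n where "n = norm (g (z m))"
      have d1: "deriv \<phi> (r m) * n \<ge> 1"
        unfolding r_def n_def using r[of m] r\<rho>[OF m(1)] m(2) \<delta>(2)
        by (intro V(5)) (simp_all add: r_def regular_subdiff_grad der subset_iff)
      have "deriv \<phi> (r m) > 0" using desingularizing_deriv_pos[OF V(4) r r\<rho>[OF m(1)]] .
      then have "deriv \<phi> (r m) * (c * n\<^sup>2) \<le> deriv \<phi> (r m) * (r m - r (Suc m))"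
        using dec[of m] by (intro mult_left_mono) (auto simp: r_def n_def)
      also have "\<dots> \<le> \<phi> (r m) - \<phi> (r (Suc m))"
        using desingularizing_concave[OF V(4) r r\<rho>[OF m(1)], of "r (Suc m)"] r[of "Suc m"] r\<rho>[of "Suc m"] m(1)
        by (simp add: algebra_simps)
      finally have "(deriv \<phi> (r m) * n) * (c * n) \<le> \<phi> (r m) - \<phi> (r (Suc m))"
        by (simp add: power2_eq_square mult_ac)
      moreover have "1 * (c * n) \<le> (deriv \<phi> (r m) * n) * (c * n)"
        using d1 c by (intro mult_right_mono) (auto simp: n_def)
      ultimately have "c * n \<le> \<phi> (r m) - \<phi> (r (Suc m))" by simp
      then have "A * (c * n) \<le> A * (\<phi> (r m) - \<phi> (r (Suc m)))" using A by (intro mult_left_mono) auto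
      moreover have "norm (z (Suc m) - z m) = A * (c * n)"
        using step[of m] \<theta> c by (simp add: n_def A_def)
      ultimately show ?thesis by simp
    qed
    \<comment> \<open>Position and length must be proved together: the KL inequality bounds the next
      step only inside the ball, and the length bound, below \<open>\<delta> / 2\<close> from a
      start within \<open>\<delta> / 2\<close> of \<open>x\<close>, keeps the next iterate
      inside.\<close>
    have trap: "z (K + m) \<in> ball x \<delta> \<and> (\<Sum>j<m. norm (z (Suc (K + j)) - z (K + j))) \<le> A * (\<phi> (r K) - \<phi> (r (K + m)))" for m
    proof (induction m)
      case 0
      show ?case using K(3) \<delta>(1) by (simp add: dist_commute)
    next
      case (Suc m)
      have sum: "(\<Sum>j<Suc m. norm (z (Suc (K + j)) - z (K + j))) \<le> A * (\<phi> (r K) - \<phi> (r (K + Suc m)))"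
        using Suc len[of "K + m"] by (simp add: algebra_simps)
      have tele: "z (K + Suc m) - z K = (\<Sum>j<Suc m. z (Suc (K + j)) - z (K + j))"
        using sum_lessThan_telescope[of "\<lambda>j. z (K + j)" "Suc m"] by (simp del: sum.lessThan_Suc)
      have "norm (z (K + Suc m) - z K) \<le> A * (\<phi> (r K) - \<phi> (r (K + Suc m)))"
        unfolding tele by (rule order_trans[OF norm_sum sum])
      also have "\<dots> \<le> A * \<phi> (r K)"
        using desingularizing_nonneg[OF V(4), of "r (K + Suc m)"] r[of "K + Suc m"] r\<rho>[of "K + Suc m"] A
        by (intro mult_left_mono) auto
      finally have "dist (z (K + Suc m)) (z K) < \<delta> / 2" using \<phi>K by (simp add: dist_norm)
      then have "z (K + Suc m) \<in> ball x \<delta>"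
        using K(3) dist_triangle[of "z (K + Suc m)" x "z K"] by (simp add: dist_commute)
      with sum show ?case by blast
    qed
    have "summable (\<lambda>j. norm (z (Suc (K + j)) - z (K + j)))"
    proof (rule summableI_nonneg_bounded[where x = "A * \<phi> (r K)"])
      fix m
      have "\<phi> (r (K + m)) \<ge> 0" using desingularizing_nonneg[OF V(4)] r[of "K + m"] r\<rho>[of "K + m"] by simp
      then have "A * (\<phi> (r K) - \<phi> (r (K + m))) \<le> A * \<phi> (r K)" using A by (intro mult_left_mono) auto
      then show "(\<Sum>j<m. norm (z (Suc (K + j)) - z (K + j))) \<le> A * \<phi> (r K)" using trap[of m] by linarith
    qed simp
    then have "summable (\<lambda>j. z (Suc (K + j)) - z (K + j))" by (rule summable_norm_cancel)
    then have "convergent (\<lambda>n. \<Sum>j<n. z (Suc (K + j)) - z (K + j))" by (simp add: summable_iff_convergent)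
    moreover have "(\<lambda>n. \<Sum>j<n. z (Suc (K + j)) - z (K + j)) = (\<lambda>n. z (n + K) - z K)"
      using sum_lessThan_telescope[of "\<lambda>j. z (K + j)"] by (simp add: add.commute[of _ K])
    ultimately have "convergent (\<lambda>n. z (n + K) - z K)" by simp
    then have "convergent (\<lambda>n. z (n + K))" by (simp add: convergent_diff_const_right_iff)
    then show ?thesis by (simp add: convergent_ignore_initial_segment)
  qed
  then obtain y where y: "z \<longlonglongrightarrow> y" by (auto simp: convergent_def)
  have "(z \<circ> \<sigma>) \<longlonglongrightarrow> y" by (rule LIMSEQ_subseq_LIMSEQ[OF y \<sigma>(1)])
  then have "y = x" using \<sigma>(2) LIMSEQ_unique by blast
  then show ?thesis using y gx by blast
qed

section \<open>Almost every orbit avoids saddles\<close>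

lemma (in C2_pair) gd_map_strict_diff:
  assumes "\<theta> > 0" "\<epsilon> > 0"
  shows "\<exists>d>0. \<forall>y\<in>ball x d. \<forall>z\<in>ball x d.
    norm (gd_map F \<theta> y - gd_map F \<theta> z - ((y - z) - \<theta> *\<^sub>R H x (y - z))) \<le> \<epsilon> * norm (y - z)"
proof -
  have "\<epsilon> / \<theta> > 0" using assms by simp
  from strict_diff[OF this, of x] obtain d where d: "d > 0"
    "\<And>y z. y \<in> ball x d \<Longrightarrow> z \<in> ball x d \<Longrightarrow> norm (g y - g z - H x (y - z)) \<le> \<epsilon> / \<theta> * norm (y - z)"
    by blast
  have "norm (gd_map F \<theta> y - gd_map F \<theta> z - ((y - z) - \<theta> *\<^sub>R H x (y - z))) \<le> \<epsilon> * norm (y - z)"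
    if "y \<in> ball x d" "z \<in> ball x d" for y z
  proof -
    have "gd_map F \<theta> y - gd_map F \<theta> z - ((y - z) - \<theta> *\<^sub>R H x (y - z)) = (- \<theta>) *\<^sub>R (g y - g z - H x (y - z))"
      by (simp add: gd_map_def grad_eq algebra_simps)
    then have "norm (gd_map F \<theta> y - gd_map F \<theta> z - ((y - z) - \<theta> *\<^sub>R H x (y - z))) = \<theta> * norm (g y - g z - H x (y - z))"
      using assms(1) by simp
    also have "\<dots> \<le> \<theta> * (\<epsilon> / \<theta> * norm (y - z))"
      using d(2)[OF that] assms(1) by (intro mult_left_mono) simp_all
    finally show ?thesis using assms(1) by simp
  qed
  then show ?thesis using d(1) by blast
qed

text \<open>Each saddle has a neighbourhood in which only a null set of orbits stays forever, and
  countably many of these cover all saddles. A convergent orbit stays in one of them only from some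
  time on, hence the conclusion about some \<open>z k\<close> instead of \<open>z 0\<close>.\<close>

lemma (in C2_pair) negligible_orbits_to_saddles:
  assumes "\<theta> > 0"
  shows "\<exists>N. negligible N \<and> (\<forall>z x v. (\<forall>k. z (Suc k) = gd_map F \<theta> (z k)) \<longrightarrow> z \<longlonglongrightarrow> x \<longrightarrow> v \<bullet> H x v < 0 \<longrightarrow>
    (\<exists>k. z k \<in> N))"
proof -
  define Sd where "Sd = {x. \<exists>v. v \<bullet> H x v < 0}"
  have "\<exists>B. open B \<and> x \<in> B \<and> negligible {y. \<forall>k. (gd_map F \<theta> ^^ k) y \<in> B}" if x: "x \<in> Sd" for x
  proof -
    obtain v where v: "v \<bullet> H x v < 0" using x by (auto simp: Sd_def)
    then have v0: "v \<noteq> 0" by auto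
    define e where "e = v /\<^sub>R norm v"
    have e: "norm e = 1" using v0 by (simp add: e_def)
    have "e \<bullet> H x e = (v \<bullet> H x v) / (norm v)\<^sup>2"
      by (simp add: e_def blinfun.scaleR_right power2_eq_square divide_inverse)
    then have eH: "e \<bullet> H x e < 0" using v v0 by (simp add: divide_neg_pos)
    show ?thesis
    proof (rule negligible_staying_near_saddle[where T = "\<lambda>w. w - \<theta> *\<^sub>R H x w" and e = e])
      show "linear (\<lambda>w. w - \<theta> *\<^sub>R H x w)"
        by (intro linearI) (simp_all add: blinfun.add_right blinfun.scaleR_right algebra_simps)
      show "(u - \<theta> *\<^sub>R H x u) \<bullet> w = u \<bullet> (w - \<theta> *\<^sub>R H x w)" for u w
        using H_sym[of x u w] by (simp add: inner_diff_left inner_diff_right inner_commute)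
      show "1 < e \<bullet> (e - \<theta> *\<^sub>R H x e)"
        using e eH assms by (simp add: inner_diff_right norm_eq_1 mult_pos_neg)
      show "\<exists>d>0. \<forall>y\<in>ball x d. \<forall>z\<in>ball x d.
          norm (gd_map F \<theta> y - gd_map F \<theta> z - (y - z - \<theta> *\<^sub>R H x (y - z))) \<le> \<epsilon> * norm (y - z)" if "\<epsilon> > 0" for \<epsilon>
        by (rule gd_map_strict_diff[OF assms that])
    qed (rule e)
  qed
  then obtain B where B: "\<And>x. x \<in> Sd \<Longrightarrow> open (B x)" "\<And>x. x \<in> Sd \<Longrightarrow> x \<in> B x"
    "\<And>x. x \<in> Sd \<Longrightarrow> negligible {y. \<forall>k. (gd_map F \<theta> ^^ k) y \<in> B x}" by metis
  obtain C where C: "C \<subseteq> B ` Sd" "countable C" "\<Union>C = \<Union>(B ` Sd)"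
    using Lindelof[of "B ` Sd"] B(1) by blast
  define N where "N = (\<Union>b\<in>C. {y. \<forall>k. (gd_map F \<theta> ^^ k) y \<in> b})"
  have "negligible N"
    unfolding N_def using C(1,2) B(3) by (intro negligible_countable_Union) auto
  moreover have "\<exists>k. z k \<in> N"
    if z: "\<And>k. z (Suc k) = gd_map F \<theta> (z k)" "z \<longlonglongrightarrow> x" and v: "v \<bullet> H x v < 0" for z x v
  proof -
    have "x \<in> Sd" using v by (auto simp: Sd_def)
    then have "x \<in> \<Union>C" using B(2) C(3) by auto
    then obtain b where b: "b \<in> C" "x \<in> b" by blast
    then have "open b" using C(1) B(1) by auto
    from topological_tendstoD[OF z(2) this b(2)] obtain K where K: "\<And>k. k \<ge> K \<Longrightarrow> z k \<in> b"
      by (auto simp: eventually_sequentially)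
    have "(gd_map F \<theta> ^^ k) (z K) = z (K + k)" for k by (induction k) (simp_all add: z(1))
    then have "z K \<in> N" unfolding N_def using K by (intro UN_I[OF b(1)]) simp
    then show ?thesis by blast
  qed
  ultimately show ?thesis by blast
qed

text \<open>The adaptive iteration is not one map, but each iterate is a word in the maps
  \<open>G m\<close> applied to the start, and the tail is an orbit of a single \<open>G m\<close>.
  The bad starting points lie in preimages of the null sets \<open>N m\<close> under words: a union
  over the countable type of pairs of a word and an index.\<close>

lemma (in C2_pair) negligible_gd_to_saddle:
  fixes \<theta>\<^sub>0 \<kappa> :: real
  assumes lb: "level_bounded F" and \<theta>0: "\<theta>\<^sub>0 > 0" and \<kappa>: "0 < \<kappa>" "\<kappa> < 1"
    and A1: "\<And>m. \<exists>U. open U \<and> negligible (- U) \<and> (\<forall>x\<in>U. inj (\<lambda>w. w - (\<kappa> ^ m * \<theta>\<^sub>0) *\<^sub>R H x w))"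
  shows "negligible {z\<^sub>0. \<exists>x v. gd_iterate F \<theta>\<^sub>0 \<kappa> z\<^sub>0 \<longlonglongrightarrow> x \<and> v \<bullet> H x v < 0}"
proof -
  define G where "G m = gd_map F (\<kappa> ^ m * \<theta>\<^sub>0)" for m
  have pos: "\<kappa> ^ m * \<theta>\<^sub>0 > 0" for m using \<kappa> \<theta>0 by simp
  have pre: "negligible {z. G m z \<in> N}" if "negligible N" for m N
  proof -
    obtain U where U: "open U" "negligible (- U)" "\<And>x. x \<in> U \<Longrightarrow> inj (\<lambda>w. w - (\<kappa> ^ m * \<theta>\<^sub>0) *\<^sub>R H x w)"
      using A1[of m] by blast
    show ?thesis
      unfolding G_def
    proof (rule negligible_preimage[where D = "\<lambda>x w. w - (\<kappa> ^ m * \<theta>\<^sub>0) *\<^sub>R H x w", OF U(1,2) _ U(3) _ that])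
      show "linear (\<lambda>w. w - (\<kappa> ^ m * \<theta>\<^sub>0) *\<^sub>R H x w)" for x
        by (intro linearI) (simp_all add: blinfun.add_right blinfun.scaleR_right algebra_simps)
    qed (assumption, rule gd_map_strict_diff[OF pos], assumption)
  qed
  have pre': "negligible {z. fold G ms z \<in> N}" if "negligible N" for ms N
  proof (induction ms)
    case (Cons m ms)
    from pre[OF this, of m] show ?case by simp
  qed (use that in simp)
  have "\<forall>m. \<exists>N. negligible N \<and> (\<forall>z x v. (\<forall>k. z (Suc k) = G m (z k)) \<longrightarrow> z \<longlonglongrightarrow> x \<longrightarrow> v \<bullet> H x v < 0 \<longrightarrow>
    (\<exists>k. z k \<in> N))"
    unfolding G_def by (intro allI negligible_orbits_to_saddles[OF pos])
  then obtain N where N: "\<forall>m. negligible (N m) \<and> (\<forall>z x v. (\<forall>k. z (Suc k) = G m (z k)) \<longrightarrow>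
      z \<longlonglongrightarrow> x \<longrightarrow> v \<bullet> H x v < 0 \<longrightarrow> (\<exists>k. z k \<in> N m))"
    by (rule choice[THEN exE])
  have "\<exists>ms m. fold G ms z\<^sub>0 \<in> N m"
    if conv: "gd_iterate F \<theta>\<^sub>0 \<kappa> z\<^sub>0 \<longlonglongrightarrow> x" and v: "v \<bullet> H x v < 0" for z\<^sub>0 x v
  proof -
    define z where "z = gd_iterate F \<theta>\<^sub>0 \<kappa> z\<^sub>0"
    note gd = gd_iterate_eventually_constant_step[OF lb \<theta>0 \<kappa>, of z\<^sub>0, folded z_def G_def]
    have word: "\<exists>ms. z k = fold G ms z\<^sub>0" for k
    proof (induction k)
      case 0
      show ?case by (rule exI[of _ "[]"]) (simp add: z_def gd_iterate_def)
    next
      case (Suc k)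
      then obtain ms where "z k = fold G ms z\<^sub>0" by blast
      moreover obtain m where "z (Suc k) = G m (z k)" using gd(2) by blast
      ultimately have "z (Suc k) = fold G (ms @ [m]) z\<^sub>0" by simp
      then show ?case by blast
    qed
    obtain m K where K: "\<And>k. k \<ge> K \<Longrightarrow> z (Suc k) = G m (z k)" using gd(3) by blast
    have "\<forall>k. z (Suc k + K) = G m (z (k + K))" using K by simp
    moreover have "(\<lambda>k. z (k + K)) \<longlonglongrightarrow> x"
      using conv unfolding z_def by (rule LIMSEQ_ignore_initial_segment)
    ultimately obtain k where "z (k + K) \<in> N m"
      using N[THEN spec, of m, THEN conjunct2, THEN spec, of "\<lambda>k. z (k + K)"] v by blast
    then show ?thesis using word by metis
  qed
  then have "{z\<^sub>0. \<exists>x v. gd_iterate F \<theta>\<^sub>0 \<kappa> z\<^sub>0 \<longlonglongrightarrow> x \<and> v \<bullet> H x v < 0}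
      \<subseteq> (\<Union>p. {z. fold G (fst p) z \<in> N (snd p)})"
    by force
  moreover have "negligible (\<Union>p\<in>UNIV. {z. fold G (fst p) z \<in> N (snd p)})"
    by (intro negligible_countable_Union) (auto intro!: pre' simp: N)
  ultimately show ?thesis using negligible_subset by blast
qed

section \<open>Tangent inequalities for real powers\<close>

lemma powr_diff_ge:
  fixes x y q :: real
  assumes q: "0 < q" "q < 1" and xy: "0 \<le> y" "y \<le> x" "0 < x"
  shows "q * x powr (q - 1) * (x - y) \<le> x powr q - y powr q"
proof (cases "y = 0")
  case True
  have "x powr (q - 1) * x = x powr q" using xy by (simp add: powr_diff)
  then have "q * x powr (q - 1) * x = q * x powr q" by simp
  also have "\<dots> \<le> 1 * x powr q" using q by (intro mult_right_mono) auto
  finally show ?thesis using True by simp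
next
  case False
  then have "y > 0" using xy by simp
  \<comment> \<open>Young's inequality with weights q and 1 - q is the tangent inequality of t^q at
    x, multiplied by x^(1-q).\<close>
  then have "y powr q * x powr (1 - q) \<le> q * y + (1 - q) * x"
    using Youngs_inequality_0[of q "1 - q" y x] q xy by simp
  then have "x powr (q - 1) * (y powr q * x powr (1 - q)) \<le> x powr (q - 1) * (q * y + (1 - q) * x)"
    by (intro mult_left_mono) simp_all
  moreover have "x powr (q - 1) * (y powr q * x powr (1 - q)) = y powr q"
    using xy powr_add[of x "q - 1" "1 - q"] by (simp add: mult_ac)
  moreover have "x powr (q - 1) * (q * y + (1 - q) * x) = x powr q - q * x powr (q - 1) * (x - y)"
  proof -
    have "x powr (q - 1) * x = x powr q" using xy by (simp add: powr_diff)
    then show ?thesis by (simp add: algebra_simps)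
  qed
  ultimately show ?thesis by simp
qed

text \<open>This is the tangent inequality for the convex function t^(-s) at x. After scaling to t =
  y / x it follows from ln t \<le> t - 1 and exp a \<ge> 1 + a.\<close>

lemma powr_minus_diff_ge:
  fixes x y s :: real
  assumes s: "0 < s" and xy: "0 < y" "y \<le> x"
  shows "s * x powr (- s - 1) * (x - y) \<le> y powr (- s) - x powr (- s)"
proof -
  define t where "t = y / x"
  have t: "t > 0" using xy by (simp add: t_def)
  have "ln t \<le> t - 1" using t by (rule ln_le_minus_one)
  from mult_left_mono[OF this, of s] s have "s * (1 - t) \<le> - s * ln t" by (simp add: algebra_simps)
  also have "\<dots> \<le> t powr (- s) - 1" using t exp_ge_add_one_self[of "- s * ln t"] by (simp add: powr_def)
  finally have "x powr (- s) * (s * (1 - t)) \<le> x powr (- s) * (t powr (- s) - 1)"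
    by (intro mult_left_mono) simp_all
  moreover have "x powr (- s) * t powr (- s) = y powr (- s)"
    using xy by (simp add: t_def powr_mult[symmetric])
  moreover have "x powr (- s) * (s * (1 - t)) = s * x powr (- s - 1) * (x - y)"
    using xy by (simp add: t_def powr_diff field_simps)
  ultimately show ?thesis by (simp add: algebra_simps)
qed

section \<open>Convergence rates from Lojasiewicz inequalities\<close>

text \<open>By concavity of t^(1-p), a decrease of \<open>r\<close> by
  \<open>c * (e k)\<^sup>2\<close> lowers its power by a multiple of
  \<open>(e k)\<^sup>2 * r k powr (- p)\<close>. The Lojasiewicz inequality trades the factor
  \<open>r k powr (- p)\<close> for one \<open>e k\<close>, leaving a bound linear in
  \<open>e k\<close> that telescopes.\<close>

lemma Lojasiewicz_descent_length:
  fixes r e :: "nat \<Rightarrow> real"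
  assumes p: "0 < p" "p < 1" and c: "c > 0" and C: "C > 0"
    and e: "e k \<ge> 0" and r: "r k \<ge> 0" "r (Suc k) \<ge> 0"
    and dec: "r (Suc k) \<le> r k - c * (e k)\<^sup>2" and loj: "r k powr p \<le> C * e k"
  shows "e k \<le> C / (c * (1 - p)) * (r k powr (1 - p) - r (Suc k) powr (1 - p))"
proof (cases "r k = 0")
  case True
  moreover have "0 \<le> c * (e k)\<^sup>2" using c by simp
  ultimately have "c * (e k)\<^sup>2 \<le> 0" "r (Suc k) = 0"
    using dec r(2) by linarith+
  then have "e k = 0" using c by (simp add: mult_le_0_iff)
  then show ?thesis using True \<open>r (Suc k) = 0\<close> by simp
next
  case False
  then have rk: "r k > 0" using r by simp
  have ce: "0 \<le> c * (e k)\<^sup>2" using c by simp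
  have "c * (e k)\<^sup>2 * ((1 - p) * r k powr (- p)) \<le> (r k - r (Suc k)) * ((1 - p) * r k powr (- p))"
    using dec p by (intro mult_right_mono) auto
  also have "\<dots> \<le> r k powr (1 - p) - r (Suc k) powr (1 - p)"
    using powr_diff_ge[of "1 - p" "r (Suc k)" "r k"] p r rk dec ce by (simp add: mult_ac)
  finally have 1: "c * (e k)\<^sup>2 * ((1 - p) * r k powr (- p)) \<le> r k powr (1 - p) - r (Suc k) powr (1 - p)" .
  have "r k powr p > 0" using rk by simp
  then have inv: "r k powr (- p) * (C * e k) \<ge> 1"
    using loj by (simp add: powr_minus field_simps)
  have "e k * (c * (1 - p)) * 1 \<le> e k * (c * (1 - p)) * (r k powr (- p) * (C * e k))"
    using e c p inv by (intro mult_left_mono) auto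
  also have "\<dots> = C * (c * (e k)\<^sup>2 * ((1 - p) * r k powr (- p)))"
    by (simp add: power2_eq_square mult_ac)
  also have "\<dots> \<le> C * (r k powr (1 - p) - r (Suc k) powr (1 - p))"
    using 1 C by (intro mult_left_mono) auto
  finally show ?thesis using c p by (simp add: field_simps)
qed

lemma Lojasiewicz_descent_error:
  fixes z :: "nat \<Rightarrow> 'a::real_normed_vector" and r e :: "nat \<Rightarrow> real"
  assumes p: "0 < p" "p < 1" and c: "c > 0" and C: "C > 0" and \<theta>: "\<theta> > 0"
    and e: "\<And>k. e k \<ge> 0" and r: "\<And>k. r k \<ge> 0"
    and dec: "\<And>k. r (Suc k) \<le> r k - c * (e k)\<^sup>2"
    and loj: "\<And>k. r k powr p \<le> C * e k"
    and step: "\<And>k. norm (z (Suc k) - z k) \<le> \<theta> * e k" and lim: "z \<longlonglongrightarrow> x"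
  shows "norm (z k - x) \<le> \<theta> * C / (c * (1 - p)) * r k powr (1 - p)"
proof -
  define A where "A = \<theta> * C / (c * (1 - p))"
  have A: "A > 0" using p c C \<theta> by (simp add: A_def)
  have A1: "norm (z (Suc k) - z k) \<le> A * (r k powr (1 - p) - r (Suc k) powr (1 - p))" for k
    using order_trans[OF step mult_left_mono[OF Lojasiewicz_descent_length[where e = e and r = r, OF p c C e r r dec loj]]] \<theta>
    by (simp add: A_def mult.assoc)
  have "norm (z (k + m) - z k) \<le> A * (r k powr (1 - p) - r (k + m) powr (1 - p))" for m
  proof (induction m)
    case (Suc m)
    have "norm (z (k + Suc m) - z k) \<le> norm (z (Suc (k + m)) - z (k + m)) + norm (z (k + m) - z k)"
      using norm_triangle_ineq[of "z (Suc (k + m)) - z (k + m)" "z (k + m) - z k"] by simp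
    also have "\<dots> \<le> A * (r k powr (1 - p) - r (k + Suc m) powr (1 - p))"
      using A1[of "k + m"] Suc by (simp add: algebra_simps)
    finally show ?case .
  qed simp
  then have "norm (z (m + k) - z k) \<le> A * r k powr (1 - p)" for m
    using A by (smt (verit, best) add.commute mult_left_mono powr_ge_zero)
  moreover have "(\<lambda>m. norm (z (m + k) - z k)) \<longlonglongrightarrow> norm (x - z k)"
    by (intro tendsto_intros LIMSEQ_ignore_initial_segment lim)
  ultimately have "norm (x - z k) \<le> A * r k powr (1 - p)"
    by (intro LIMSEQ_le_const2) auto
  then show ?thesis by (simp add: A_def norm_minus_commute)
qed

lemma Lojasiewicz_descent_linear:
  fixes r e :: "nat \<Rightarrow> real"
  assumes c: "c > 0" and C: "C > 0" and e: "\<And>k. e k \<ge> 0" and r: "\<And>k. r k \<ge> 0"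
    and dec: "\<And>k. r (Suc k) \<le> r k - c * (e k)\<^sup>2"
    and loj: "\<And>k. r k powr (1/2) \<le> C * e k"
  shows "\<exists>q. 0 < q \<and> q < 1 \<and> (\<forall>k. r k \<le> q ^ k * r 0)"
proof -
  \<comment> \<open>The decrease removes the fraction \<open>c / C\<^sup>2\<close> of
    \<open>r k\<close>; the maximum with 1/2 keeps \<open>q\<close> positive when this fraction is 1
    or more.\<close>
  define q where "q = max (1/2) (1 - c / C\<^sup>2)"
  have q: "0 < q" "q < 1" using c C by (auto simp: q_def)
  have "r (Suc k) \<le> q * r k" for k
  proof -
    have "(r k powr (1/2))\<^sup>2 \<le> (C * e k)\<^sup>2" using loj[of k] by (intro power_mono) auto
    then have "r k \<le> C\<^sup>2 * (e k)\<^sup>2" using r[of k] by (simp add: powr_half_sqrt power_mult_distrib)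
    then have "c / C\<^sup>2 * r k \<le> c * (e k)\<^sup>2" using c C by (simp add: field_simps)
    then have "r (Suc k) \<le> (1 - c / C\<^sup>2) * r k" using dec[of k] by (simp add: algebra_simps)
    also have "\<dots> \<le> q * r k" using r[of k] by (intro mult_right_mono) (auto simp: q_def)
    finally show ?thesis .
  qed
  then have step: "r (Suc k) \<le> q * r k" for k .
  have "r k \<le> q ^ k * r 0" for k
  proof (induction k)
    case (Suc k)
    from order_trans[OF step mult_left_mono[OF Suc, of q]] q show ?case by (simp add: mult.assoc)
  qed simp
  with q show ?thesis by blast
qed

text \<open>A discrete form of the differential inequality r' \<le> - const r^(2p): the quantity
  r^(1-2p) grows by at least a fixed amount per step.\<close>

lemma Lojasiewicz_descent_sublinear:
  fixes r e :: "nat \<Rightarrow> real"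
  assumes p: "1/2 < p" "p < 1" and c: "c > 0" and C: "C > 0" and e: "\<And>k. e k \<ge> 0" and r: "\<And>k. r k > 0"
    and dec: "\<And>k. r (Suc k) \<le> r k - c * (e k)\<^sup>2"
    and loj: "\<And>k. r k powr p \<le> C * e k"
  shows "real k * ((2 * p - 1) * (c / C\<^sup>2)) \<le> r k powr (- (2 * p - 1))"
proof (induction k)
  case (Suc k)
  define s where "s = 2 * p - 1"
  have s: "s > 0" using p by (simp add: s_def)
  have "(r k powr p)\<^sup>2 \<le> (C * e k)\<^sup>2" using loj[of k] by (intro power_mono) auto
  then have "r k powr (2 * p) \<le> C\<^sup>2 * (e k)\<^sup>2" using r[of k]
    by (simp add: power2_eq_square powr_add[symmetric] mult_ac)
  then have "c / C\<^sup>2 * r k powr (2 * p) \<le> c * (e k)\<^sup>2" using c C by (simp add: field_simps)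
  then have diff: "c / C\<^sup>2 * r k powr (2 * p) \<le> r k - r (Suc k)" using dec[of k] by simp
  have "0 \<le> c * (e k)\<^sup>2" using c by simp
  then have le: "r (Suc k) \<le> r k" using dec[of k] by linarith
  have "s * (c / C\<^sup>2) = s * r k powr (- s - 1) * (c / C\<^sup>2 * r k powr (2 * p))"
    using r[of k] by (simp add: s_def powr_add[symmetric])
  also have "\<dots> \<le> s * r k powr (- s - 1) * (r k - r (Suc k))"
    using diff s by (intro mult_left_mono) auto
  also have "\<dots> \<le> r (Suc k) powr (- s) - r k powr (- s)"
    by (rule powr_minus_diff_ge[OF s r le])
  finally have "s * (c / C\<^sup>2) \<le> r (Suc k) powr (- s) - r k powr (- s)" .
  moreover have "real (Suc k) * (s * (c / C\<^sup>2)) = real k * (s * (c / C\<^sup>2)) + s * (c / C\<^sup>2)"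
    by (simp only: of_nat_Suc distrib_right mult_1_left add.commute)
  ultimately show ?case using Suc unfolding s_def[symmetric] by linarith
qed simp

lemma Lojasiewicz_descent_rate:
  fixes z :: "nat \<Rightarrow> 'a::real_normed_vector" and r e :: "nat \<Rightarrow> real"
  assumes p: "1/2 \<le> p" "p < 1" and c: "c > 0" and C: "C > 0" and \<theta>: "\<theta> > 0"
    and e: "\<And>k. e k \<ge> 0" and r: "\<And>k. r k \<ge> 0"
    and dec: "\<And>k. k \<ge> K \<Longrightarrow> r (Suc k) \<le> r k - c * (e k)\<^sup>2"
    and loj: "\<And>k. k \<ge> K \<Longrightarrow> r k powr p \<le> C * e k"
    and step: "\<And>k. k \<ge> K \<Longrightarrow> norm (z (Suc k) - z k) \<le> \<theta> * e k" and lim: "z \<longlonglongrightarrow> x"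
  shows "1/2 < p \<Longrightarrow> (\<lambda>k. norm (z k - x)) \<in> O(\<lambda>k. real k powr (- ((1 - p) / (2 * p - 1))))"
    and "p = 1/2 \<Longrightarrow> \<exists>q. 0 < q \<and> q < 1 \<and> (\<lambda>k. norm (z k - x)) \<in> O(\<lambda>k. q ^ k)"
proof -
  define r' e' z' where "r' = (\<lambda>k. r (k + K))" and "e' = (\<lambda>k. e (k + K))" and "z' = (\<lambda>k. z (k + K))"
  have dec': "r' (Suc k) \<le> r' k - c * (e' k)\<^sup>2" for k using dec[of "k + K"] by (simp add: r'_def e'_def)
  have loj': "r' k powr p \<le> C * e' k" for k using loj[of "k + K"] by (simp add: r'_def e'_def)
  have e': "e' k \<ge> 0" and r': "r' k \<ge> 0" for k using e r by (auto simp: e'_def r'_def)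
  define A where "A = \<theta> * C / (c * (1 - p))"
  have A: "A > 0" using p c C \<theta> by (simp add: A_def)
  have err: "norm (z' k - x) \<le> A * r' k powr (1 - p)" for k
    unfolding A_def
  proof (rule Lojasiewicz_descent_error[where e = e'])
    show "norm (z' (Suc k) - z' k) \<le> \<theta> * e' k" for k using step[of "k + K"] by (simp add: z'_def e'_def)
    show "z' \<longlonglongrightarrow> x" unfolding z'_def by (rule LIMSEQ_ignore_initial_segment[OF lim])
  qed (use p c C \<theta> e' r' dec' loj' in auto)
  show "\<exists>q. 0 < q \<and> q < 1 \<and> (\<lambda>k. norm (z k - x)) \<in> O(\<lambda>k. q ^ k)" if ph: "p = 1/2"
  proof -
    obtain q where q: "0 < q" "q < 1" "\<And>k. r' k \<le> q ^ k * r' 0"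
      using Lojasiewicz_descent_linear[of c C e' r'] c C e' r' dec' loj'[unfolded ph] by blast
    \<comment> \<open>The error is of order r^(1/2), so its ratio is the square root of the ratio
      for the values.\<close>
    have "norm (norm (z k - x)) \<le> A * sqrt (r' 0) / sqrt q ^ K * norm (sqrt q ^ k)" if "k \<ge> K" for k
    proof -
      have "r' (k - K) powr (1 - p) \<le> sqrt (q ^ (k - K) * r' 0)"
        using real_sqrt_le_mono[OF q(3)[of "k - K"]] r'[of "k - K"] by (simp add: ph powr_half_sqrt)
      also have "\<dots> = sqrt q ^ (k - K) * sqrt (r' 0)" by (simp add: real_sqrt_mult real_sqrt_power)
      finally have "A * r' (k - K) powr (1 - p) \<le> A * (sqrt q ^ (k - K) * sqrt (r' 0))"
        using A by (intro mult_left_mono) auto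
      from order_trans[OF err this] have "norm (z k - x) \<le> A * (sqrt q ^ (k - K) * sqrt (r' 0))"
        using that by (simp add: z'_def)
      also have "sqrt q ^ (k - K) = sqrt q ^ k / sqrt q ^ K"
        using q(1) that by (simp add: power_diff)
      finally show ?thesis using q(1) by (simp add: mult_ac)
    qed
    then have "(\<lambda>k. norm (z k - x)) \<in> O(\<lambda>k. sqrt q ^ k)"
      by (intro bigoI[of _ "A * sqrt (r' 0) / sqrt q ^ K"] eventually_sequentiallyI[of K])
    then show ?thesis using q(1,2) by (intro exI[of _ "sqrt q"]) auto
  qed
  show "(\<lambda>k. norm (z k - x)) \<in> O(\<lambda>k. real k powr (- ((1 - p) / (2 * p - 1))))" if ph: "1/2 < p"
  \<comment> \<open>A vanishing gap defeats the argument by negative powers, but then the error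
    bound makes the sequence eventually constant.\<close>
  proof (cases "\<exists>k. r' k = 0")
    case True
    then obtain k0 where k0: "r' k0 = 0" by blast
    have zero: "r' k = 0" if "k \<ge> k0" for k
      using that
    proof (induction k rule: dec_induct)
      case (step k)
      have "0 \<le> c * (e' k)\<^sup>2" using c by simp
      then show ?case using step dec'[of k] r'[of "Suc k"] by linarith
    qed (rule k0)
    have "z k - x = 0" if "k \<ge> k0 + K" for k
      using err[of "k - K"] zero[of "k - K"] that by (simp add: z'_def)
    then show ?thesis
      by (intro bigoI[of _ 0] eventually_sequentiallyI[of "k0 + K"]) simp
  next
    case False
    then have rp: "r' k > 0" for k using r'[of k] by (metis less_le)
    define s D where "s = 2 * p - 1" and "D = (2 * p - 1) * (c / C\<^sup>2)"
    have s: "s > 0" and D: "D > 0" using ph c C by (auto simp: s_def D_def)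
    \<comment> \<open>From index \<open>2 * K + 1\<close> on, \<open>k - K\<close> is at least k/2,
      so the shift by \<open>K\<close> is absorbed into the constant; moreover \<open>k\<close> is
      positive.\<close>
    have "norm (norm (z k - x)) \<le> A * (D / 2) powr (- ((1 - p) / s)) * norm (real k powr (- ((1 - p) / s)))"
      if k: "k \<ge> 2 * K + 1" for k
    proof -
      have "real k / 2 * D \<le> real (k - K) * D" using k D by (intro mult_right_mono) auto
      also have "\<dots> \<le> r' (k - K) powr (- s)"
        unfolding s_def D_def using Lojasiewicz_descent_sublinear[of p c C e' r' "k - K"] ph p c C e' rp dec' loj' by blast
      finally have "real k / 2 * D \<le> r' (k - K) powr (- s)" .
      then have "(r' (k - K) powr (- s)) powr (- ((1 - p) / s)) \<le> (real k / 2 * D) powr (- ((1 - p) / s))"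
        using p s D k by (intro powr_mono2') auto
      then have "r' (k - K) powr (1 - p) \<le> (D / 2 * real k) powr (- ((1 - p) / s))"
        using s by (simp add: powr_powr mult_ac)
      also have "\<dots> = (D / 2) powr (- ((1 - p) / s)) * real k powr (- ((1 - p) / s))"
        by (rule powr_mult)
      finally have "A * r' (k - K) powr (1 - p) \<le> A * ((D / 2) powr (- ((1 - p) / s)) * real k powr (- ((1 - p) / s)))"
        using A by (intro mult_left_mono) auto
      then show ?thesis using err[of "k - K"] k by (simp add: z'_def mult.assoc)
    qed
    then show ?thesis unfolding s_def[symmetric]
      by (intro bigoI[of _ "A * (D / 2) powr (- ((1 - p) / s))"] eventually_sequentiallyI[of "2 * K + 1"])
  qed
qed

section \<open>The Hadamard parametrisation\<close>

definition square_diff :: "(real ^ 'n) \<times> (real ^ 'n) \<Rightarrow> real ^ 'n" where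
  "square_diff z = vsq (fst z) - vsq (snd z)"

lemma square_diff_nth: "square_diff z $ i = (fst z $ i)\<^sup>2 - (snd z $ i)\<^sup>2"
  by (simp add: square_diff_def vsq_def)

lemma has_derivative_vecI:
  fixes f :: "'a::real_normed_vector \<Rightarrow> real ^ 'n"
  assumes "\<And>i. ((\<lambda>x. f x $ i) has_derivative (\<lambda>w. f' w $ i)) (at x)"
  shows "(f has_derivative f') (at x)"
  using assms by (subst has_derivative_componentwise_within) (auto simp: Basis_vec_def cart_eq_inner_axis)

definition square_diff_deriv :: "(real ^ 'n) \<times> (real ^ 'n) \<Rightarrow> (real ^ 'n) \<times> (real ^ 'n) \<Rightarrow> real ^ 'n" where
  "square_diff_deriv z w = (\<chi> i. 2 * (fst z $ i) * (fst w $ i) - 2 * (snd z $ i) * (snd w $ i))"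

lemma has_derivative_fst_nth: "((\<lambda>z. fst z $ i) has_derivative (\<lambda>w. fst w $ i)) F"
  by (intro bounded_linear_imp_has_derivative bounded_linear_compose[OF bounded_linear_vec_nth bounded_linear_fst])

lemma has_derivative_snd_nth: "((\<lambda>z. snd z $ i) has_derivative (\<lambda>w. snd w $ i)) F"
  by (intro bounded_linear_imp_has_derivative bounded_linear_compose[OF bounded_linear_vec_nth bounded_linear_snd])

lemma has_derivative_square_diff: "(square_diff has_derivative square_diff_deriv z) (at z)"
proof (rule has_derivative_vecI)
  fix i
  show "((\<lambda>z. square_diff z $ i) has_derivative (\<lambda>w. square_diff_deriv z w $ i)) (at z)"
    unfolding square_diff_nth square_diff_deriv_def power2_eq_square
    by (auto intro!: derivative_eq_intros has_derivative_fst_nth has_derivative_snd_nth)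
qed

lemma continuous_square_diff: "continuous_on S square_diff"
  unfolding square_diff_def vsq_def by (intro continuous_intros)

locale hadamard = h: C2_pair h u U
  for h :: "real ^ 'n \<Rightarrow> real" and u U +
  fixes \<mu> :: real and f :: "real ^ 'n \<Rightarrow> real" and F :: "(real ^ 'n) \<times> (real ^ 'n) \<Rightarrow> real"
  assumes mu: "\<mu> > 0"
    and f: "\<And>x. f x = h x + \<mu> * l1_norm x"
    and F: "\<And>a b. F (a, b) = h (vsq a - vsq b) + \<mu> * (\<Sum>i\<in>UNIV. (a $ i)\<^sup>2 + (b $ i)\<^sup>2)"
begin

lemma F_eq: "F z = h (square_diff z) + \<mu> * (\<Sum>i\<in>UNIV. (fst z $ i)\<^sup>2 + (snd z $ i)\<^sup>2)"
  using F[of "fst z" "snd z"] by (simp add: square_diff_def)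

definition gradF :: "(real ^ 'n) \<times> (real ^ 'n) \<Rightarrow> (real ^ 'n) \<times> (real ^ 'n)" where
  "gradF z = ((\<chi> i. 2 * (fst z $ i) * (u (square_diff z) $ i + \<mu>)),
              (\<chi> i. 2 * (snd z $ i) * (\<mu> - u (square_diff z) $ i)))"

definition hessF :: "(real ^ 'n) \<times> (real ^ 'n) \<Rightarrow> (real ^ 'n) \<times> (real ^ 'n) \<Rightarrow> (real ^ 'n) \<times> (real ^ 'n)" where
  "hessF z w =
    ((\<chi> i. 2 * (fst z $ i) * (U (square_diff z) (square_diff_deriv z w) $ i)
            + 2 * (fst w $ i) * (u (square_diff z) $ i + \<mu>)),
     (\<chi> i. - 2 * (snd z $ i) * (U (square_diff z) (square_diff_deriv z w) $ i)
            + 2 * (snd w $ i) * (\<mu> - u (square_diff z) $ i)))"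

lemma has_derivative_u_square_diff:
  "((\<lambda>z. u (square_diff z) $ i) has_derivative (\<lambda>w. U (square_diff z) (square_diff_deriv z w) $ i)) (at z)"
  by (intro bounded_linear.has_derivative[OF bounded_linear_vec_nth]
      has_derivative_compose[OF has_derivative_square_diff h.der2])

lemma gradF_has_derivative: "(gradF has_derivative hessF z) (at z)"
  unfolding gradF_def[abs_def] hessF_def[abs_def]
proof (intro has_derivative_Pair has_derivative_vecI)
  fix i
  show "((\<lambda>z. (\<chi> i. 2 * (fst z $ i) * (u (square_diff z) $ i + \<mu>)) $ i) has_derivative
      (\<lambda>w. (\<chi> i. 2 * (fst z $ i) * (U (square_diff z) (square_diff_deriv z w) $ i)
            + 2 * (fst w $ i) * (u (square_diff z) $ i + \<mu>)) $ i)) (at z)"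
    by (auto intro!: derivative_eq_intros has_derivative_fst_nth has_derivative_u_square_diff simp: mult_ac)
  show "((\<lambda>z. (\<chi> i. 2 * (snd z $ i) * (\<mu> - u (square_diff z) $ i)) $ i) has_derivative
      (\<lambda>w. (\<chi> i. - 2 * (snd z $ i) * (U (square_diff z) (square_diff_deriv z w) $ i)
            + 2 * (snd w $ i) * (\<mu> - u (square_diff z) $ i)) $ i)) (at z)"
    by (auto intro!: derivative_eq_intros has_derivative_snd_nth has_derivative_u_square_diff simp: algebra_simps)
qed

lemma GDERIV_F: "GDERIV F z :> gradF z"
proof -
  have "F = (\<lambda>z. h (square_diff z) + \<mu> * (\<Sum>i\<in>UNIV. (fst z $ i)\<^sup>2 + (snd z $ i)\<^sup>2))"
    using F_eq by blast
  moreover have "((\<lambda>z. h (square_diff z) + \<mu> * (\<Sum>i\<in>UNIV. (fst z $ i)\<^sup>2 + (snd z $ i)\<^sup>2)) has_derivative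
      (\<lambda>w. square_diff_deriv z w \<bullet> u (square_diff z)
        + \<mu> * (\<Sum>i\<in>UNIV. 2 * (fst z $ i) * (fst w $ i) + 2 * (snd z $ i) * (snd w $ i)))) (at z)"
    unfolding power2_eq_square
    by (intro has_derivative_add has_derivative_compose[OF has_derivative_square_diff h.der[unfolded gderiv_def]]
        has_derivative_mult_right has_derivative_sum)
      (auto intro!: derivative_eq_intros has_derivative_fst_nth has_derivative_snd_nth)
  moreover have "square_diff_deriv z w \<bullet> u (square_diff z)
        + \<mu> * (\<Sum>i\<in>UNIV. 2 * (fst z $ i) * (fst w $ i) + 2 * (snd z $ i) * (snd w $ i)) = w \<bullet> gradF z" for w
    by (simp add: inner_prod_def inner_vec_def gradF_def square_diff_deriv_def sum_distrib_left
        sum.distrib[symmetric] algebra_simps)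
  ultimately show ?thesis unfolding gderiv_def by simp
qed

lemma hessF_continuous: "continuous_on UNIV (\<lambda>z. hessF z w)"
proof -
  have "continuous_on UNIV (\<lambda>z. u (square_diff z))" "continuous_on UNIV (\<lambda>z. U (square_diff z))"
    using continuous_on_compose2[OF h.cont_g[of UNIV] continuous_square_diff]
      continuous_on_compose2[OF h.cont2 continuous_square_diff] by auto
  then show ?thesis
    unfolding hessF_def square_diff_deriv_def by (intro continuous_intros)
qed

sublocale F: C2_pair F gradF "\<lambda>z. Blinfun (hessF z)"
proof
  fix z
  have bl: "bounded_linear (hessF z)" for z using gradF_has_derivative by (rule has_derivative_bounded_linear)
  show "GDERIV F z :> gradF z" by (rule GDERIV_F)
  show "(gradF has_derivative blinfun_apply (Blinfun (hessF z))) (at z)"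
    using gradF_has_derivative by (simp add: bounded_linear_Blinfun_apply[OF bl])
  show "continuous_on UNIV (\<lambda>z. Blinfun (hessF z))"
    \<comment> \<open>In finite dimensions, continuity of \<open>hessF z w\<close> in
      \<open>z\<close> for each fixed \<open>w\<close> gives continuity in the operator
      norm.\<close>
    by (rule continuous_on_blinfun_componentwise)
      (simp add: bounded_linear_Blinfun_apply[OF bl] hessF_continuous)
qed

lemma hess_F: "hess F z = hessF z"
  using F.hess_eq bounded_linear_Blinfun_apply[OF has_derivative_bounded_linear[OF gradF_has_derivative]] by simp

end

section \<open>From the Jacobian determinant to injectivity of the derivative\<close>

lemma split_join_vec: "split_vec (join_vec z) = z"
  by (simp add: split_vec_def join_vec_def)

lemma linear_join_vec: "linear join_vec"
  by (intro linearI) (auto simp: join_vec_def vec_eq_iff split: sum.split)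

lemma linear_split_vec: "linear split_vec"
  by (intro linearI) (auto simp: split_vec_def vec_eq_iff)

text \<open>The determinant is that of \<open>D\<close> conjugated by the coordinate maps, so its
  being nonzero makes the conjugate injective. Applied to joined vectors this gives injectivity of
  \<open>D\<close>, since splitting undoes joining.\<close>

lemma jacobian_det_nonzero_imp_inj:
  assumes "(G has_derivative D) (at z)" and det: "jacobian_det G z \<noteq> 0"
  shows "inj D"
proof -
  have "((\<lambda>v. join_vec (G (split_vec v))) has_derivative (\<lambda>v. join_vec (D (split_vec v)))) (at (join_vec z))"
  proof (rule bounded_linear.has_derivative[OF linear_conv_bounded_linear[THEN iffD1, OF linear_join_vec]])
    have "(split_vec has_derivative split_vec) (at (join_vec z))"
      by (intro bounded_linear_imp_has_derivative linear_conv_bounded_linear[THEN iffD1] linear_split_vec)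
    moreover have "(G has_derivative D) (at (split_vec (join_vec z)))"
      using assms(1) by (simp add: split_join_vec)
    ultimately show "((\<lambda>v. G (split_vec v)) has_derivative (\<lambda>v. D (split_vec v))) (at (join_vec z))"
      by (rule has_derivative_compose)
  qed
  note der = this
  have "jacobian_det G z = det (matrix (\<lambda>v. join_vec (D (split_vec v))))"
    unfolding jacobian_det_def jacobian_def using frechet_derivative_at[OF der] by simp
  then have "inj (\<lambda>v. join_vec (D (split_vec v)))"
    using det det_nz_iff_inj[OF has_derivative_linear[OF der]] by simp
  then show "inj D"
    unfolding inj_def by (metis split_join_vec)
qed

section \<open>The subdifferential of the l1-norm and its relative interior\<close>

lemma convex_subdiff_l1_norm:
  fixes s :: "real ^ 'n"
  shows "convex_subdiff l1_norm s = {w. \<forall>i. \<bar>w $ i\<bar> \<le> 1 \<and> w $ i * s $ i = \<bar>s $ i\<bar>}"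
proof (intro set_eqI iffI)
  fix w assume "w \<in> convex_subdiff l1_norm s"
  then have sub: "l1_norm y \<ge> l1_norm s + w \<bullet> (y - s)" for y by (simp add: convex_subdiff_def)
  \<comment> \<open>Perturbing a single coordinate decouples the subgradient inequality. The
    increments 1 and -1 bound \<open>w $ i\<close>, and the increment \<open>- (s $ i)\<close> gives
    the equality.\<close>
  have key: "\<bar>s $ i + t\<bar> \<ge> \<bar>s $ i\<bar> + w $ i * t" for i t
  proof -
    have "l1_norm (s + t *\<^sub>R axis i 1) = (\<Sum>j\<in>UNIV. \<bar>s $ j\<bar> + (if j = i then \<bar>s $ i + t\<bar> - \<bar>s $ i\<bar> else 0))"
      unfolding l1_norm_def by (rule sum.cong) (auto simp: axis_def)
    also have "\<dots> = l1_norm s + (\<bar>s $ i + t\<bar> - \<bar>s $ i\<bar>)"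
      by (simp add: sum.distrib l1_norm_def)
    finally show ?thesis
      using sub[of "s + t *\<^sub>R axis i 1"] by (simp add: inner_axis mult.commute)
  qed
  have "\<bar>w $ i\<bar> \<le> 1" for i using key[of i 1] key[of i "-1"] by linarith
  moreover have "w $ i * s $ i = \<bar>s $ i\<bar>" for i
  proof (rule antisym)
    have "\<bar>w $ i * s $ i\<bar> \<le> 1 * \<bar>s $ i\<bar>"
      unfolding abs_mult using calculation[of i] by (intro mult_right_mono) auto
    then show "w $ i * s $ i \<le> \<bar>s $ i\<bar>" by simp
    show "\<bar>s $ i\<bar> \<le> w $ i * s $ i" using key[of i "- (s $ i)"] by simp
  qed
  ultimately show "w \<in> {w. \<forall>i. \<bar>w $ i\<bar> \<le> 1 \<and> w $ i * s $ i = \<bar>s $ i\<bar>}" by blast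
next
  fix w assume w: "w \<in> {w. \<forall>i. \<bar>w $ i\<bar> \<le> 1 \<and> w $ i * s $ i = \<bar>s $ i\<bar>}"
  have "l1_norm s + w \<bullet> (y - s) \<le> l1_norm y" for y
  proof -
    have "\<bar>s $ i\<bar> + w $ i * (y $ i - s $ i) \<le> \<bar>y $ i\<bar>" for i
    proof -
      have "w $ i * y $ i \<le> \<bar>w $ i\<bar> * \<bar>y $ i\<bar>" by (metis abs_ge_self abs_mult)
      also have "\<dots> \<le> 1 * \<bar>y $ i\<bar>" using w by (intro mult_right_mono) auto
      finally show ?thesis using w by (simp add: algebra_simps)
    qed
    then show ?thesis
      unfolding l1_norm_def inner_vec_def by (simp add: sum.distrib[symmetric] sum_mono)
  qed
  then show "w \<in> convex_subdiff l1_norm s" by (simp add: convex_subdiff_def)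
qed

text \<open>If coordinate \<open>i\<close> were extreme, flipping its sign would give another point
  of the set, as \<open>s $ i = 0\<close>. From a relative interior point the segment can be
  extended beyond \<open>v\<close>, but coordinate \<open>i\<close> would then exceed \<mu>.\<close>

lemma rel_interior_subdiff_l1_norm:
  fixes s v :: "real ^ 'n"
  assumes mu: "\<mu> > 0" and v: "v \<in> rel_interior ((*\<^sub>R) \<mu> ` convex_subdiff l1_norm s)" and s: "s $ i = 0"
  shows "\<bar>v $ i\<bar> < \<mu>"
proof -
  define D where "D = (*\<^sub>R) \<mu> ` convex_subdiff l1_norm s"
  have D: "D = {w. \<forall>i. \<bar>w $ i\<bar> \<le> \<mu> \<and> w $ i * s $ i = \<mu> * \<bar>s $ i\<bar>}"
  proof (intro set_eqI iffI)
    fix w assume "w \<in> D"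
    then show "w \<in> {w. \<forall>i. \<bar>w $ i\<bar> \<le> \<mu> \<and> w $ i * s $ i = \<mu> * \<bar>s $ i\<bar>}"
      using mu by (auto simp: D_def convex_subdiff_l1_norm abs_mult mult_left_le)
  next
    fix w assume w: "w \<in> {w. \<forall>i. \<bar>w $ i\<bar> \<le> \<mu> \<and> w $ i * s $ i = \<mu> * \<bar>s $ i\<bar>}"
    then have "w /\<^sub>R \<mu> \<in> convex_subdiff l1_norm s"
      using mu by (auto simp: convex_subdiff_l1_norm abs_mult field_simps)
    moreover have "w = \<mu> *\<^sub>R (w /\<^sub>R \<mu>)" using mu by simp
    ultimately show "w \<in> D" unfolding D_def by blast
  qed
  have conv: "convex D"
  proof (rule convexI)
    fix x y a b assume xy: "x \<in> D" "y \<in> D" and ab: "0 \<le> (a::real)" "0 \<le> b" "a + b = 1"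
    have "\<bar>(a *\<^sub>R x + b *\<^sub>R y) $ j\<bar> \<le> \<mu>" for j
    proof -
      have "\<bar>a * x $ j + b * y $ j\<bar> \<le> a * \<bar>x $ j\<bar> + b * \<bar>y $ j\<bar>"
        using abs_triangle_ineq[of "a * x $ j" "b * y $ j"] ab by (simp add: abs_mult)
      also have "\<dots> \<le> a * \<mu> + b * \<mu>" using xy ab unfolding D by (intro add_mono mult_left_mono) auto
      finally show ?thesis using ab by (simp add: distrib_right[symmetric])
    qed
    moreover have "(a *\<^sub>R x + b *\<^sub>R y) $ j * s $ j = \<mu> * \<bar>s $ j\<bar>" for j
    proof -
      have "(a *\<^sub>R x + b *\<^sub>R y) $ j * s $ j = a * (x $ j * s $ j) + b * (y $ j * s $ j)"
        by (simp add: algebra_simps)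
      also have "\<dots> = (a + b) * (\<mu> * \<bar>s $ j\<bar>)" using xy unfolding D by (simp add: algebra_simps)
      finally show ?thesis using ab by simp
    qed
    ultimately show "a *\<^sub>R x + b *\<^sub>R y \<in> D" unfolding D by blast
  qed
  have vD: "v \<in> D" using v rel_interior_subset unfolding D_def by blast
  show ?thesis
  proof (rule ccontr)
    assume "\<not> \<bar>v $ i\<bar> < \<mu>"
    then have vi: "\<bar>v $ i\<bar> = \<mu>" using vD unfolding D by (simp add: order_antisym)
    define x where "x = (\<chi> j. if j = i then - (v $ i) else v $ j)"
    have "x \<in> D" using vD s unfolding D by (auto simp: x_def)
    moreover have "D \<noteq> {}" using vD by blast
    ultimately obtain e where e: "e > 1" "(1 - e) *\<^sub>R x + e *\<^sub>R v \<in> D"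
      using convex_rel_interior_iff[OF conv, of v] v unfolding D_def[symmetric] by blast
    have eq: "((1 - e) *\<^sub>R x + e *\<^sub>R v) $ i = (2 * e - 1) * v $ i" by (simp add: x_def algebra_simps)
    have "\<bar>((1 - e) *\<^sub>R x + e *\<^sub>R v) $ i\<bar> \<le> \<mu>" using e(2) unfolding D by blast
    then have "(2 * e - 1) * \<mu> \<le> \<mu>" unfolding eq abs_mult vi using e(1) by simp
    then show False using e(1) mu by (simp add: algebra_simps)
  qed
qed

section \<open>Convergence to second-order stationary points for almost every start\<close>

context hadamard
begin

lemma gd_step_inj:
  assumes "jacobian_det (gd_map F \<theta>) z \<noteq> 0"
  shows "inj (\<lambda>w. w - \<theta> *\<^sub>R hessF z w)"
proof (rule jacobian_det_nonzero_imp_inj[OF _ assms])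
  have "((\<lambda>z. z - \<theta> *\<^sub>R gradF z) has_derivative (\<lambda>w. w - \<theta> *\<^sub>R hessF z w)) (at z)"
    by (intro has_derivative_diff has_derivative_ident has_derivative_scaleR_right gradF_has_derivative)
  then show "(gd_map F \<theta> has_derivative (\<lambda>w. w - \<theta> *\<^sub>R hessF z w)) (at z)"
    by (simp add: gd_map_def[abs_def] F.grad_eq)
qed

lemma Blinfun_hessF: "blinfun_apply (Blinfun (hessF z)) = hessF z"
  using F.hess_eq hess_F by metis

text \<open>Every start gives convergence to a stationary point; only the curvature condition
  excludes a null set. The eventually constant stepsize is part of the conclusion because the rates
  are derived from it.\<close>

theorem gd_converges_almost_everywhere:
  assumes theta0: "\<theta>\<^sub>0 > 0" and kappa: "0 < \<kappa>" "\<kappa> < 1"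
    and A1: "\<And>m. \<exists>V. open V \<and> - V \<in> null_sets lebesgue \<and>
               (\<forall>z\<in>V. jacobian_det (gd_map F (\<kappa> ^ m * \<theta>\<^sub>0)) z \<noteq> 0)"
    and A2: "level_bounded F"
    and A3: "\<And>z. stationary F z \<Longrightarrow> KL_property F z"
  shows "\<exists>V. - V \<in> null_sets lebesgue \<and> (\<forall>z\<^sub>0\<in>V. \<exists>x m K. gd_iterate F \<theta>\<^sub>0 \<kappa> z\<^sub>0 \<longlonglongrightarrow> x \<and>
    second_order_stationary F x \<and> (\<forall>k\<ge>K. gd_iterate F \<theta>\<^sub>0 \<kappa> z\<^sub>0 (Suc k) = gd_map F (\<kappa> ^ m * \<theta>\<^sub>0) (gd_iterate F \<theta>\<^sub>0 \<kappa> z\<^sub>0 k) \<and>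
      accepted F (gd_iterate F \<theta>\<^sub>0 \<kappa> z\<^sub>0 k) (\<kappa> ^ m * \<theta>\<^sub>0)))"
proof -
  define B where "B = {z\<^sub>0. \<exists>x v. gd_iterate F \<theta>\<^sub>0 \<kappa> z\<^sub>0 \<longlonglongrightarrow> x \<and> v \<bullet> hessF x v < 0}"
  have "\<exists>V. open V \<and> negligible (- V) \<and>
      (\<forall>x\<in>V. inj (\<lambda>w. w - (\<kappa> ^ m * \<theta>\<^sub>0) *\<^sub>R blinfun_apply (Blinfun (hessF x)) w))" for m
  proof -
    obtain V where "open V" "- V \<in> null_sets lebesgue"
      "\<forall>z\<in>V. jacobian_det (gd_map F (\<kappa> ^ m * \<theta>\<^sub>0)) z \<noteq> 0" using A1[of m] by blast
    then show ?thesis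
      by (intro exI[of _ V]) (simp add: Blinfun_hessF gd_step_inj negligible_iff_null_sets)
  qed
  from F.negligible_gd_to_saddle[OF A2 theta0 kappa this] have "negligible B"
    by (simp add: B_def Blinfun_hessF)
  then have "- (- B) \<in> null_sets lebesgue" by (simp add: negligible_iff_null_sets)
  moreover have "\<exists>x m K. gd_iterate F \<theta>\<^sub>0 \<kappa> z\<^sub>0 \<longlonglongrightarrow> x \<and>
    second_order_stationary F x \<and> (\<forall>k\<ge>K. gd_iterate F \<theta>\<^sub>0 \<kappa> z\<^sub>0 (Suc k) = gd_map F (\<kappa> ^ m * \<theta>\<^sub>0) (gd_iterate F \<theta>\<^sub>0 \<kappa> z\<^sub>0 k) \<and>
      accepted F (gd_iterate F \<theta>\<^sub>0 \<kappa> z\<^sub>0 k) (\<kappa> ^ m * \<theta>\<^sub>0))" if "z\<^sub>0 \<in> - B" for z\<^sub>0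
  proof -
    define z where "z = gd_iterate F \<theta>\<^sub>0 \<kappa> z\<^sub>0"
    note gd = F.gd_iterate_eventually_constant_step[OF A2 theta0 kappa, of z\<^sub>0, folded z_def]
    obtain m K where mK: "\<And>k. k \<ge> K \<Longrightarrow> z (Suc k) = gd_map F (\<kappa> ^ m * \<theta>\<^sub>0) (z k) \<and> accepted F (z k) (\<kappa> ^ m * \<theta>\<^sub>0)"
      using gd(3) by blast
    define \<theta> where "\<theta> = \<kappa> ^ m * \<theta>\<^sub>0"
    have \<theta>: "\<theta> > 0" using kappa theta0 by (simp add: \<theta>_def)
    have "\<exists>x. (\<lambda>k. z (k + K)) \<longlonglongrightarrow> x \<and> gradF x = 0"
    proof (rule F.KL_descent_converges[OF _ \<theta>])
      show "z (Suc k + K) = z (k + K) - \<theta> *\<^sub>R gradF (z (k + K))" for k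
        using mK[of "k + K"] by (simp add: gd_map_def \<theta>_def F.grad_eq)
      show "F (z (Suc k + K)) \<le> F (z (k + K)) - \<theta>\<^sup>2 / 2 * (norm (gradF (z (k + K))))\<^sup>2" for k
        using mK[of "k + K"] by (simp add: accepted_def \<theta>_def F.grad_eq)
      show "bounded (range (\<lambda>k. z (k + K)))" using gd(1) by (rule bounded_subset) auto
      show "KL_property F x" if "gradF x = 0" for x using A3 that by (simp add: stationary_def F.grad_eq)
    qed (use \<theta> in simp)
    then obtain x where x: "z \<longlonglongrightarrow> x" "gradF x = 0" using LIMSEQ_offset by blast
    have "0 \<le> v \<bullet> hessF x v" for v
    proof (rule ccontr)
      assume "\<not> 0 \<le> v \<bullet> hessF x v"
      then have "z\<^sub>0 \<in> B" unfolding B_def using x(1) by (auto simp: z_def not_le simp del: split_paired_Ex)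
      with that show False by simp
    qed
    then have "second_order_stationary F x"
      using x(2) by (simp add: second_order_stationary_def F.grad_eq hess_F del: split_paired_All)
    then show ?thesis using x(1) mK unfolding z_def by blast
  qed
  ultimately show ?thesis by blast
qed

end

section \<open>Estimates near a second-order stationary point\<close>

lemma (in C2_pair) Lipschitz_F_cball:
  "\<exists>L\<ge>0. \<forall>x\<in>cball 0 R. \<forall>y\<in>cball 0 R. \<bar>F x - F y\<bar> \<le> L * norm (x - y)"
proof -
  have "compact (g ` cball 0 R)" by (intro compact_continuous_image cont_g) auto
  then obtain L where L: "L > 0" "\<And>x. x \<in> cball 0 R \<Longrightarrow> norm (g x) \<le> L"
    using compact_imp_bounded bounded_pos by (metis imageI)
  have "\<bar>F x - F y\<bar> \<le> L * norm (x - y)" if xy: "x \<in> cball 0 R" "y \<in> cball 0 R" for x y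
  proof -
    obtain t where t: "t \<in> {0..1}" "F (y + (x - y)) - F y = g (y + t *\<^sub>R (x - y)) \<bullet> (x - y)"
      using MVT_grad by blast
    have "y + t *\<^sub>R (x - y) = (1 - t) *\<^sub>R y + t *\<^sub>R x" by (simp add: algebra_simps)
    also have "\<dots> \<in> cball 0 R"
      by (rule convexD_alt[OF convex_cball xy(2,1)]) (use t(1) in auto)
    finally have "norm (g (y + t *\<^sub>R (x - y))) \<le> L" by (rule L(2))
    from mult_right_mono[OF this norm_ge_zero[of "x - y"]] have "\<bar>g (y + t *\<^sub>R (x - y)) \<bullet> (x - y)\<bar> \<le> L * norm (x - y)"
      using Cauchy_Schwarz_ineq2[of "g (y + t *\<^sub>R (x - y))" "x - y"]
      by linarith
    then show ?thesis using t(2) by simp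
  qed
  then show ?thesis using L(1) by (intro exI[of _ L]) auto
qed

lemma eventually_less_nhds:
  fixes g :: "'a::topological_space \<Rightarrow> real"
  assumes "continuous_on UNIV g" "g x < c"
  shows "\<forall>\<^sub>F z in nhds x. g z < c"
proof -
  have "open {z. g z < c}" by (intro open_Collect_less assms(1) continuous_on_const)
  then show ?thesis using assms(2) unfolding eventually_nhds by blast
qed

lemma l1_norm_diff_le: "\<bar>l1_norm x - l1_norm y\<bar> \<le> (\<Sum>i\<in>UNIV. \<bar>x $ i - y $ i\<bar>)"
  unfolding l1_norm_def sum_subtractf[symmetric]
  by (rule order_trans[OF sum_abs sum_mono]) (rule abs_triangle_ineq3)

locale hadamard_sosp = hadamard h u U \<mu> f F
  for h :: "real ^ 'n \<Rightarrow> real" and u U \<mu> f F +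
  fixes zs :: "(real ^ 'n) \<times> (real ^ 'n)"
  assumes sosp: "second_order_stationary F zs"
begin

definition s where "s = square_diff zs"

text \<open>Stationarity forces a_i = 0 or u_i = -\<mu>, and b_i = 0 or u_i = \<mu>. If both
  components vanish, this says nothing about u_i; but then \<open>square_diff\<close> has zero
  derivative in the two axis directions, and the Hessian there reduces to 2 (\<mu> + u_i) and 2
  (\<mu> - u_i).\<close>

lemma sosp_coordinates:
  "\<bar>u s $ i\<bar> \<le> \<mu>" "u s $ i \<noteq> - \<mu> \<Longrightarrow> fst zs $ i = 0" "u s $ i \<noteq> \<mu> \<Longrightarrow> snd zs $ i = 0"
proof -
  have "gradF zs = 0" and H: "0 \<le> v \<bullet> hessF zs v" for v
    using sosp by (simp_all add: second_order_stationary_def F.grad_eq hess_F del: split_paired_All)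
  then have "fst (gradF zs) $ i = 0" "snd (gradF zs) $ i = 0" by simp_all
  then have st: "fst zs $ i = 0 \<or> u s $ i = - \<mu>" "snd zs $ i = 0 \<or> u s $ i = \<mu>"
    by (auto simp: gradF_def s_def)
  then show 1: "u s $ i \<noteq> - \<mu> \<Longrightarrow> fst zs $ i = 0" and 2: "u s $ i \<noteq> \<mu> \<Longrightarrow> snd zs $ i = 0" by auto
  show "\<bar>u s $ i\<bar> \<le> \<mu>"
  proof (cases "fst zs $ i = 0 \<and> snd zs $ i = 0")
    case True
    have "square_diff_deriv zs (axis i 1, 0) = 0" "square_diff_deriv zs (0, axis i 1) = 0"
      using True by (auto simp: square_diff_deriv_def vec_eq_iff axis_def)
    moreover have "U s 0 = 0" by (rule blinfun.zero_right)
    ultimately have "0 \<le> 2 * (u s $ i + \<mu>)" "0 \<le> 2 * (\<mu> - u s $ i)"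
      using H[of "(axis i 1, 0)"] H[of "(0, axis i 1)"]
      by (simp_all add: hessF_def inner_axis' s_def)
    then show ?thesis by simp
  next
    case False
    then show ?thesis using st mu by auto
  qed
qed

text \<open>Setting the vanishing part of each pair \<open>(a\<^sub>i, b\<^sub>i)\<close> to zero moves \<open>s\<close> by at most a multiple of the
  squared gradient norm, and at the moved point \<open>f\<close> has an explicit small subgradient.\<close>

definition reduced :: "(real ^ 'n) \<times> (real ^ 'n) \<Rightarrow> real ^ 'n" where
  "reduced z = (\<chi> i. if u s $ i = - \<mu> then (fst z $ i)\<^sup>2 else if u s $ i = \<mu> then - (snd z $ i)\<^sup>2 else 0)"

definition subgr :: "(real ^ 'n) \<times> (real ^ 'n) \<Rightarrow> real ^ 'n" where
  "subgr z = (\<chi> i. if u s $ i = - \<mu> then u (reduced z) $ i + \<mu>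
                   else if u s $ i = \<mu> then u (reduced z) $ i - \<mu> else 0)"

lemma reduced_zs: "reduced zs = s"
  using sosp_coordinates mu by (auto simp: vec_eq_iff reduced_def s_def square_diff_nth)

lemma continuous_reduced: "continuous_on S reduced"
  unfolding reduced_def
proof (intro continuous_on_vec_lambda)
  fix i
  show "continuous_on S (\<lambda>z. if u s $ i = - \<mu> then (fst z $ i)\<^sup>2 else if u s $ i = \<mu> then - (snd z $ i)\<^sup>2 else 0)"
    by (cases "u s $ i = - \<mu>"; cases "u s $ i = \<mu>"; simp; intro continuous_intros)
qed

text \<open>The identity a^2 + b^2 = |a^2 - b^2| + 2 min(a^2, b^2) exhibits \<open>F\<close> as
  \<open>f\<close> after \<open>square_diff\<close> plus a penalty for pairs with two nonzero
  members.\<close>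

lemma F_eq_f: "F z = f (square_diff z) + 2 * \<mu> * (\<Sum>i\<in>UNIV. min ((fst z $ i)\<^sup>2) ((snd z $ i)\<^sup>2))"
proof -
  have "(fst z $ i)\<^sup>2 + (snd z $ i)\<^sup>2 = \<bar>square_diff z $ i\<bar> + 2 * min ((fst z $ i)\<^sup>2) ((snd z $ i)\<^sup>2)" for i
    by (simp add: square_diff_nth min_def abs_if)
  then show ?thesis
    by (simp add: F_eq f l1_norm_def sum.distrib sum_distrib_left[symmetric] distrib_left)
qed

lemma F_zs: "F zs = f s"
proof -
  have "min ((fst zs $ i)\<^sup>2) ((snd zs $ i)\<^sup>2) = 0" for i
    using sosp_coordinates(2,3)[of i] mu by (cases "u s $ i = \<mu>") (auto simp: min_def)
  then show ?thesis by (simp add: F_eq_f s_def)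
qed

text \<open>Where \<open>u s $ i\<close> differs from -\<mu>, the factor of a_i in
  \<open>gradF\<close> is bounded away from 0 near \<open>zs\<close>, so a_i is O(|gradF|); likewise
  b_i where it differs from \<mu>. These are the components that \<open>reduced\<close> deletes. For
  the others the gradient bounds |a_i| or |b_i| times the factor itself, which is the subgradient
  coordinate up to the effect of the deletion.\<close>

lemma local_estimates:
  "\<exists>C>0. \<forall>\<^sub>F z in nhds zs. norm (gradF z) \<le> 1 \<and>
     F z - f s \<le> f (reduced z) - f s + C * (norm (gradF z))\<^sup>2 \<and>
     (\<forall>i. \<bar>subgr z $ i\<bar> * sqrt \<bar>reduced z $ i\<bar> \<le> C * norm (gradF z)) \<and>
     (\<forall>i. s $ i \<noteq> 0 \<longrightarrow> \<bar>subgr z $ i\<bar> \<le> C * norm (gradF z)) \<and>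
     (\<exists>w\<in>convex_subdiff l1_norm (reduced z). subgr z = u (reduced z) + \<mu> *\<^sub>R w)"
proof -
  \<comment> \<open>The gap to the bounds is at least \<open>2 * m\<close> at inactive indices, so
    \<open>m\<close> remains after a perturbation of \<open>u\<close> by less than \<open>m\<close>.
    Including \<mu> makes the set nonempty and covers the factor at the opposite bound, where the
    gap is 2 \<mu>.\<close>
  define m where "m = Min (insert \<mu> ((\<lambda>i. (\<mu> - \<bar>u s $ i\<bar>) / 2) ` {i. \<bar>u s $ i\<bar> < \<mu>}))"
  have m: "m > 0" "m \<le> \<mu>" "\<And>i. \<bar>u s $ i\<bar> < \<mu> \<Longrightarrow> 2 * m \<le> \<mu> - \<bar>u s $ i\<bar>"
  proof -
    show "m > 0" unfolding m_def by (subst Min_gr_iff) (auto simp: mu)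
    show "m \<le> \<mu>" unfolding m_def by (intro Min_le) auto
    fix i assume "\<bar>u s $ i\<bar> < \<mu>"
    then have "m \<le> (\<mu> - \<bar>u s $ i\<bar>) / 2" unfolding m_def by (intro Min_le) auto
    then show "2 * m \<le> \<mu> - \<bar>u s $ i\<bar>" by simp
  qed
  define R where "R = norm s + 1"
  define R1 where "R1 = norm zs + 1"
  obtain L where L: "L > 0" "\<And>x y. x \<in> cball 0 R \<Longrightarrow> y \<in> cball 0 R \<Longrightarrow> norm (u x - u y) \<le> L * norm (x - y)"
    using h.Lipschitz_cball by blast
  obtain Lh where Lh: "Lh \<ge> 0" "\<And>x y. x \<in> cball 0 R \<Longrightarrow> y \<in> cball 0 R \<Longrightarrow> \<bar>h x - h y\<bar> \<le> Lh * norm (x - y)"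
    using h.Lipschitz_F_cball by blast
  define n where "n = real CARD('n)"
  \<comment> \<open>|t| m \<le> e/2 gives t^2 \<le> k e^2. In \<open>Ca\<close>, 2 \<mu> pays for
    the minima, \<mu> for the change of the l1-norm and \<open>Lh\<close> for that of
    \<open>h\<close>. In \<open>Cb\<close>, 1/2 undoes the factor 2 in \<open>gradF\<close>, and the
    rest pays for evaluating \<open>u\<close> at \<open>reduced z\<close> instead of
    \<open>square_diff z\<close>.\<close>
  define k where "k = 1 / (4 * m\<^sup>2)"
  have n: "n \<ge> 0" and k: "k > 0" using m by (auto simp: n_def k_def)
  define Ca where "Ca = (3 * \<mu> + Lh) * n * k"
  define Cb where "Cb = 1 / 2 + R1 * (L * (n * k))"
  \<comment> \<open>Terms with \<open>s $ i = 0\<close> are 0, since division by zero yields 0; the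
    sum merely dominates each of the other terms.\<close>
  define Cc where "Cc = (\<Sum>i\<in>UNIV. Cb / sqrt (\<bar>s $ i\<bar> / 2))"
  have R1: "R1 > 0" by (simp add: R1_def add_nonneg_pos)
  have Ca: "Ca \<ge> 0" using mu Lh n k by (simp add: Ca_def)
  have Cb: "Cb > 0" unfolding Cb_def using R1 L n k by (simp add: add_pos_nonneg)
  have Cc: "Cc \<ge> 0" unfolding Cc_def using Cb by (intro sum_nonneg) simp
  define C where "C = Ca + Cb + Cc"
  have C: "C > 0" "Ca \<le> C" "Cb \<le> C" "Cc \<le> C" using Ca Cb Cc by (auto simp: C_def)
  have cu: "continuous_on UNIV (\<lambda>z. u (square_diff z))" "continuous_on UNIV (\<lambda>z. u (reduced z))"
    using continuous_on_compose2[OF h.cont_g[of UNIV] continuous_square_diff]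
      continuous_on_compose2[OF h.cont_g[of UNIV] continuous_reduced] by auto
  have "\<forall>\<^sub>F z in nhds zs. (\<forall>i. \<bar>u (square_diff z) $ i - u s $ i\<bar> < m) \<and> (\<forall>i. \<bar>u (reduced z) $ i - u s $ i\<bar> < m)
      \<and> norm (gradF z) < 1 \<and> norm (square_diff z) < R \<and> norm (reduced z) < R \<and> norm z < R1
      \<and> (\<forall>i. s $ i \<noteq> 0 \<longrightarrow> \<bar>s $ i - reduced z $ i\<bar> < \<bar>s $ i\<bar> / 2)"
  proof (intro eventually_conj eventually_all_finite)
    fix i
    show "\<forall>\<^sub>F z in nhds zs. \<bar>u (square_diff z) $ i - u s $ i\<bar> < m"
      by (intro eventually_less_nhds continuous_intros cu) (simp add: s_def[symmetric] m)
    show "\<forall>\<^sub>F z in nhds zs. \<bar>u (reduced z) $ i - u s $ i\<bar> < m"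
      by (intro eventually_less_nhds continuous_intros cu) (simp add: reduced_zs m)
    show "\<forall>\<^sub>F z in nhds zs. s $ i \<noteq> 0 \<longrightarrow> \<bar>s $ i - reduced z $ i\<bar> < \<bar>s $ i\<bar> / 2"
    proof (cases "s $ i = 0")
      case False
      have "\<forall>\<^sub>F z in nhds zs. \<bar>s $ i - reduced z $ i\<bar> < \<bar>s $ i\<bar> / 2"
        by (intro eventually_less_nhds continuous_intros continuous_reduced) (simp add: reduced_zs False)
      then show ?thesis by simp
    qed simp
  next
    have "gradF zs = 0" using sosp by (simp add: second_order_stationary_def F.grad_eq)
    then show "\<forall>\<^sub>F z in nhds zs. norm (gradF z) < 1"
      by (intro eventually_less_nhds continuous_intros F.cont_g) simp
    show "\<forall>\<^sub>F z in nhds zs. norm (square_diff z) < R"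
      by (intro eventually_less_nhds continuous_intros continuous_square_diff) (simp add: s_def[symmetric] R_def)
    show "\<forall>\<^sub>F z in nhds zs. norm (reduced z) < R"
      by (intro eventually_less_nhds continuous_intros continuous_reduced) (simp add: reduced_zs R_def)
    show "\<forall>\<^sub>F z in nhds zs. norm z < R1"
      by (intro eventually_less_nhds continuous_intros) (simp add: R1_def)
  qed
  then have "\<forall>\<^sub>F z in nhds zs. norm (gradF z) \<le> 1 \<and>
     F z - f s \<le> f (reduced z) - f s + C * (norm (gradF z))\<^sup>2 \<and>
     (\<forall>i. \<bar>subgr z $ i\<bar> * sqrt \<bar>reduced z $ i\<bar> \<le> C * norm (gradF z)) \<and>
     (\<forall>i. s $ i \<noteq> 0 \<longrightarrow> \<bar>subgr z $ i\<bar> \<le> C * norm (gradF z)) \<and>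
     (\<exists>w\<in>convex_subdiff l1_norm (reduced z). subgr z = u (reduced z) + \<mu> *\<^sub>R w)"
  proof (rule eventually_mono, elim conjE)
    fix z
    assume z1: "\<forall>i. \<bar>u (square_diff z) $ i - u s $ i\<bar> < m" and z2: "\<forall>i. \<bar>u (reduced z) $ i - u s $ i\<bar> < m"
      and z3: "norm (gradF z) < 1" and z4: "norm (square_diff z) < R" "norm (reduced z) < R" and z5: "norm z < R1"
      and z6: "\<forall>i. s $ i \<noteq> 0 \<longrightarrow> \<bar>s $ i - reduced z $ i\<bar> < \<bar>s $ i\<bar> / 2"
    define e where "e = norm (gradF z)"
    have e: "0 \<le> e" "e \<le> 1" using z3 by (auto simp: e_def)
    have e2: "e\<^sup>2 \<le> e" using e by (simp add: power2_eq_square mult_left_le)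
    define a b where "a i = fst z $ i" and "b i = snd z $ i" for i
    have comp: "\<bar>a i\<bar> * \<bar>u (square_diff z) $ i + \<mu>\<bar> \<le> e / 2" "\<bar>b i\<bar> * \<bar>\<mu> - u (square_diff z) $ i\<bar> \<le> e / 2" for i
    proof -
      have "\<bar>fst (gradF z) $ i\<bar> \<le> e" unfolding e_def
        using component_le_norm_cart[of "fst (gradF z)" i] norm_fst_le[of "fst (gradF z)" "snd (gradF z)"] by simp
      then show "\<bar>a i\<bar> * \<bar>u (square_diff z) $ i + \<mu>\<bar> \<le> e / 2" by (simp add: gradF_def a_def abs_mult)
      have "\<bar>snd (gradF z) $ i\<bar> \<le> e" unfolding e_def
        using component_le_norm_cart[of "snd (gradF z)" i] norm_snd_le[of "snd (gradF z)" "fst (gradF z)"] by simp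
      then show "\<bar>b i\<bar> * \<bar>\<mu> - u (square_diff z) $ i\<bar> \<le> e / 2" by (simp add: gradF_def b_def abs_mult)
    qed
    have square: "t\<^sup>2 \<le> e\<^sup>2 * k" if t: "\<bar>t\<bar> * d \<le> e / 2" "m \<le> d" for t d
    proof -
      have "\<bar>t\<bar> * m \<le> \<bar>t\<bar> * d" using t(2) by (intro mult_left_mono) auto
      then have "\<bar>t\<bar> * m \<le> e / 2" using t(1) by linarith
      then have "(\<bar>t\<bar> * m)\<^sup>2 \<le> (e / 2)\<^sup>2" using m by (intro power_mono) auto
      then show ?thesis using m by (simp add: k_def power_mult_distrib power_divide field_simps)
    qed
    have asmall: "(a i)\<^sup>2 \<le> e\<^sup>2 * k" if "u s $ i \<noteq> - \<mu>" for i
    proof (rule square[OF comp(1)[of i]])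
      have "2 * m \<le> u s $ i + \<mu>"
        using sosp_coordinates(1)[of i] m(2) m(3)[of i] that by (cases "\<bar>u s $ i\<bar> < \<mu>") (auto simp: abs_if split: if_splits)
      then show "m \<le> \<bar>u (square_diff z) $ i + \<mu>\<bar>" using z1[rule_format, of i] by linarith
    qed
    have bsmall: "(b i)\<^sup>2 \<le> e\<^sup>2 * k" if "u s $ i \<noteq> \<mu>" for i
    proof (rule square[OF comp(2)[of i]])
      have "2 * m \<le> \<mu> - u s $ i"
        using sosp_coordinates(1)[of i] m(2) m(3)[of i] that by (cases "\<bar>u s $ i\<bar> < \<mu>") (auto simp: abs_if split: if_splits)
      then show "m \<le> \<bar>\<mu> - u (square_diff z) $ i\<bar>" using z1[rule_format, of i] by linarith
    qed
    have minq: "min ((a i)\<^sup>2) ((b i)\<^sup>2) \<le> e\<^sup>2 * k" for i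
      using asmall[of i] bsmall[of i] mu by (cases "u s $ i = \<mu>") auto
    have redq: "\<bar>square_diff z $ i - reduced z $ i\<bar> \<le> e\<^sup>2 * k" for i
    proof -
      have gen: "\<bar>(A - B) - (if P then A else if M then - B else 0)\<bar> \<le> q"
        if "0 \<le> A" "0 \<le> B" "\<not> P \<Longrightarrow> A \<le> q" "\<not> M \<Longrightarrow> B \<le> q" "\<not> (P \<and> M)" for A B q :: real and P M
        using that by (cases P; cases M) auto
      show ?thesis
        unfolding square_diff_nth reduced_def vec_lambda_beta
        by (rule gen) (use asmall[of i] bsmall[of i] mu in \<open>auto simp: a_def b_def\<close>)
    qed
    have sumq: "(\<Sum>i\<in>UNIV. \<bar>square_diff z $ i - reduced z $ i\<bar>) \<le> n * (e\<^sup>2 * k)"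
      using sum_bounded_above[of UNIV "\<lambda>i. \<bar>square_diff z $ i - reduced z $ i\<bar>" "e\<^sup>2 * k"] redq by (simp add: n_def)
    have normq: "norm (square_diff z - reduced z) \<le> n * (e\<^sup>2 * k)"
      using norm_le_l1_cart[of "square_diff z - reduced z"] sumq by simp
    have inR: "square_diff z \<in> cball 0 R" "reduced z \<in> cball 0 R" using z4 by auto
    have est1: "F z - f s \<le> f (reduced z) - f s + C * e\<^sup>2"
    proof -
      have "(\<Sum>i\<in>UNIV. min ((fst z $ i)\<^sup>2) ((snd z $ i)\<^sup>2)) \<le> n * (e\<^sup>2 * k)"
        using sum_bounded_above[of UNIV "\<lambda>i. min ((fst z $ i)\<^sup>2) ((snd z $ i)\<^sup>2)" "e\<^sup>2 * k"] minq
        by (simp add: n_def a_def b_def)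
      then have 1: "2 * \<mu> * (\<Sum>i\<in>UNIV. min ((fst z $ i)\<^sup>2) ((snd z $ i)\<^sup>2)) \<le> 2 * \<mu> * (n * (e\<^sup>2 * k))"
        using mu by (intro mult_left_mono) auto
      have 2: "h (square_diff z) - h (reduced z) \<le> Lh * (n * (e\<^sup>2 * k))"
        using Lh(2)[OF inR] mult_left_mono[OF normq Lh(1)] by linarith
      have "l1_norm (square_diff z) - l1_norm (reduced z) \<le> n * (e\<^sup>2 * k)"
        using l1_norm_diff_le[of "square_diff z" "reduced z"] sumq by linarith
      then have 3: "\<mu> * (l1_norm (square_diff z) - l1_norm (reduced z)) \<le> \<mu> * (n * (e\<^sup>2 * k))"
        using mu by (intro mult_left_mono) auto
      have "F z \<le> f (reduced z) + Ca * e\<^sup>2"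
        using 1 2 3 unfolding F_eq_f f Ca_def by (simp add: algebra_simps)
      also have "\<dots> \<le> f (reduced z) + C * e\<^sup>2" using C(2) by (simp add: mult_right_mono)
      finally show ?thesis by simp
    qed
    have uu: "\<bar>u (reduced z) $ i - u (square_diff z) $ i\<bar> \<le> L * (n * k) * e" for i
    proof -
      have "\<bar>u (reduced z) $ i - u (square_diff z) $ i\<bar> \<le> norm (u (reduced z) - u (square_diff z))"
        using component_le_norm_cart[of "u (reduced z) - u (square_diff z)" i] by simp
      also have "\<dots> \<le> L * norm (reduced z - square_diff z)" by (rule L(2)[OF inR(2,1)])
      also have "\<dots> \<le> L * (n * (e\<^sup>2 * k))" using normq L(1) by (simp add: norm_minus_commute)
      also have "\<dots> \<le> L * (n * (e * k))" using e2 L(1) n k by (intro mult_left_mono mult_right_mono) auto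
      finally show ?thesis by (simp add: mult_ac)
    qed
    have est2: "\<bar>subgr z $ i\<bar> * sqrt \<bar>reduced z $ i\<bar> \<le> Cb * e" for i
    proof -
      have key: "\<bar>t\<bar> * \<bar>y\<bar> \<le> Cb * e"
        if "\<bar>t\<bar> * \<bar>x\<bar> \<le> e / 2" "\<bar>y - x\<bar> \<le> L * (n * k) * e" "\<bar>t\<bar> \<le> R1" for t x y
      proof -
        have "\<bar>t\<bar> * \<bar>y\<bar> \<le> \<bar>t\<bar> * (\<bar>x\<bar> + \<bar>y - x\<bar>)" by (intro mult_left_mono) auto
        also have "\<dots> = \<bar>t\<bar> * \<bar>x\<bar> + \<bar>t\<bar> * \<bar>y - x\<bar>" by (simp add: distrib_left)
        also have "\<dots> \<le> e / 2 + R1 * (L * (n * k) * e)"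
          using that R1 by (intro add_mono mult_mono) auto
        finally show ?thesis by (simp add: Cb_def algebra_simps)
      qed
      have ab: "\<bar>a i\<bar> \<le> R1" "\<bar>b i\<bar> \<le> R1"
        using component_le_norm_cart[of "fst z" i] component_le_norm_cart[of "snd z" i]
          norm_fst_le[of "fst z" "snd z"] norm_snd_le[of "snd z" "fst z"] z5 unfolding a_def b_def by auto
      show ?thesis
      proof (cases "u s $ i = - \<mu>")
        case True
        then have "\<bar>subgr z $ i\<bar> * sqrt \<bar>reduced z $ i\<bar> = \<bar>a i\<bar> * \<bar>u (reduced z) $ i + \<mu>\<bar>"
          by (simp add: subgr_def reduced_def a_def)
        also have "\<dots> \<le> Cb * e"
          by (rule key[OF comp(1)[of i] _ ab(1)]) (use uu[of i] in simp)
        finally show ?thesis .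
      next
        case False
        show ?thesis
        proof (cases "u s $ i = \<mu>")
          case True
          then have "\<bar>subgr z $ i\<bar> * sqrt \<bar>reduced z $ i\<bar> = \<bar>b i\<bar> * \<bar>\<mu> - u (reduced z) $ i\<bar>"
            using mu by (simp add: subgr_def reduced_def b_def abs_minus_commute)
          also have "\<dots> \<le> Cb * e"
            by (rule key[OF comp(2)[of i] _ ab(2)]) (use uu[of i] in simp)
          finally show ?thesis .
        next
          case nmu: False
          then show ?thesis using False Cb e by (simp add: subgr_def)
        qed
      qed
    qed
    have est3: "\<bar>subgr z $ i\<bar> \<le> Cc * e" if si: "s $ i \<noteq> 0" for i
    proof -
      define y where "y = sqrt (\<bar>s $ i\<bar> / 2)"
      have y: "y > 0" using si by (simp add: y_def)
      have "\<bar>s $ i\<bar> / 2 \<le> \<bar>reduced z $ i\<bar>" using z6[rule_format, OF si] by linarith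
      then have "y \<le> sqrt \<bar>reduced z $ i\<bar>" unfolding y_def by (rule real_sqrt_le_mono)
      then have "\<bar>subgr z $ i\<bar> * y \<le> \<bar>subgr z $ i\<bar> * sqrt \<bar>reduced z $ i\<bar>" by (intro mult_left_mono) auto
      then have "\<bar>subgr z $ i\<bar> * y \<le> Cb * e" using est2[of i] by linarith
      then have "\<bar>subgr z $ i\<bar> \<le> Cb / y * e" using y by (simp add: field_simps)
      also have "Cb / y \<le> Cc" unfolding Cc_def y_def using Cb
        by (intro member_le_sum[of i UNIV "\<lambda>i. Cb / sqrt (\<bar>s $ i\<bar> / 2)"]) auto
      then have "Cb / y * e \<le> Cc * e" using e by (intro mult_right_mono)
      finally show ?thesis .
    qed
    have est4: "\<exists>w\<in>convex_subdiff l1_norm (reduced z). subgr z = u (reduced z) + \<mu> *\<^sub>R w"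
    proof
      \<comment> \<open>At inactive indices \<open>w $ i\<close> is
        \<open>- u (reduced z) $ i / \<mu>\<close>, and it has modulus at most 1 because
        \<open>u\<close> has moved by less than the gap. At active ones it is 1 or -1, matching the
        sign of \<open>reduced z $ i\<close>.\<close>
      define w where "w = (subgr z - u (reduced z)) /\<^sub>R \<mu>"
      show "subgr z = u (reduced z) + \<mu> *\<^sub>R w" using mu by (simp add: w_def)
      have "\<bar>w $ i\<bar> \<le> 1 \<and> w $ i * reduced z $ i = \<bar>reduced z $ i\<bar>" for i
      proof (cases "\<bar>u s $ i\<bar> < \<mu>")
        case True
        then have "w $ i = - u (reduced z) $ i / \<mu>" "reduced z $ i = 0"
          by (auto simp: w_def subgr_def reduced_def field_simps)
        moreover have "\<bar>u (reduced z) $ i\<bar> \<le> \<mu>"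
          using z2[rule_format, of i] m(3)[OF True] m(1) by linarith
        ultimately show ?thesis using mu by simp
      next
        case False
        then have "u s $ i = - \<mu> \<or> u s $ i = \<mu>" using sosp_coordinates(1)[of i] by linarith
        then show ?thesis using mu by (auto simp: w_def subgr_def reduced_def)
      qed
      then show "w \<in> convex_subdiff l1_norm (reduced z)" by (simp add: convex_subdiff_l1_norm)
    qed
    have "Cb * e \<le> C * e" "Cc * e \<le> C * e" using C e by (auto intro: mult_right_mono)
    then show "norm (gradF z) \<le> 1 \<and>
     F z - f s \<le> f (reduced z) - f s + C * (norm (gradF z))\<^sup>2 \<and>
     (\<forall>i. \<bar>subgr z $ i\<bar> * sqrt \<bar>reduced z $ i\<bar> \<le> C * norm (gradF z)) \<and>
     (\<forall>i. s $ i \<noteq> 0 \<longrightarrow> \<bar>subgr z $ i\<bar> \<le> C * norm (gradF z)) \<and>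
     (\<exists>w\<in>convex_subdiff l1_norm (reduced z). subgr z = u (reduced z) + \<mu> *\<^sub>R w)"
      unfolding e_def[symmetric] using e(2) est1 est4 order_trans[OF est2] order_trans[OF est3] by blast
  qed
  then show ?thesis using C(1) by blast
qed

end

section \<open>The KL exponent of the nonsmooth function\<close>

text \<open>Either the quadratic error dominates, and \<open>p \<ge> 1/2\<close> turns e^(2p) into
  at most e; or \<open>\<Delta>\<close> dominates, and its exponent \<open>q\<close> may be raised
  to \<open>p\<close> because \<open>e \<le> 1\<close>.\<close>

lemma Lojasiewicz_combine:
  fixes R \<Delta> e :: real
  assumes q: "0 < q" "q \<le> p" and p: "1/2 \<le> p" and A: "0 \<le> A" and B: "0 \<le> B" and e: "0 \<le> e" "e \<le> 1"
    and R: "0 \<le> R" "R \<le> \<Delta> + B * e\<^sup>2" and \<Delta>: "\<Delta> > 0 \<Longrightarrow> \<Delta> powr q \<le> A * e"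
  shows "R powr p \<le> ((2 * B) powr p + 2 powr p * A powr (p / q)) * e"
proof (cases "\<Delta> \<le> B * e\<^sup>2")
  case True
  have ep: "(e\<^sup>2) powr p \<le> e"
  proof (cases "e = 0")
    case False
    then have "(e\<^sup>2) powr p = e powr (2 * p)" using e by (simp add: powr_powr[symmetric] powr_numeral)
    also have "\<dots> \<le> e powr 1" using e False p by (intro powr_mono') auto
    finally show ?thesis using e by simp
  qed simp
  have "R powr p \<le> ((2 * B) * e\<^sup>2) powr p" using True R p by (intro powr_mono2) auto
  also have "\<dots> = (2 * B) powr p * (e\<^sup>2) powr p" by (rule powr_mult)
  also have "\<dots> \<le> (2 * B) powr p * e" using ep by (intro mult_left_mono) auto
  also have "\<dots> \<le> ((2 * B) powr p + 2 powr p * A powr (p / q)) * e"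
    using e by (intro mult_right_mono) auto
  finally show ?thesis .
next
  case False
  have "0 \<le> B * e\<^sup>2" using B by simp
  then have D: "\<Delta> > 0" using False by linarith
  have "R powr p \<le> (2 * \<Delta>) powr p" using False R p by (intro powr_mono2) auto
  also have "\<dots> = 2 powr p * (\<Delta> powr q) powr (p / q)" using q by (simp add: powr_mult powr_powr)
  also have "\<dots> \<le> 2 powr p * (A * e) powr (p / q)"
    using \<Delta>[OF D] q by (intro mult_left_mono powr_mono2) auto
  also have "\<dots> = 2 powr p * A powr (p / q) * e powr (p / q)" by (simp add: powr_mult)
  also have "\<dots> \<le> 2 powr p * A powr (p / q) * e"
  proof (intro mult_left_mono)
    show "e powr (p / q) \<le> e"
    proof (cases "e = 0")
      case False
      have "e powr (p / q) \<le> e powr 1" using e False q by (intro powr_mono') auto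
      then show ?thesis using e by simp
    qed simp
  qed simp
  also have "\<dots> \<le> ((2 * B) powr p + 2 powr p * A powr (p / q)) * e"
    using e by (intro mult_right_mono) auto
  finally show ?thesis .
qed

lemma deriv_const_powr:
  fixes t :: real
  assumes "t > 0"
  shows "deriv (\<lambda>t. c * t powr (1 - \<alpha>)) t = c * ((1 - \<alpha>) * t powr (- \<alpha>))"
  by (rule DERIV_imp_deriv) (use assms in \<open>auto intro!: derivative_eq_intros\<close>)

lemma (in C2_pair) convex_above_tangent:
  assumes "convex_on UNIV F"
  shows "F x + g x \<bullet> (y - x) \<le> F y"
proof -
  have "((\<lambda>t. x + t *\<^sub>R (y - x)) has_derivative (\<lambda>t. t *\<^sub>R (y - x))) (at 0)"
    by (auto intro!: derivative_eq_intros)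
  from has_derivative_compose[OF this, of F "\<lambda>h. h \<bullet> g x"]
  have "((\<lambda>t. F (x + t *\<^sub>R (y - x))) has_derivative (\<lambda>t. (t *\<^sub>R (y - x)) \<bullet> g x)) (at 0)"
    using der[of x] by (simp add: gderiv_def)
  then have "((\<lambda>t. F (x + t *\<^sub>R (y - x))) has_field_derivative (g x \<bullet> (y - x))) (at 0)"
    by (simp add: has_field_derivative_def inner_commute mult.commute[of _ "g x \<bullet> (y - x)"])
  then have "((\<lambda>t. (F (x + t *\<^sub>R (y - x)) - F x) / t) \<longlongrightarrow> g x \<bullet> (y - x)) (at_right 0)"
    using has_field_derivative_at_within[of _ _ 0 "{0<..}"] unfolding has_field_derivative_iff by fastforce
  moreover have "\<forall>\<^sub>F t in at_right 0. (F (x + t *\<^sub>R (y - x)) - F x) / t \<le> F y - F x"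
  proof (rule eventually_at_rightI[of 0 1])
    fix t :: real assume t: "t \<in> {0<..<1}"
    have "x + t *\<^sub>R (y - x) = (1 - t) *\<^sub>R x + t *\<^sub>R y" by (simp add: algebra_simps)
    then have "F (x + t *\<^sub>R (y - x)) \<le> (1 - t) * F x + t * F y"
      using convex_onD[OF assms, of t x y] t by simp
    then show "(F (x + t *\<^sub>R (y - x)) - F x) / t \<le> F y - F x"
      using t by (simp add: field_simps)
  qed simp
  ultimately have "g x \<bullet> (y - x) \<le> F y - F x"
    by (rule tendsto_upperbound) simp
  then show ?thesis by simp
qed

context hadamard
begin

lemma continuous_f: "continuous_on S f"
proof -
  have "continuous_on S (\<lambda>x. h x + \<mu> * (\<Sum>i\<in>UNIV. \<bar>x $ i\<bar>))" by (intro continuous_intros h.cont_F)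
  then show ?thesis by (simp add: f l1_norm_def cong: continuous_on_cong)
qed

lemma regular_subdiff_f:
  assumes "w \<in> convex_subdiff l1_norm x"
  shows "u x + \<mu> *\<^sub>R w \<in> regular_subdiff f x"
proof -
  have "f = (\<lambda>x. h x + \<mu> * l1_norm x)" using f by blast
  moreover have "\<mu> *\<^sub>R w \<in> convex_subdiff (\<lambda>x. \<mu> * l1_norm x) x"
    using assms mu by (auto simp: convex_subdiff_def distrib_left[symmetric])
  ultimately show ?thesis
    using regular_subdiff_add_convex[OF regular_subdiff_grad[OF h.der]] by simp
qed

lemma convex_f_above_tangent:
  assumes "convex_on UNIV h" and w: "w \<in> convex_subdiff l1_norm x"
  shows "f x + (u x + \<mu> *\<^sub>R w) \<bullet> (y - x) \<le> f y"
proof -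
  have "l1_norm x + w \<bullet> (y - x) \<le> l1_norm y" using w by (simp add: convex_subdiff_def)
  then have "\<mu> * (l1_norm x + w \<bullet> (y - x)) \<le> \<mu> * l1_norm y" using mu by (intro mult_left_mono) auto
  then show ?thesis
    using h.convex_above_tangent[OF assms(1), of x y] by (simp add: f inner_add_left algebra_simps)
qed

text \<open>The neighbourhood is shrunk by continuity of \<open>f\<close>, so that the upper bound
  on the values in the KL property holds automatically. The constant
  \<open>c * (1 - \<alpha>)\<close> comes from differentiating the desingularizing power.\<close>

lemma KL_exponent_f:
  assumes KL: "KL_exponent f x0 \<alpha>" and \<alpha>: "0 < \<alpha>" "\<alpha> < 1"
  shows "\<exists>N A. open N \<and> x0 \<in> N \<and> A > 0 \<and>
    (\<forall>x\<in>N. \<forall>w\<in>convex_subdiff l1_norm x. 0 < f x - f x0 \<longrightarrow> (f x - f x0) powr \<alpha> \<le> A * norm (u x + \<mu> *\<^sub>R w))"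
proof -
  obtain c where c: "c > 0" "KL_with (\<lambda>t. c * t powr (1 - \<alpha>)) f x0"
    using KL unfolding KL_exponent_def by blast
  obtain r V where V: "r > 0" "open V" "x0 \<in> V"
    "\<And>y v. y \<in> V \<Longrightarrow> 0 < f y - f x0 \<Longrightarrow> ereal (f y - f x0) < r \<Longrightarrow> v \<in> regular_subdiff f y \<Longrightarrow>
       deriv (\<lambda>t. c * t powr (1 - \<alpha>)) (f y - f x0) * norm v \<ge> 1"
    by (rule KL_withD[OF c(2)]) blast
  obtain r' where r': "r' > 0" "ereal r' \<le> r"
    using V(1) by (cases r) (auto intro: that[of 1])
  define N where "N = V \<inter> {x. f x - f x0 < r'}"
  have "open {x. f x - f x0 < r'}" by (intro open_Collect_less continuous_intros continuous_f)
  then have "open N" "x0 \<in> N" using V(2,3) r'(1) by (auto simp: N_def)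
  moreover have "(f x - f x0) powr \<alpha> \<le> c * (1 - \<alpha>) * norm (u x + \<mu> *\<^sub>R w)"
    if x: "x \<in> N" "w \<in> convex_subdiff l1_norm x" "0 < f x - f x0" for x w
  proof -
    define \<tau> where "\<tau> = f x - f x0"
    have "ereal \<tau> < ereal r'" using x(1) by (simp add: N_def \<tau>_def)
    then have "ereal \<tau> < r" using r'(2) by (rule less_le_trans)
    then have "1 \<le> c * ((1 - \<alpha>) * \<tau> powr (- \<alpha>)) * norm (u x + \<mu> *\<^sub>R w)"
      using V(4)[OF _ x(3) _ regular_subdiff_f[OF x(2)]] x by (simp add: N_def \<tau>_def deriv_const_powr)
    then have "\<tau> powr \<alpha> * 1 \<le> \<tau> powr \<alpha> * (c * ((1 - \<alpha>) * \<tau> powr (- \<alpha>)) * norm (u x + \<mu> *\<^sub>R w))"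
      by (intro mult_left_mono) auto
    also have "\<dots> = (\<tau> powr \<alpha> * \<tau> powr (- \<alpha>)) * (c * (1 - \<alpha>) * norm (u x + \<mu> *\<^sub>R w))" by simp
    also have "\<tau> powr \<alpha> * \<tau> powr (- \<alpha>) = 1" using x(3) by (simp add: \<tau>_def powr_add[symmetric])
    finally show ?thesis by (simp add: \<tau>_def)
  qed
  moreover have "c * (1 - \<alpha>) > 0" using c(1) \<alpha> by simp
  ultimately show ?thesis by blast
qed

text \<open>The witness is the minimal norm element of the subdifferential.\<close>

lemma steepest_descent:
  "\<exists>w\<in>convex_subdiff l1_norm y. let v = u y + \<mu> *\<^sub>R w in
     ((\<lambda>t. (f y - f (y - t *\<^sub>R v)) / t) \<longlongrightarrow> (norm v)\<^sup>2) (at_right 0)"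
proof -
  \<comment> \<open>At zero coordinates -u/\<mu> is clipped to [-1, 1], so \<open>v\<close> is
    \<open>u\<close> soft-thresholded there. This makes each |y_i| change exactly linearly along
    \<open>- v\<close> for small \<open>t\<close>.\<close>
  define w :: "real ^ 'n" where
    "w = (\<chi> i. if y $ i = 0 then max (-1) (min 1 (- u y $ i / \<mu>)) else sgn (y $ i))"
  define v where "v = u y + \<mu> *\<^sub>R w"
  have w: "w \<in> convex_subdiff l1_norm y"
    by (auto simp: convex_subdiff_l1_norm w_def abs_le_iff sgn_if)
  have each: "\<forall>\<^sub>F t in at_right 0. \<bar>y $ i\<bar> - \<bar>y $ i - t * v $ i\<bar> = t * (v $ i * w $ i)" for i
  proof (cases "y $ i = 0")
    case True
    have vw: "v $ i * w $ i = - \<bar>v $ i\<bar>"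
      using True mu by (auto simp: v_def w_def max_def min_def field_simps abs_if)
    show ?thesis
      using eventually_at_right_less[of 0] by eventually_elim (simp add: True vw abs_mult)
  next
    case False
    have "((\<lambda>t. \<bar>t * v $ i\<bar>) \<longlongrightarrow> \<bar>0 * v $ i\<bar>) (at_right 0)" by (intro tendsto_intros)
    then have "\<forall>\<^sub>F t in at_right 0. \<bar>t * v $ i\<bar> < \<bar>y $ i\<bar>"
      using False by (intro order_tendstoD(2)[where y = "\<bar>0 * v $ i\<bar>"]) auto
    then show ?thesis
      by eventually_elim (use False in \<open>auto simp: w_def sgn_if abs_if split: if_splits\<close>)
  qed
  have all: "\<forall>\<^sub>F t in at_right 0. \<forall>i. \<bar>y $ i\<bar> - \<bar>y $ i - t * v $ i\<bar> = t * (v $ i * w $ i)"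
    by (intro eventually_all_finite each)
  have l1: "\<forall>\<^sub>F t in at_right 0. (\<mu> * (l1_norm y - l1_norm (y - t *\<^sub>R v))) / t = \<mu> * (v \<bullet> w)"
    using all eventually_at_right_less[of 0]
  proof eventually_elim
    case (elim t)
    have "l1_norm y - l1_norm (y - t *\<^sub>R v) = (\<Sum>i\<in>UNIV. t * (v $ i * w $ i))"
      unfolding l1_norm_def sum_subtractf[symmetric] using elim(1) by simp
    also have "\<dots> = t * (v \<bullet> w)" by (simp add: inner_vec_def sum_distrib_left)
    finally show ?case using elim(2) by simp
  qed
  have "((\<lambda>t. y - t *\<^sub>R v) has_derivative (\<lambda>t. - (t *\<^sub>R v))) (at 0)"
    by (auto intro!: derivative_eq_intros)
  from has_derivative_compose[OF this, of h "\<lambda>h. h \<bullet> u y"]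
  have "((\<lambda>t. h (y - t *\<^sub>R v)) has_derivative (\<lambda>t. - (t *\<^sub>R v) \<bullet> u y)) (at 0)"
    using h.der[of y] by (simp add: gderiv_def)
  then have "((\<lambda>t. h (y - t *\<^sub>R v)) has_field_derivative (- (v \<bullet> u y))) (at 0)"
    by (rule has_derivative_imp_has_field_derivative) simp
  then have "((\<lambda>t. (h (y - t *\<^sub>R v) - h y) / t) \<longlongrightarrow> - (v \<bullet> u y)) (at_right 0)"
    using has_field_derivative_at_within[of _ _ 0 "{0<..}"] unfolding has_field_derivative_iff by fastforce
  then have "((\<lambda>t. - ((h (y - t *\<^sub>R v) - h y) / t) + \<mu> * (v \<bullet> w)) \<longlongrightarrow> - (- (v \<bullet> u y)) + \<mu> * (v \<bullet> w)) (at_right 0)"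
    by (intro tendsto_intros)
  moreover have "- (- (v \<bullet> u y)) + \<mu> * (v \<bullet> w) = (norm v)\<^sup>2"
    by (simp add: power2_norm_eq_inner v_def inner_add_right)
  moreover have "\<forall>\<^sub>F t in at_right 0. - ((h (y - t *\<^sub>R v) - h y) / t) + \<mu> * (v \<bullet> w) = (f y - f (y - t *\<^sub>R v)) / t"
    using l1 by eventually_elim (simp add: f diff_divide_distrib add_divide_distrib algebra_simps)
  ultimately have "((\<lambda>t. (f y - f (y - t *\<^sub>R v)) / t) \<longlongrightarrow> (norm v)\<^sup>2) (at_right 0)"
    using tendsto_cong by fastforce
  then show ?thesis using w unfolding v_def Let_def by blast
qed

text \<open>Minimise \<open>(f y - f x0) powr (1 - \<alpha>) + \<lambda> * norm (y - x)\<close> over a ball around \<open>x\<close>, with \<open>\<lambda>\<close> smaller than the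
  slope the KL inequality enforces off \<open>\<Omega>\<close>: the minimiser must lie in \<open>\<Omega>\<close>.\<close>

lemma KL_error_bound:
  assumes KL: "KL_exponent f x0 \<alpha>" and \<alpha>: "0 < \<alpha>" "\<alpha> < 1" and min: "\<And>x. f x0 \<le> f x"
  shows "\<exists>N C. open N \<and> x0 \<in> N \<and> C > 0 \<and> (\<forall>x\<in>N. infdist x {x. f x = f x0} \<le> C * (f x - f x0) powr (1 - \<alpha>))"
proof -
  define \<Omega> where "\<Omega> = {x. f x = f x0}"
  obtain V A where V: "open V" "x0 \<in> V" "A > 0"
    "\<And>x w. x \<in> V \<Longrightarrow> w \<in> convex_subdiff l1_norm x \<Longrightarrow> 0 < f x - f x0 \<Longrightarrow>
        (f x - f x0) powr \<alpha> \<le> A * norm (u x + \<mu> *\<^sub>R w)"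
    using KL_exponent_f[OF KL \<alpha>] by blast
  obtain \<rho> where \<rho>: "\<rho> > 0" "ball x0 \<rho> \<subseteq> V" using V(1,2) open_contains_ball by blast
  \<comment> \<open>Off the solution set the KL inequality gives \<open>\<phi>\<close> a slope of at
    least \<open>(1 - \<alpha>) / A\<close>; half of it leaves room for a contradiction.\<close>
  define l where "l = (1 - \<alpha>) / (2 * A)"
  have l: "l > 0" using \<alpha> V(3) by (simp add: l_def)
  define \<phi> where "\<phi> x = (f x - f x0) powr (1 - \<alpha>)" for x
  have \<phi>c: "continuous_on S \<phi>" for S
    unfolding \<phi>_def using \<alpha> by (intro continuous_on_powr' continuous_intros continuous_f) (auto simp: min)
  \<comment> \<open>The bound on \<open>\<phi> x\<close> places the minimiser strictly inside the
    ball around \<open>x\<close>, where a small move along \<open>- v\<close> stays admissible. The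
    two radii \<open>\<rho> / 2\<close> add up to \<open>\<rho>\<close>, which keeps it in
    \<open>V\<close>.\<close>
  define N where "N = ball x0 (\<rho> / 2) \<inter> {x. \<phi> x < l * (\<rho> / 2)}"
  have "open {x. \<phi> x < l * (\<rho> / 2)}" by (intro open_Collect_less continuous_intros \<phi>c)
  moreover have "\<phi> x0 = 0" by (simp add: \<phi>_def)
  ultimately have "open N" "x0 \<in> N" using \<rho>(1) l by (auto simp: N_def)
  moreover have "infdist x \<Omega> \<le> (1 / l) * \<phi> x" if x: "x \<in> N" for x
  proof -
    define \<psi> where "\<psi> y = \<phi> y + l * norm (y - x)" for y
    have "continuous_on (cball x (\<rho> / 2)) \<psi>" unfolding \<psi>_def by (intro continuous_intros \<phi>c)
    then obtain y where y: "y \<in> cball x (\<rho> / 2)" "\<And>z. z \<in> cball x (\<rho> / 2) \<Longrightarrow> \<psi> y \<le> \<psi> z"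
      using continuous_attains_inf[of "cball x (\<rho> / 2)" \<psi>] \<rho>(1) by auto
    have "\<psi> y \<le> \<psi> x" using \<rho>(1) by (intro y(2)) simp
    then have yx: "\<phi> y + l * norm (y - x) \<le> \<phi> x" by (simp add: \<psi>_def)
    moreover have "\<phi> y \<ge> 0" by (simp add: \<phi>_def)
    ultimately have lx: "l * norm (y - x) \<le> \<phi> x" by simp
    then have "l * norm (y - x) < l * (\<rho> / 2)" using x by (simp add: N_def)
    then have yb: "norm (y - x) < \<rho> / 2" using l by simp
    have "dist x0 y \<le> dist x0 x + norm (y - x)"
      using dist_triangle[of x0 y x] by (simp add: dist_norm norm_minus_commute)
    then have yV: "y \<in> V" using yb x \<rho>(2) by (auto simp: N_def)
    have "f y = f x0"
    proof (rule ccontr)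
      assume "f y \<noteq> f x0"
      define \<tau> where "\<tau> = f y - f x0"
      have \<tau>: "\<tau> > 0" using min[of y] \<open>f y \<noteq> f x0\<close> by (simp add: \<tau>_def)
      obtain w where w: "w \<in> convex_subdiff l1_norm y"
        "((\<lambda>t. (f y - f (y - t *\<^sub>R (u y + \<mu> *\<^sub>R w))) / t) \<longlongrightarrow> (norm (u y + \<mu> *\<^sub>R w))\<^sup>2) (at_right 0)"
        using steepest_descent[of y] unfolding Let_def by blast
      define v where "v = u y + \<mu> *\<^sub>R w"
      have \<tau>v: "\<tau> powr \<alpha> \<le> A * norm v" using V(4)[OF yV w(1)] \<tau> by (simp add: \<tau>_def v_def)
      have "\<tau> powr \<alpha> > 0" using \<tau> by simp
      then have v0: "norm v > 0" using \<tau>v by (cases "norm v = 0") auto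
      have lim: "((\<lambda>t. (f y - f (y - t *\<^sub>R v)) / t) \<longlongrightarrow> (norm v)\<^sup>2) (at_right 0)"
        using w(2) by (simp add: v_def)
      have "((\<lambda>t. norm (y - t *\<^sub>R v - x)) \<longlongrightarrow> norm (y - 0 *\<^sub>R v - x)) (at_right 0)"
        by (intro tendsto_intros)
      then have "((\<lambda>t. norm (y - t *\<^sub>R v - x)) \<longlongrightarrow> norm (y - x)) (at_right 0)" by simp
      then have ev1: "\<forall>\<^sub>F t in at_right 0. norm (y - t *\<^sub>R v - x) < \<rho> / 2"
        using yb by (rule order_tendstoD(2))
      have "0 < (norm v)\<^sup>2" using v0 by simp
      then have ev2: "\<forall>\<^sub>F t in at_right 0. 0 < (f y - f (y - t *\<^sub>R v)) / t"
        using lim by (intro order_tendstoD(1)[of _ "(norm v)\<^sup>2"])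
      \<comment> \<open>The right-hand side equals half of \<open>(norm v)\<^sup>2\<close>:
        minimality permits only half the descent rate that \<open>v\<close> actually has in the
        limit.\<close>
      have "\<forall>\<^sub>F t in at_right 0. (f y - f (y - t *\<^sub>R v)) / t \<le> norm v * (A * norm v) / (2 * A)"
        using ev1 ev2 eventually_at_right_less[of 0]
      proof eventually_elim
        case (elim t)
        define yt where "yt = y - t *\<^sub>R v"
        have fy: "f yt \<le> f y" using elim(2,3) by (simp add: yt_def zero_less_divide_iff)
        have "yt \<in> cball x (\<rho> / 2)" using elim(1) by (simp add: yt_def dist_norm norm_minus_commute)
        from y(2)[OF this] have "\<phi> y - \<phi> yt \<le> l * (norm (yt - x) - norm (y - x))"
          by (simp add: \<psi>_def algebra_simps)
        also have "\<dots> \<le> l * (t * norm v)"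
        proof (rule mult_left_mono)
          show "norm (yt - x) - norm (y - x) \<le> t * norm v"
            using norm_triangle_ineq2[of "yt - x" "y - x"] elim(3) by (simp add: yt_def)
        qed (use l in simp)
        finally have 1: "\<phi> y - \<phi> yt \<le> l * (t * norm v)" .
        have "(1 - \<alpha>) * \<tau> powr (1 - \<alpha> - 1) * (\<tau> - (f yt - f x0)) \<le> \<tau> powr (1 - \<alpha>) - (f yt - f x0) powr (1 - \<alpha>)"
          using \<alpha> fy min[of yt] \<tau> by (intro powr_diff_ge) (auto simp: \<tau>_def)
        then have "(1 - \<alpha>) * \<tau> powr (- \<alpha>) * (f y - f yt) \<le> \<phi> y - \<phi> yt"
          by (simp add: \<phi>_def \<tau>_def)
        then have "(1 - \<alpha>) * \<tau> powr (- \<alpha>) * (f y - f yt) \<le> l * (t * norm v)" using 1 by linarith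
        then have "\<tau> powr \<alpha> * ((1 - \<alpha>) * \<tau> powr (- \<alpha>) * (f y - f yt)) \<le> \<tau> powr \<alpha> * (l * (t * norm v))"
          by (intro mult_left_mono) auto
        moreover have "\<tau> powr \<alpha> * ((1 - \<alpha>) * \<tau> powr (- \<alpha>) * (f y - f yt)) = (1 - \<alpha>) * (f y - f yt)"
        proof -
          have "\<tau> powr \<alpha> * \<tau> powr (- \<alpha>) = 1" using \<tau> by (simp add: powr_add[symmetric])
          then show ?thesis by (metis (no_types, lifting) mult.assoc mult.left_commute mult_1)
        qed
        ultimately have "(1 - \<alpha>) * (f y - f yt) \<le> \<tau> powr \<alpha> * (l * (t * norm v))" by simp
        also have "\<dots> \<le> (A * norm v) * (l * (t * norm v))"
          using \<tau>v l elim(3) by (intro mult_right_mono) auto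
        also have "\<dots> = (1 - \<alpha>) * (t * (norm v * (A * norm v) / (2 * A)))"
          by (simp add: l_def mult_ac)
        finally have "(1 - \<alpha>) * (f y - f yt) \<le> (1 - \<alpha>) * (t * (norm v * (A * norm v) / (2 * A)))" .
        then have "f y - f yt \<le> t * (norm v * (A * norm v) / (2 * A))" using \<alpha> by simp
        then show ?case using elim(3) by (simp add: yt_def pos_divide_le_eq mult.commute)
      qed
      then have "(norm v)\<^sup>2 \<le> norm v * (A * norm v) / (2 * A)"
        using lim by (intro tendsto_upperbound) auto
      moreover have "norm v * norm v > 0" using v0 by simp
      ultimately show False using V(3) by (simp add: power2_eq_square)
    qed
    then have "y \<in> \<Omega>" by (simp add: \<Omega>_def)
    then have "infdist x \<Omega> \<le> dist x y" by (rule infdist_le)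
    also have "\<dots> \<le> (1 / l) * \<phi> x" using lx l by (simp add: dist_norm norm_minus_commute field_simps)
    finally show ?thesis .
  qed
  moreover have "1 / l > 0" using l by simp
  ultimately show ?thesis unfolding \<Omega>_def \<phi>_def by blast
qed

end

section \<open>Lojasiewicz exponents of the parametrised function\<close>

context hadamard_sosp
begin

lemma eventually_reduced_in:
  assumes "open N" "s \<in> N"
  shows "\<forall>\<^sub>F z in nhds zs. reduced z \<in> N"
proof -
  have "open (reduced -` N)" by (intro open_vimage assms(1) continuous_reduced)
  then show ?thesis using assms(2) reduced_zs unfolding eventually_nhds by (intro exI[of _ "reduced -` N"]) auto
qed

text \<open>At indices with \<open>s $ i = 0\<close> strict complementarity makes
  \<open>subgr\<close> vanish identically, and at the others it is directly bounded by the
  gradient.\<close>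

lemma Lojasiewicz_F_strict:
  assumes strict: "\<And>i. s $ i = 0 \<Longrightarrow> \<bar>u s $ i\<bar> < \<mu>" and KL: "KL_exponent f s \<alpha>" and \<alpha>: "0 < \<alpha>" "\<alpha> < 1"
  shows "\<exists>C>0. \<forall>\<^sub>F z in nhds zs. 0 \<le> F z - F zs \<longrightarrow> (F z - F zs) powr (max \<alpha> (1/2)) \<le> C * norm (gradF z)"
proof -
  obtain B where B: "B > 0" "\<forall>\<^sub>F z in nhds zs. norm (gradF z) \<le> 1 \<and>
     F z - f s \<le> f (reduced z) - f s + B * (norm (gradF z))\<^sup>2 \<and>
     (\<forall>i. \<bar>subgr z $ i\<bar> * sqrt \<bar>reduced z $ i\<bar> \<le> B * norm (gradF z)) \<and>
     (\<forall>i. s $ i \<noteq> 0 \<longrightarrow> \<bar>subgr z $ i\<bar> \<le> B * norm (gradF z)) \<and>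
     (\<exists>w\<in>convex_subdiff l1_norm (reduced z). subgr z = u (reduced z) + \<mu> *\<^sub>R w)"
    using local_estimates by blast
  obtain N A where N: "open N" "s \<in> N" "A > 0"
    "\<And>x w. x \<in> N \<Longrightarrow> w \<in> convex_subdiff l1_norm x \<Longrightarrow> 0 < f x - f s \<Longrightarrow>
       (f x - f s) powr \<alpha> \<le> A * norm (u x + \<mu> *\<^sub>R w)"
    using KL_exponent_f[OF KL \<alpha>] by blast
  define p where "p = max \<alpha> (1/2)"
  define n where "n = real CARD('n)"
  define A' where "A' = A * (n * B)"
  define C where "C = (2 * B) powr p + 2 powr p * A' powr (p / \<alpha>)"
  have "0 < (2 * B) powr p" using B(1) by simp
  then have C: "C > 0" unfolding C_def by (intro add_pos_nonneg) auto
  have "\<forall>\<^sub>F z in nhds zs. 0 \<le> F z - F zs \<longrightarrow> (F z - F zs) powr p \<le> C * norm (gradF z)"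
    using B(2) eventually_reduced_in[OF N(1,2)]
  proof eventually_elim
    case (elim z)
    define e where "e = norm (gradF z)"
    obtain w where w: "w \<in> convex_subdiff l1_norm (reduced z)" "subgr z = u (reduced z) + \<mu> *\<^sub>R w"
      using elim(1) by blast
    have "\<bar>subgr z $ i\<bar> \<le> B * e" for i
    proof (cases "s $ i = 0")
      case True
      then have "subgr z $ i = 0" using strict[OF True] mu by (auto simp: subgr_def)
      then show ?thesis using B(1) by (simp add: e_def)
    qed (use elim(1) in \<open>simp add: e_def\<close>)
    then have "(\<Sum>i\<in>UNIV. \<bar>subgr z $ i\<bar>) \<le> n * (B * e)"
      using sum_bounded_above[of UNIV "\<lambda>i. \<bar>subgr z $ i\<bar>" "B * e"] by (simp add: n_def)
    then have sg: "norm (subgr z) \<le> n * B * e" using norm_le_l1_cart[of "subgr z"] by simp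
    have \<Delta>: "(f (reduced z) - f s) powr \<alpha> \<le> A' * e" if "f (reduced z) - f s > 0"
    proof -
      have "(f (reduced z) - f s) powr \<alpha> \<le> A * norm (subgr z)"
        using N(4)[OF elim(2) w(1) that] w(2) by simp
      also have "\<dots> \<le> A * (n * B * e)" using sg N(3) by (intro mult_left_mono) auto
      finally show ?thesis by (simp add: A'_def mult_ac)
    qed
    show ?case
    proof
      assume "0 \<le> F z - F zs"
      moreover have "F z - F zs \<le> (f (reduced z) - f s) + B * e\<^sup>2" using elim(1) by (simp add: F_zs e_def)
      moreover have "0 \<le> A'" using N(3) B(1) by (simp add: A'_def n_def)
      moreover have "0 \<le> e" "e \<le> 1" using elim(1) by (auto simp: e_def)
      ultimately show "(F z - F zs) powr p \<le> C * norm (gradF z)"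
        using Lojasiewicz_combine[of \<alpha> p A' B e "F z - F zs" "f (reduced z) - f s"] \<alpha> B(1) \<Delta>
        by (simp add: C_def p_def e_def)
    qed
  qed
  then show ?thesis using C unfolding p_def by blast
qed

text \<open>The coordinate conditions say that \<open>- (u s /\<^sub>R \<mu>)\<close> is a
  subgradient of the l1-norm at \<open>s\<close>, so 0 is a subgradient of the convex function
  \<open>f\<close>.\<close>

lemma s_minimizes:
  assumes "convex_on UNIV h"
  shows "f s \<le> f x"
proof -
  define w where "w = - (u s /\<^sub>R \<mu>)"
  have "\<bar>w $ i\<bar> \<le> 1 \<and> w $ i * s $ i = \<bar>s $ i\<bar>" for i
  proof
    show "\<bar>w $ i\<bar> \<le> 1" using sosp_coordinates(1)[of i] mu by (simp add: w_def field_simps)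
    have si: "s $ i = (fst zs $ i)\<^sup>2 - (snd zs $ i)\<^sup>2" by (simp add: s_def square_diff_nth)
    show "w $ i * s $ i = \<bar>s $ i\<bar>"
      using sosp_coordinates(2,3)[of i] mu unfolding si
      by (cases "u s $ i = - \<mu>"; cases "u s $ i = \<mu>") (auto simp: w_def)
  qed
  then have "w \<in> convex_subdiff l1_norm s" by (simp add: convex_subdiff_l1_norm)
  from convex_f_above_tangent[OF assms this, of x] show ?thesis using mu by (simp add: w_def)
qed

text \<open>The coordinates of \<open>reduced z\<close> are nonnegative where
  \<open>u s $ i = - \<mu>\<close>, nonpositive where it is \<mu>, and 0 elsewhere. Against a point
  of the subdifferential the contribution of \<open>s\<close> cancels and the signs make each
  summand nonpositive. This admits \<open>reduced z\<close> to the regularity condition.\<close>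

lemma reduced_in_normal_cone:
  "reduced z \<in> (+) s ` normal_cone ((*\<^sub>R) \<mu> ` convex_subdiff l1_norm s) (- u s)"
proof -
  have "(reduced z - s) \<bullet> (\<mu> *\<^sub>R w - (- u s)) \<le> 0" if w: "w \<in> convex_subdiff l1_norm s" for w
    unfolding inner_vec_def
  proof (rule sum_nonpos)
    fix i
    have wi: "\<bar>w $ i\<bar> \<le> 1" "w $ i * s $ i = \<bar>s $ i\<bar>" using w by (auto simp: convex_subdiff_l1_norm)
    have si: "s $ i = (if u s $ i = - \<mu> then (fst zs $ i)\<^sup>2 else if u s $ i = \<mu> then - (snd zs $ i)\<^sup>2 else 0)"
      using arg_cong[OF reduced_zs, of "\<lambda>x. x $ i"] by (simp add: reduced_def)
    consider "u s $ i = - \<mu>" | "u s $ i = \<mu>" "u s $ i \<noteq> - \<mu>" | "u s $ i \<noteq> - \<mu>" "u s $ i \<noteq> \<mu>" by blast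
    then have "(reduced z $ i - s $ i) * (\<mu> * w $ i + u s $ i) \<le> 0"
    proof cases
      case 1
      then have "(reduced z $ i - s $ i) * (\<mu> * w $ i + u s $ i)
          = (reduced z $ i) * (\<mu> * (w $ i - 1)) - \<mu> * (w $ i * s $ i - s $ i)" by (simp add: algebra_simps)
      also have "w $ i * s $ i - s $ i = 0" using wi(2) si 1 by simp
      also have "(reduced z $ i) * (\<mu> * (w $ i - 1)) \<le> 0"
        using 1 wi(1) mu by (intro mult_nonneg_nonpos mult_nonneg_nonpos) (auto simp: reduced_def)
      finally show ?thesis by simp
    next
      case 2
      then have "(reduced z $ i - s $ i) * (\<mu> * w $ i + u s $ i)
          = (reduced z $ i) * (\<mu> * (w $ i + 1)) - \<mu> * (w $ i * s $ i + s $ i)" by (simp add: algebra_simps)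
      also have "w $ i * s $ i + s $ i = 0" using wi(2) si 2 by simp
      also have "(reduced z $ i) * (\<mu> * (w $ i + 1)) \<le> 0"
        using 2 wi(1) mu by (intro mult_nonpos_nonneg mult_nonneg_nonneg) (auto simp: reduced_def)
      finally show ?thesis by simp
    next
      case 3
      then show ?thesis using si by (simp add: reduced_def)
    qed
    then show "(reduced z - s) $ i \<bullet> (\<mu> *\<^sub>R w - (- u s)) $ i \<le> 0" by simp
  qed
  then have "reduced z - s \<in> normal_cone ((*\<^sub>R) \<mu> ` convex_subdiff l1_norm s) (- u s)"
    by (auto simp: normal_cone_def)
  then show ?thesis by (rule rev_image_eqI) simp
qed

text \<open>At degenerate indices the difference is at most
  \<open>2 * \<bar>reduced z $ i\<bar>\<close> and at most the distance d, hence at most a multiple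
  of the geometric mean; its factor sqrt |reduced z_i| is what \<open>subgr\<close> can absorb. The
  price is sqrt d in place of d. At indices with \<open>s $ i \<noteq> 0\<close>, d \<le> sqrt d as
  d \<le> 1.\<close>

lemma subgradient_pairing:
  assumes e: "0 \<le> e" and B: "B \<ge> 0"
    and d1: "\<And>i. \<bar>subgr z $ i\<bar> * sqrt \<bar>reduced z $ i\<bar> \<le> B * e"
    and d2: "\<And>i. s $ i \<noteq> 0 \<Longrightarrow> \<bar>subgr z $ i\<bar> \<le> B * e"
    and x: "\<And>i. s $ i = 0 \<Longrightarrow> u s $ i \<in> {- \<mu>, \<mu>} \<Longrightarrow> \<bar>x $ i\<bar> \<le> \<bar>reduced z $ i\<bar>"
    and d: "norm (reduced z - x) \<le> 1"
  shows "subgr z \<bullet> (reduced z - x) \<le> real CARD('n) * (2 * B * e * sqrt (norm (reduced z - x)))"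
proof -
  define d where "d = norm (reduced z - x)"
  have d: "0 \<le> d" "d \<le> 1" using assms(6) by (auto simp: d_def)
  have "\<bar>subgr z $ i * (reduced z $ i - x $ i)\<bar> \<le> 2 * B * e * sqrt d" for i
  proof -
    have comp: "\<bar>reduced z $ i - x $ i\<bar> \<le> d"
      using component_le_norm_cart[of "reduced z - x" i] by (simp add: d_def)
    consider "s $ i \<noteq> 0" | "s $ i = 0" "u s $ i \<in> {- \<mu>, \<mu>}" | "u s $ i \<notin> {- \<mu>, \<mu>}" by blast
    then show ?thesis
    proof cases
      case 1
      have "d * d \<le> 1 * d" using d by (intro mult_right_mono) auto
      then have "d \<le> sqrt d" using d by (intro real_le_rsqrt) (simp add: power2_eq_square)
      then have "\<bar>reduced z $ i - x $ i\<bar> \<le> sqrt d" using comp by linarith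
      then have "\<bar>subgr z $ i\<bar> * \<bar>reduced z $ i - x $ i\<bar> \<le> B * e * sqrt d"
        using d2[OF 1] e B by (intro mult_mono) auto
      moreover have "0 \<le> B * e * sqrt d" using e B d by simp
      ultimately show ?thesis unfolding abs_mult by linarith
    next
      case 2
      define y where "y = \<bar>reduced z $ i - x $ i\<bar>"
      have "y \<le> 2 * \<bar>reduced z $ i\<bar>" using x[OF 2] by (simp add: y_def)
      then have "y * y \<le> 2 * \<bar>reduced z $ i\<bar> * d" using comp by (intro mult_mono) (auto simp: y_def)
      also have "\<dots> \<le> 4 * \<bar>reduced z $ i\<bar> * d" using d by (intro mult_right_mono) auto
      finally have "sqrt (y * y) \<le> sqrt (4 * \<bar>reduced z $ i\<bar> * d)" by (rule real_sqrt_le_mono)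
      then have y: "y \<le> 2 * sqrt \<bar>reduced z $ i\<bar> * sqrt d" by (simp add: real_sqrt_mult y_def)
      have "\<bar>subgr z $ i\<bar> * y \<le> \<bar>subgr z $ i\<bar> * (2 * sqrt \<bar>reduced z $ i\<bar> * sqrt d)"
        using y by (intro mult_left_mono) auto
      also have "\<dots> = 2 * (\<bar>subgr z $ i\<bar> * sqrt \<bar>reduced z $ i\<bar>) * sqrt d" by simp
      also have "\<dots> \<le> 2 * (B * e) * sqrt d" using d1[of i] d by (intro mult_right_mono mult_left_mono) auto
      finally show ?thesis by (simp add: abs_mult y_def)
    next
      case 3
      then have "subgr z $ i = 0" by (simp add: subgr_def)
      then show ?thesis using e B d by simp
    qed
  qed
  then have "subgr z $ i * (reduced z $ i - x $ i) \<le> 2 * B * e * sqrt d" for i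
    by (meson abs_le_D1)
  then show ?thesis
    using sum_bounded_above[of UNIV "\<lambda>i. subgr z $ i * (reduced z $ i - x $ i)" "2 * B * e * sqrt d"]
    by (simp add: inner_vec_def d_def)
qed

text \<open>With \<open>\<beta> = 1 - \<gamma> (1 - \<alpha>)\<close> the exponent is \<open>p = (1 + \<beta>) / 2\<close>. The regularity assumption is applied
  with \<open>\<rho> i = \<bar>reduced z $ i\<bar>\<close>: this keeps the point of \<open>\<Omega>\<close> within \<open>2 \<bar>reduced z $ i\<bar>\<close> in the coordinates of \<open>J\<close>,
  where only the product of \<open>subgr z $ i\<close> and the square root of \<open>reduced z $ i\<close> is controlled.\<close>

lemma Lojasiewicz_F_convex:
  assumes conv: "convex_on UNIV h" and KL: "KL_exponent f s \<alpha>" and \<alpha>: "0 < \<alpha>" "\<alpha> < 1"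
    and W: "open W" "s \<in> W" and c: "c > 0" and \<gamma>: "0 < \<gamma>" "\<gamma> \<le> 1"
  defines "J \<equiv> {i. s $ i = 0 \<and> u s $ i \<in> {- \<mu>, \<mu>}}"
  defines "S \<equiv> \<lambda>\<rho> :: 'n \<Rightarrow> real. {x :: real ^ 'n. \<forall>i\<in>J. \<bar>x $ i - s $ i\<bar> \<le> \<rho> i}"
  defines "\<Omega> \<equiv> {x. f x = f s}"
  defines "p \<equiv> 1 - \<gamma> * (1 - \<alpha>) / 2"
  assumes reg: "\<And>\<rho> x. (\<forall>i\<in>J. 0 \<le> \<rho> i) \<Longrightarrow>
      x \<in> W \<inter> (+) s ` normal_cone ((*\<^sub>R) \<mu> ` convex_subdiff l1_norm s) (- u s) \<Longrightarrow>
      infdist x (\<Omega> \<inter> S \<rho>) \<le> c * (max (infdist x \<Omega>) (infdist x (S \<rho>))) powr \<gamma>"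
  shows "\<exists>C>0. \<forall>\<^sub>F z in nhds zs. 0 \<le> F z - F zs \<longrightarrow> (F z - F zs) powr p \<le> C * norm (gradF z)"
proof -
  obtain B where B: "B > 0" "\<forall>\<^sub>F z in nhds zs. norm (gradF z) \<le> 1 \<and>
     F z - f s \<le> f (reduced z) - f s + B * (norm (gradF z))\<^sup>2 \<and>
     (\<forall>i. \<bar>subgr z $ i\<bar> * sqrt \<bar>reduced z $ i\<bar> \<le> B * norm (gradF z)) \<and>
     (\<forall>i. s $ i \<noteq> 0 \<longrightarrow> \<bar>subgr z $ i\<bar> \<le> B * norm (gradF z)) \<and>
     (\<exists>w\<in>convex_subdiff l1_norm (reduced z). subgr z = u (reduced z) + \<mu> *\<^sub>R w)"
    using local_estimates by blast
  obtain N E where N: "open N" "s \<in> N" "E > 0"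
    "\<And>x. x \<in> N \<Longrightarrow> infdist x \<Omega> \<le> E * (f x - f s) powr (1 - \<alpha>)"
    unfolding \<Omega>_def using KL_error_bound[OF KL \<alpha> s_minimizes[OF conv]] by blast
  define n where "n = real CARD('n)"
  define g1 where "g1 = \<gamma> * (1 - \<alpha>)"
  have "\<gamma> * (1 - \<alpha>) \<le> 1 * (1 - \<alpha>)" using \<gamma> \<alpha> by (intro mult_right_mono) auto
  then have "g1 < 1" unfolding g1_def by (rule le_less_trans) (use \<alpha> in simp)
  moreover have "0 < g1" unfolding g1_def using \<gamma> \<alpha> by simp
  ultimately have g1: "0 < g1" "g1 < 1" by blast+
  have p: "p = 1 - g1 / 2" "1/2 \<le> p" "0 < p" using g1 by (simp_all add: p_def g1_def)
  define A where "A = n * (2 * B) * sqrt (c * E powr \<gamma>)"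
  have A: "0 \<le> A" using B(1) c by (simp add: A_def n_def)
  define C where "C = (2 * B) powr p + 2 powr p * A powr (p / p)"
  have "0 < (2 * B) powr p" using B(1) by simp
  then have C: "C > 0" unfolding C_def by (intro add_pos_nonneg) auto
  have "\<forall>\<^sub>F z in nhds zs. 0 \<le> F z - F zs \<longrightarrow> (F z - F zs) powr p \<le> C * norm (gradF z)"
    using B(2) eventually_reduced_in[OF N(1,2)] eventually_reduced_in[OF W]
      eventually_reduced_in[of "ball s 1", simplified]
  proof eventually_elim
    case (elim z)
    define e where "e = norm (gradF z)"
    obtain w where w: "w \<in> convex_subdiff l1_norm (reduced z)" "subgr z = u (reduced z) + \<mu> *\<^sub>R w"
      using elim(1) by blast
    define \<Delta> where "\<Delta> = f (reduced z) - f s"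
    have \<Delta>: "\<Delta> powr p \<le> A * e" if pos: "\<Delta> > 0"
    proof -
      define \<rho> where "\<rho> i = \<bar>reduced z $ i\<bar>" for i
      have "closed \<Omega>" unfolding \<Omega>_def by (intro closed_Collect_eq continuous_f continuous_on_const)
      moreover have "closed (\<Inter>i\<in>J. {x. \<bar>x $ i - s $ i\<bar> \<le> \<rho> i})"
        by (intro closed_INT ballI closed_Collect_le continuous_intros)
      then have "closed (S \<rho>)" unfolding S_def by (simp add: INTER_eq)
      ultimately have "closed (\<Omega> \<inter> S \<rho>)" by (rule closed_Int)
      \<comment> \<open>The point \<open>s\<close> makes the set nonempty, so the distance is
        attained; it also bounds that distance by 1, as \<open>reduced z\<close> lies in the unit
        ball around \<open>s\<close>.\<close>
      moreover have s\<Omega>: "s \<in> \<Omega> \<inter> S \<rho>" by (simp add: \<Omega>_def S_def \<rho>_def)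
      ultimately obtain x where x: "x \<in> \<Omega> \<inter> S \<rho>" "infdist (reduced z) (\<Omega> \<inter> S \<rho>) = dist (reduced z) x"
        using infdist_attains_inf by blast
      define d where "d = norm (reduced z - x)"
      have dinf: "d = infdist (reduced z) (\<Omega> \<inter> S \<rho>)" using x(2) by (simp add: d_def dist_norm)
      have "d \<le> dist (reduced z) s" unfolding dinf by (rule infdist_le[OF s\<Omega>])
      then have d1: "d \<le> 1" using elim(4) by (simp add: dist_commute)
      have "reduced z \<in> S \<rho>" by (simp add: S_def \<rho>_def J_def)
      then have "infdist (reduced z) (S \<rho>) = 0" by simp
      moreover have "infdist (reduced z) \<Omega> \<ge> 0" by (rule infdist_nonneg)
      ultimately have "max (infdist (reduced z) \<Omega>) (infdist (reduced z) (S \<rho>)) = infdist (reduced z) \<Omega>" by simp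
      then have "d \<le> c * infdist (reduced z) \<Omega> powr \<gamma>"
        using reg[of \<rho> "reduced z"] reduced_in_normal_cone[of z] elim(3) unfolding dinf by (simp add: \<rho>_def)
      also have "\<dots> \<le> c * (E * \<Delta> powr (1 - \<alpha>)) powr \<gamma>"
        using N(4)[OF elim(2)] c \<gamma> infdist_nonneg unfolding \<Delta>_def by (intro mult_left_mono powr_mono2) auto
      also have "\<dots> = c * E powr \<gamma> * \<Delta> powr g1" by (simp add: powr_mult powr_powr g1_def mult_ac)
      finally have "sqrt d \<le> sqrt (c * E powr \<gamma> * \<Delta> powr g1)" by (rule real_sqrt_le_mono)
      also have "\<dots> = sqrt (c * E powr \<gamma>) * \<Delta> powr (g1 / 2)"
        using pos by (simp add: real_sqrt_mult powr_half_sqrt[symmetric] powr_powr)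
      finally have sd: "sqrt d \<le> sqrt (c * E powr \<gamma>) * \<Delta> powr (g1 / 2)" .
      have "f (reduced z) + subgr z \<bullet> (x - reduced z) \<le> f x"
        using convex_f_above_tangent[OF conv w(1), of x] w(2) by simp
      moreover have "f x = f s" using x(1) by (simp add: \<Omega>_def)
      ultimately have "\<Delta> \<le> subgr z \<bullet> (reduced z - x)" by (simp add: \<Delta>_def inner_diff_right)
      also have "\<dots> \<le> n * (2 * B * e * sqrt d)"
        unfolding n_def d_def
      proof (rule subgradient_pairing)
        show "\<bar>x $ i\<bar> \<le> \<bar>reduced z $ i\<bar>" if "s $ i = 0" "u s $ i \<in> {- \<mu>, \<mu>}" for i
          using x(1) that by (auto simp: S_def J_def \<rho>_def)
      qed (use elim(1) B(1) d1 in \<open>auto simp: e_def d_def\<close>)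
      also have "\<dots> \<le> n * (2 * B * e * (sqrt (c * E powr \<gamma>) * \<Delta> powr (g1 / 2)))"
        using sd B(1) by (intro mult_left_mono) (auto simp: n_def e_def)
      also have "\<dots> = A * e * \<Delta> powr (g1 / 2)" by (simp add: A_def mult_ac)
      \<comment> \<open>Dividing by the power on the right leaves the exponent 1 - g1/2 = p on the
        left.\<close>
      finally have "\<Delta> * \<Delta> powr (- (g1 / 2)) \<le> A * e * \<Delta> powr (g1 / 2) * \<Delta> powr (- (g1 / 2))"
        by (intro mult_right_mono) auto
      moreover have "\<Delta> powr (g1 / 2) * \<Delta> powr (- (g1 / 2)) = 1" using pos by (simp add: powr_add[symmetric])
      moreover have "\<Delta> * \<Delta> powr (- (g1 / 2)) = \<Delta> powr p"
        using pos powr_add[of \<Delta> 1 "- (g1 / 2)"] by (simp add: p)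
      ultimately show ?thesis by (simp add: mult.assoc)
    qed
    show ?case
    proof
      assume "0 \<le> F z - F zs"
      moreover have "F z - F zs \<le> \<Delta> + B * e\<^sup>2" using elim(1) by (simp add: F_zs e_def \<Delta>_def)
      moreover have "0 \<le> e" "e \<le> 1" using elim(1) by (auto simp: e_def)
      ultimately show "(F z - F zs) powr p \<le> C * norm (gradF z)"
        using Lojasiewicz_combine[of p p A B e "F z - F zs" \<Delta>] p A B(1) \<Delta>
        by (simp only: C_def e_def order_refl less_imp_le)
    qed
  qed
  then show ?thesis using C by blast
qed

lemma gd_rate:
  assumes \<theta>: "\<theta> > 0" and p: "1/2 \<le> p" "p < 1" and C: "C > 0"
    and loj: "\<forall>\<^sub>F z in nhds zs. 0 \<le> F z - F zs \<longrightarrow> (F z - F zs) powr p \<le> C * norm (gradF z)"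
    and lim: "z \<longlonglongrightarrow> zs"
    and step: "\<And>k. k \<ge> K \<Longrightarrow> z (Suc k) = gd_map F \<theta> (z k) \<and> accepted F (z k) \<theta>"
  shows "1/2 < p \<Longrightarrow> (\<lambda>k. norm (z k - zs)) \<in> O(\<lambda>k. real k powr (- ((1 - p) / (2 * p - 1))))"
    and "p = 1/2 \<Longrightarrow> \<exists>q. 0 < q \<and> q < 1 \<and> (\<lambda>k. norm (z k - zs)) \<in> O(\<lambda>k. q ^ k)"
proof -
  have "\<forall>\<^sub>F k in sequentially. 0 \<le> F (z k) - F zs \<longrightarrow> (F (z k) - F zs) powr p \<le> C * norm (gradF (z k))"
    using lim loj unfolding filterlim_iff by blast
  then obtain K1 where K1: "\<And>k. k \<ge> K1 \<Longrightarrow> 0 \<le> F (z k) - F zs \<Longrightarrow> (F (z k) - F zs) powr p \<le> C * norm (gradF (z k))"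
    unfolding eventually_sequentially by blast
  define M where "M = max K K1"
  define z' where "z' k = z (k + M)" for k
  have step': "z' (Suc k) = gd_map F \<theta> (z' k)" "accepted F (z' k) \<theta>" for k
    using step[of "k + M"] by (auto simp: z'_def M_def)
  have dec: "F (z' (Suc k)) \<le> F (z' k) - \<theta>\<^sup>2 / 2 * (norm (gradF (z' k)))\<^sup>2" for k
    using step'[of k] by (simp add: accepted_def F.grad_eq)
  have "isCont F zs" using F.cont_F[of UNIV] by (simp add: continuous_on_eq_continuous_at del: split_paired_All)
  moreover have lim': "z' \<longlonglongrightarrow> zs" unfolding z'_def by (rule LIMSEQ_ignore_initial_segment[OF lim])
  ultimately have "(\<lambda>k. F (z' k)) \<longlonglongrightarrow> F zs" by (rule isCont_tendsto_compose)
  moreover have "decseq (\<lambda>k. F (z' k))"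
  proof (rule decseq_SucI)
    fix k
    have "0 \<le> \<theta>\<^sup>2 / 2 * (norm (gradF (z' k)))\<^sup>2" by simp
    then show "F (z' (Suc k)) \<le> F (z' k)" using dec[of k] by linarith
  qed
  \<comment> \<open>The values decrease to \<open>F zs\<close>, which supplies the premise of the
    Lojasiewicz inequality along the tail.\<close>
  ultimately have ge: "F zs \<le> F (z' k)" for k using decseq_ge by blast
  \<comment> \<open>Before index \<open>M\<close> the sign of the gap is unknown; the default 0
    keeps \<open>r\<close> nonnegative everywhere, and the other conditions are asked only from
    \<open>M\<close> on.\<close>
  define r where "r k = (if k \<ge> M then F (z k) - F zs else 0)" for k
  have r: "r k \<ge> 0" for k using ge[of "k - M"] by (cases "k \<ge> M") (simp_all add: r_def z'_def)
  have h1: "r (Suc k) \<le> r k - \<theta>\<^sup>2 / 2 * (norm (gradF (z k)))\<^sup>2" if "k \<ge> M" for k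
    using dec[of "k - M"] that by (simp add: r_def z'_def Suc_diff_le)
  have h2: "r k powr p \<le> C * norm (gradF (z k))" if "k \<ge> M" for k
    using K1[of k] r[of k] that by (simp add: r_def M_def)
  have h3: "norm (z (Suc k) - z k) \<le> \<theta> * norm (gradF (z k))" if "k \<ge> M" for k
    using step[of k] that \<theta> by (simp add: M_def gd_map_def F.grad_eq)
  have \<theta>2: "\<theta>\<^sup>2 / 2 > 0" using \<theta> by simp
  note rate = Lojasiewicz_descent_rate[OF p \<theta>2 C \<theta> norm_ge_zero r h1 h2 h3 lim]
  show "1/2 < p \<Longrightarrow> (\<lambda>k. norm (z k - zs)) \<in> O(\<lambda>k. real k powr (- ((1 - p) / (2 * p - 1))))"
    by (rule rate(1))
  show "p = 1/2 \<Longrightarrow> \<exists>q. 0 < q \<and> q < 1 \<and> (\<lambda>k. norm (z k - zs)) \<in> O(\<lambda>k. q ^ k)"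
    by (rule rate(2))
qed

end

text \<open>For nonnegative \<rho> every set whose distance is taken in (ii) contains
  \<open>s\<close>, so \<open>infdist\<close> is the genuine distance there.\<close>

theorem theorem4p4:
  fixes h f :: "real ^ 'n \<Rightarrow> real"
    and F :: "(real ^ 'n) \<times> (real ^ 'n) \<Rightarrow> real"
    and \<mu> \<theta>\<^sub>0 \<kappa> :: real
    and \<Gamma> :: "real set"
  assumes h: "C2_fun h"
    and mu: "\<mu> > 0"
    and f: "\<And>x. f x = h x + \<mu> * l1_norm x"
    and F: "\<And>a b. F (a, b) = h (vsq a - vsq b) + \<mu> * (\<Sum>i\<in>UNIV. (a $ i)\<^sup>2 + (b $ i)\<^sup>2)"
    and theta0: "\<theta>\<^sub>0 > 0"
    and kappa: "0 < \<kappa>" "\<kappa> < 1"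
    and Gamma: "\<Gamma> = {\<kappa> ^ k * \<theta>\<^sub>0 | k. k \<in> (UNIV :: nat set)}"
    and A1: "\<forall>\<theta>\<in>\<Gamma>. \<exists>U. open U \<and> - U \<in> null_sets lebesgue \<and>
               (\<forall>z\<in>U. jacobian_det (gd_map F \<theta>) z \<noteq> 0)"
    and A2: "level_bounded F"
    and A3: "\<forall>z. stationary F z \<longrightarrow> KL_property F z"
  shows "\<exists>V. - V \<in> null_sets lebesgue \<and> (\<forall>a\<^sub>0 b\<^sub>0. (a\<^sub>0, b\<^sub>0) \<in> V \<longrightarrow>
    (\<exists>a b. gd_iterate F \<theta>\<^sub>0 \<kappa> (a\<^sub>0, b\<^sub>0) \<longlonglongrightarrow> (a, b) \<and> second_order_stationary F (a, b) \<and>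
      (let err = (\<lambda>k. norm (gd_iterate F \<theta>\<^sub>0 \<kappa> (a\<^sub>0, b\<^sub>0) k - (a, b)));
           s = vsq a - vsq b;
           D = (*\<^sub>R) \<mu> ` convex_subdiff l1_norm s;
           \<Omega> = {x. f x = f s};
           J\<^sub>3 = {i. s $ i = 0 \<and> grad h s $ i \<in> {- \<mu>, \<mu>}};
           S = (\<lambda>\<rho> :: 'n \<Rightarrow> real. {x :: real ^ 'n. \<forall>i\<in>J\<^sub>3. \<bar>x $ i - s $ i\<bar> \<le> \<rho> i});
           K = normal_cone D (- grad h s)
       in \<forall>\<alpha>. 0 < \<alpha> \<and> \<alpha> < 1 \<and> KL_exponent f s \<alpha> \<longrightarrow>
         (- grad h s \<in> rel_interior D \<longrightarrow>
            (1/2 < \<alpha> \<longrightarrow> err \<in> O(\<lambda>k. real k powr (- ((1 - \<alpha>) / (2 * \<alpha> - 1))))) \<and>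
            (\<alpha> \<le> 1/2 \<longrightarrow> (\<exists>c. 0 < c \<and> c < 1 \<and> err \<in> O(\<lambda>k. c ^ k)))) \<and>
         (\<forall>W c \<gamma> \<beta>. convex_on UNIV h \<and> open W \<and> s \<in> W \<and> c > 0 \<and> 0 < \<gamma> \<and> \<gamma> \<le> 1 \<and>
            (\<forall>\<rho>. (\<forall>i\<in>J\<^sub>3. 0 \<le> \<rho> i) \<longrightarrow>
               (\<forall>x \<in> W \<inter> (+) s ` K.
                  infdist x (\<Omega> \<inter> S \<rho>) \<le> c * (max (infdist x \<Omega>) (infdist x (S \<rho>))) powr \<gamma>)) \<and>
            \<beta> = 1 - \<gamma> * (1 - \<alpha>) \<longrightarrow>
            err \<in> O(\<lambda>k. real k powr (- ((1 - \<beta>) / (2 * \<beta>))))))))"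
proof -
  obtain u U where "C2_pair h u U"
    using h unfolding C2_fun_def C2_pair_def by blast
  then interpret had: hadamard h u U \<mu> f F
    using mu f F by (simp add: hadamard_def hadamard_axioms_def)
  have "\<kappa> ^ m * \<theta>\<^sub>0 \<in> \<Gamma>" for m unfolding Gamma by blast
  with A1 have "\<exists>V. open V \<and> - V \<in> null_sets lebesgue \<and>
      (\<forall>z\<in>V. jacobian_det (gd_map F (\<kappa> ^ m * \<theta>\<^sub>0)) z \<noteq> 0)" for m by blast
  from had.gd_converges_almost_everywhere[OF theta0 kappa this A2] A3
  obtain V where V: "- V \<in> null_sets lebesgue"
    "\<And>z\<^sub>0. z\<^sub>0 \<in> V \<Longrightarrow> \<exists>x m K. gd_iterate F \<theta>\<^sub>0 \<kappa> z\<^sub>0 \<longlonglongrightarrow> x \<and> second_order_stationary F x \<and>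
      (\<forall>k\<ge>K. gd_iterate F \<theta>\<^sub>0 \<kappa> z\<^sub>0 (Suc k) = gd_map F (\<kappa> ^ m * \<theta>\<^sub>0) (gd_iterate F \<theta>\<^sub>0 \<kappa> z\<^sub>0 k) \<and>
        accepted F (gd_iterate F \<theta>\<^sub>0 \<kappa> z\<^sub>0 k) (\<kappa> ^ m * \<theta>\<^sub>0))"
    by metis
  show ?thesis
  proof (rule exI[of _ V], intro conjI allI impI)
    show "- V \<in> null_sets lebesgue" by (rule V(1))
    fix a\<^sub>0 b\<^sub>0 assume "(a\<^sub>0, b\<^sub>0) \<in> V"
    define z where "z = gd_iterate F \<theta>\<^sub>0 \<kappa> (a\<^sub>0, b\<^sub>0)"
    obtain a b m K where lim: "z \<longlonglongrightarrow> (a, b)" and sosp: "second_order_stationary F (a, b)"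
      and step: "\<And>k. k \<ge> K \<Longrightarrow> z (Suc k) = gd_map F (\<kappa> ^ m * \<theta>\<^sub>0) (z k) \<and> accepted F (z k) (\<kappa> ^ m * \<theta>\<^sub>0)"
      using V(2)[OF \<open>(a\<^sub>0, b\<^sub>0) \<in> V\<close>] unfolding z_def by (metis surj_pair)
    interpret S: hadamard_sosp h u U \<mu> f F "(a, b)"
      by unfold_locales (rule sosp)
    have sd: "vsq a - vsq b = S.s" by (simp add: S.s_def square_diff_def)
    have \<theta>: "\<kappa> ^ m * \<theta>\<^sub>0 > 0" using kappa theta0 by simp
    have rate: "1/2 < p \<Longrightarrow> (\<lambda>k. norm (z k - (a, b))) \<in> O(\<lambda>k. real k powr (- ((1 - p) / (2 * p - 1))))"
      "p = 1/2 \<Longrightarrow> \<exists>q. 0 < q \<and> q < 1 \<and> (\<lambda>k. norm (z k - (a, b))) \<in> O(\<lambda>k. q ^ k)"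
      if p: "1/2 \<le> p" "p < 1"
        and loj: "\<exists>C>0. \<forall>\<^sub>F z in nhds (a, b). 0 \<le> F z - F (a, b) \<longrightarrow> (F z - F (a, b)) powr p \<le> C * norm (had.gradF z)"
      for p
    proof -
      obtain C where C: "C > 0"
        "\<forall>\<^sub>F z in nhds (a, b). 0 \<le> F z - F (a, b) \<longrightarrow> (F z - F (a, b)) powr p \<le> C * norm (had.gradF z)"
        using loj by blast
      note r = S.gd_rate[OF \<theta> p C lim step]
      show "1/2 < p \<Longrightarrow> (\<lambda>k. norm (z k - (a, b))) \<in> O(\<lambda>k. real k powr (- ((1 - p) / (2 * p - 1))))"
        by (rule r(1))
      show "p = 1/2 \<Longrightarrow> \<exists>q. 0 < q \<and> q < 1 \<and> (\<lambda>k. norm (z k - (a, b))) \<in> O(\<lambda>k. q ^ k)"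
        by (rule r(2))
    qed
    have strict: "\<exists>C>0. \<forall>\<^sub>F z in nhds (a, b). 0 \<le> F z - F (a, b) \<longrightarrow>
        (F z - F (a, b)) powr (max \<alpha> (1/2)) \<le> C * norm (had.gradF z)"
      if "0 < \<alpha> \<and> \<alpha> < 1 \<and> KL_exponent f S.s \<alpha>"
        and ri: "- u S.s \<in> rel_interior ((*\<^sub>R) \<mu> ` convex_subdiff l1_norm S.s)" for \<alpha>
    proof (rule S.Lojasiewicz_F_strict)
      show "\<bar>u S.s $ i\<bar> < \<mu>" if "S.s $ i = 0" for i
        using rel_interior_subdiff_l1_norm[OF mu ri that] by simp
    qed (use that(1) in auto)
    show "\<exists>a b. gd_iterate F \<theta>\<^sub>0 \<kappa> (a\<^sub>0, b\<^sub>0) \<longlonglongrightarrow> (a, b) \<and> second_order_stationary F (a, b) \<and>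
      (let err = (\<lambda>k. norm (gd_iterate F \<theta>\<^sub>0 \<kappa> (a\<^sub>0, b\<^sub>0) k - (a, b)));
           s = vsq a - vsq b;
           D = (*\<^sub>R) \<mu> ` convex_subdiff l1_norm s;
           \<Omega> = {x. f x = f s};
           J\<^sub>3 = {i. s $ i = 0 \<and> grad h s $ i \<in> {- \<mu>, \<mu>}};
           S = (\<lambda>\<rho> :: 'n \<Rightarrow> real. {x :: real ^ 'n. \<forall>i\<in>J\<^sub>3. \<bar>x $ i - s $ i\<bar> \<le> \<rho> i});
           K = normal_cone D (- grad h s)
       in \<forall>\<alpha>. 0 < \<alpha> \<and> \<alpha> < 1 \<and> KL_exponent f s \<alpha> \<longrightarrow>
         (- grad h s \<in> rel_interior D \<longrightarrow>
            (1/2 < \<alpha> \<longrightarrow> err \<in> O(\<lambda>k. real k powr (- ((1 - \<alpha>) / (2 * \<alpha> - 1))))) \<and>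
            (\<alpha> \<le> 1/2 \<longrightarrow> (\<exists>c. 0 < c \<and> c < 1 \<and> err \<in> O(\<lambda>k. c ^ k)))) \<and>
         (\<forall>W c \<gamma> \<beta>. convex_on UNIV h \<and> open W \<and> s \<in> W \<and> c > 0 \<and> 0 < \<gamma> \<and> \<gamma> \<le> 1 \<and>
            (\<forall>\<rho>. (\<forall>i\<in>J\<^sub>3. 0 \<le> \<rho> i) \<longrightarrow>
               (\<forall>x \<in> W \<inter> (+) s ` K.
                  infdist x (\<Omega> \<inter> S \<rho>) \<le> c * (max (infdist x \<Omega>) (infdist x (S \<rho>))) powr \<gamma>)) \<and>
            \<beta> = 1 - \<gamma> * (1 - \<alpha>) \<longrightarrow>
            err \<in> O(\<lambda>k. real k powr (- ((1 - \<beta>) / (2 * \<beta>))))))"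
      unfolding z_def[symmetric] Let_def
    proof (rule exI[of _ a], rule exI[of _ b], unfold sd had.h.grad_eq, intro conjI allI impI)
      show "z \<longlonglongrightarrow> (a, b)" by (rule lim)
      show "second_order_stationary F (a, b)" by (rule sosp)
    next
      fix \<alpha> :: real
      assume \<alpha>: "0 < \<alpha> \<and> \<alpha> < 1 \<and> KL_exponent f S.s \<alpha>"
        and ri: "- u S.s \<in> rel_interior ((*\<^sub>R) \<mu> ` convex_subdiff l1_norm S.s)"
      show "(\<lambda>k. norm (z k - (a, b))) \<in> O(\<lambda>k. real k powr (- ((1 - \<alpha>) / (2 * \<alpha> - 1))))" if "1/2 < \<alpha>"
        using rate(1)[OF _ _ strict[OF \<alpha> ri]] that \<alpha> by (simp add: max_def)
      show "\<exists>c. 0 < c \<and> c < 1 \<and> (\<lambda>k. norm (z k - (a, b))) \<in> O(\<lambda>k. c ^ k)" if "\<alpha> \<le> 1/2"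
        using rate(2)[OF _ _ strict[OF \<alpha> ri]] that \<alpha> by (simp add: max_def)
    next
      fix \<alpha> \<gamma> \<beta> c :: real and W
      assume \<alpha>: "0 < \<alpha> \<and> \<alpha> < 1 \<and> KL_exponent f S.s \<alpha>"
        and A: "convex_on UNIV h \<and> open W \<and> S.s \<in> W \<and> c > 0 \<and> 0 < \<gamma> \<and> \<gamma> \<le> 1 \<and>
            (\<forall>\<rho>. (\<forall>i\<in>{i. S.s $ i = 0 \<and> u S.s $ i \<in> {- \<mu>, \<mu>}}. 0 \<le> \<rho> i) \<longrightarrow>
               (\<forall>x \<in> W \<inter> (+) S.s ` normal_cone ((*\<^sub>R) \<mu> ` convex_subdiff l1_norm S.s) (- u S.s).
                  infdist x ({x. f x = f S.s} \<inter>
                      {x. \<forall>i\<in>{i. S.s $ i = 0 \<and> u S.s $ i \<in> {- \<mu>, \<mu>}}. \<bar>x $ i - S.s $ i\<bar> \<le> \<rho> i})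
                    \<le> c * (max (infdist x {x. f x = f S.s})
                        (infdist x {x. \<forall>i\<in>{i. S.s $ i = 0 \<and> u S.s $ i \<in> {- \<mu>, \<mu>}}. \<bar>x $ i - S.s $ i\<bar> \<le> \<rho> i}))
                      powr \<gamma>)) \<and>
            \<beta> = 1 - \<gamma> * (1 - \<alpha>)"
      \<comment> \<open>This is (1 + \<beta>) / 2, so the general rate (1 - p) / (2 p - 1) becomes
        (1 - \<beta>) / (2 \<beta>). As \<open>p > 1/2\<close>, only the sublinear regime
        occurs.\<close>
      define p where "p = 1 - \<gamma> * (1 - \<alpha>) / 2"
      have loj: "\<exists>C>0. \<forall>\<^sub>F z in nhds (a, b). 0 \<le> F z - F (a, b) \<longrightarrow>
          (F z - F (a, b)) powr p \<le> C * norm (had.gradF z)"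
        unfolding p_def
        by (rule S.Lojasiewicz_F_convex[of \<alpha> W c \<gamma>]) (use A \<alpha> in blast)+
      have "\<gamma> * (1 - \<alpha>) \<le> 1 * (1 - \<alpha>)" using A \<alpha> by (intro mult_right_mono) auto
      also have "\<dots> < 1" using \<alpha> by simp
      finally have "\<gamma> * (1 - \<alpha>) < 1" .
      moreover have "0 < \<gamma> * (1 - \<alpha>)" using A \<alpha> by simp
      ultimately have p: "1/2 < p" "p < 1" by (simp_all add: p_def)
      have "2 * (1 - p) = 1 - \<beta>" "2 * p - 1 = \<beta>" using A by (auto simp: p_def)
      then have "(1 - p) / (2 * p - 1) = (1 - \<beta>) / (2 * \<beta>)"
        by (metis mult_divide_mult_cancel_left_if zero_neq_numeral)
      then show "(\<lambda>k. norm (z k - (a, b))) \<in> O(\<lambda>k. real k powr (- ((1 - \<beta>) / (2 * \<beta>))))"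
        using rate(1)[OF _ p(2) loj p(1)] p(1) by simp
    qed
  qed
qed

end
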